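(* Let $x>0$. The function $\Theta(s,s,s,x)$ of the complex variable $s$ has singularities exactly at $s=\frac23$ and $s=\frac12-j$, for any $j\in\mathbb{N}\cup\{0\}$. Moreover: (1) around $s=\frac23$, we have $$\Theta(s,s,s,x)=\frac{\Gamma^3\left(\frac13\right)}{2\sqrt3\,\pi\,x^{1/3}\left(s-\frac23\right)}+O(1);$$ (2) around $s=\frac12-j$ (for any $j\in\mathbb{N}\cup\{0\}$), we have $$\Theta(s,s,s,x)=(-1)^j2^{-4j-1}\binom{2j}{j}\left(x^{2j}+x^{-\frac12-j}\right)\frac{\zeta\left(\frac{1-6j}{2}\right)}{\left(s-\left(\frac12-j\right)\right)}+O(1).$$
   Context: $\mathbb{N}=\{1,2,3,\dots\}$. For $x>0$ and $(r,s,t)\in\mathbb{C}^3$ with $\Re(r+t)>1$, $\Re(s+t)>1$, $\Re(r+s+t)>2$, the generalized Mordell–Tornheim zeta function is the absolutely convergent series $\Theta(r,s,t,x)=\sum_{n=1}^{\infty}\sum_{m=1}^{\infty}\frac{1}{n^r m^s (n+mx)^t}$. For fixed $x>0$ it continues meromorphically to $(r,s,t)\in\mathbb{C}^3$, with singularities only on the hyperplanes $r+t=1-\ell$, $s+t=1-\ell$ ($\ell\in\mathbb{N}\cup\{0\}$) and $r+s+t=2$; $\Theta$ also denotes this continuation. $\Theta(s,s,s,x)$ is considered as a meromorphic function of the one complex variable $s$ (given by the double series for $\Re(s)>2/3$); singularities are those that remain after removable ones are filled in. $\zeta$ is the Riemann zeta function. *)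

theory Defs
  imports "HOL-Complex_Analysis.Complex_Analysis" "HOL-Library.Landau_Symbols"
begin

text \<open>
  The predicate \<open>nicely_meromorphic_on\<close> says that removable singularities have been filled in and
  that the value at every pole is 0. This normalisation makes the continuation of a
  function from a nonempty open set \<open>A\<close> unique as a total function
  (\<open>meromorphic_continuation_eqI\<close> below).
\<close>
definition meromorphic_continuation ::
    "(complex \<Rightarrow> complex) \<Rightarrow> complex set \<Rightarrow> complex \<Rightarrow> complex" where
  "meromorphic_continuation f A =
     (THE F. F nicely_meromorphic_on UNIV \<and> (\<forall>s\<in>A. F s = f s))"

definition Riemann_zeta :: "complex \<Rightarrow> complex" where
  "Riemann_zeta =
     meromorphic_continuation (\<lambda>s. \<Sum>\<^sub>\<infinity>n\<in>{1::nat..}. 1 / of_nat n powr s) {s. Re s > 1}"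

definition Theta_series :: "complex \<Rightarrow> complex \<Rightarrow> complex \<Rightarrow> real \<Rightarrow> complex" where
  "Theta_series r s t x =
     (\<Sum>\<^sub>\<infinity>(n, m)\<in>{1::nat..} \<times> {1::nat..}.
        1 / (of_nat n powr r * of_nat m powr s * of_real (real n + real m * x) powr t))"

text \<open>
  The diagonal function \<open>\<Theta>(s,s,s,x)\<close>, as a meromorphic function of the single variable \<open>s\<close>. The
  conditions \<open>Re (r + t) > 1\<close>, \<open>Re (s + t) > 1\<close> and \<open>Re (r + s + t) > 2\<close> for absolute convergence
  of the double series reduce to \<open>Re s > 2/3\<close> when \<open>r = s = t\<close>.
\<close>
definition Theta_diag :: "real \<Rightarrow> complex \<Rightarrow> complex" where
  "Theta_diag x = meromorphic_continuation (\<lambda>s. Theta_series s s s x) {s. Re s > 2/3}"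

definition singularities :: "(complex \<Rightarrow> complex) \<Rightarrow> complex set" where
  "singularities f = {s. \<not> f analytic_on {s}}"

lemma nicely_meromorphic_remove_sings_eq:
  assumes "F nicely_meromorphic_on UNIV"
  shows "remove_sings F z = F z"
proof -
  have "(is_pole F z \<and> F z = 0) \<or> F \<midarrow>z\<rightarrow> F z"
    using assms by (auto simp: nicely_meromorphic_on_def)
  thus ?thesis
  proof
    assume "is_pole F z \<and> F z = 0"
    thus ?thesis
      by (metis is_pole_imp_not_essential remove_sings_eq_0_iff)
  qed (rule remove_sings_eqI)
qed

lemma nicely_meromorphic_unique:
  assumes F: "F nicely_meromorphic_on UNIV" and G: "G nicely_meromorphic_on UNIV"
    and A: "open A" "A \<noteq> {}" and eq: "\<And>s. s \<in> A \<Longrightarrow> F s = G s"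
  shows "F = G"
proof
  fix z
  have "(\<lambda>s. F s - G s) meromorphic_on UNIV"
    using F G by (intro meromorphic_intros) (auto simp: nicely_meromorphic_on_def)
  hence "eventually (\<lambda>s. F s - G s = 0) (cosparse UNIV) \<or>
         eventually (\<lambda>s. F s - G s \<noteq> 0) (cosparse UNIV)"
    by (rule meromorphic_imp_constant_or_avoid) auto
  moreover have "\<not> eventually (\<lambda>s. F s - G s \<noteq> 0) (cosparse UNIV)"
  proof
    assume ev: "eventually (\<lambda>s. F s - G s \<noteq> 0) (cosparse UNIV)"
    obtain a where a: "a \<in> A" using A by auto
    have "eventually (\<lambda>s. F s - G s \<noteq> 0) (at a)"
      using ev by (simp add: eventually_cosparse_open_eq)
    moreover have "eventually (\<lambda>s. s \<in> A) (at a)"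
      using A a by (simp add: eventually_at_in_open')
    ultimately have "eventually (\<lambda>s. False) (at a)"
      by eventually_elim (use eq in auto)
    thus False by simp
  qed
  ultimately have "eventually (\<lambda>s. F s - G s = 0) (cosparse UNIV)"
    by blast
  hence "eventually (\<lambda>s. F s = G s) (at z)"
    by (simp add: eventually_cosparse_open_eq)
  hence "remove_sings F z = remove_sings G z"
    by (intro remove_sings_cong) auto
  thus "F z = G z"
    using F G by (simp add: nicely_meromorphic_remove_sings_eq)
qed

lemma meromorphic_continuation_eqI:
  assumes "F nicely_meromorphic_on UNIV" "open A" "A \<noteq> {}" "\<And>s. s \<in> A \<Longrightarrow> F s = f s"
  shows "meromorphic_continuation f A = F"
  unfolding meromorphic_continuation_def
proof (rule the_equality)
  fix G assume "G nicely_meromorphic_on UNIV \<and> (\<forall>s\<in>A. G s = f s)"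
  thus "G = F" using assms by (intro nicely_meromorphic_unique[of G F A]) auto
qed (use assms in auto)

end

theory Submission
  imports Defs "HOL-Real_Asymp.Real_Asymp"
begin

text \<open>
  Let \<open>L(s,u) = \<Sum> n\<^sup>-\<^sup>s e\<^sup>-\<^sup>n\<^sup>u\<close>. For \<open>Re s > 2/3\<close>, \<open>\<Gamma>(s) \<Theta>(s,s,s,x)\<close> is the Mellin transform of
  \<open>L(s,u) L(s,xu)\<close> in \<open>u\<close>. As \<open>u\<close> tends to \<open>0\<close>,
  \<open>L(s,u) = \<Gamma>(1-s) u\<^sup>s\<^sup>-\<^sup>1 + (\<Sum>k<K. \<zeta>(s-k) (-u)\<^sup>k / k!) + O(u\<^sup>K)\<close>. Since \<open>d/du\<close> lowers \<open>s\<close> by \<open>1\<close>, this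
  follows from the boundedness of \<open>L(s,u) - \<Gamma>(1-s) u\<^sup>s\<^sup>-\<^sup>1\<close>, and that bound is transported by fractional
  integration from \<open>s = -p\<close>, where the difference is \<open>(-1)\<^sup>p (d/du)\<^sup>p (1/(e\<^sup>u-1) - 1/u)\<close>.

  Integrating the product of the two expansions over \<open>(0,1]\<close> gives the continuation. The square of
  the singular terms yields the pole at \<open>2/3\<close>. The cross terms yield
  \<open>\<Gamma>(1-s) \<zeta>(s-k) (-1)\<^sup>k (x\<^sup>k + x\<^sup>s\<^sup>-\<^sup>1) / (k! \<Gamma>(s) (2s-1+k))\<close>, hence the poles at \<open>1/2 - j\<close> for \<open>k = 2j\<close>.
  The denominators \<open>s+k+l\<close>, and \<open>2s-1+k\<close> for odd \<open>k\<close>, are cancelled by zeros of \<open>1/\<Gamma>(s)\<close>. The poles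
  are genuine because \<open>\<zeta>(1/2-3j) \<noteq> 0\<close>: for \<open>j > 0\<close> by the functional equation, for \<open>j = 0\<close> because
  \<open>\<Gamma>(1/2) \<zeta>(1/2)\<close> is the Mellin transform of the negative function \<open>1/(e\<^sup>v-1) - 1/v\<close>.
\<close>

section \<open>Parameter integrals and Mellin transforms\<close>

text \<open>The expansion of \<open>dexp s u\<close> at 0 must hold to every order and uniformly for
  s in compact sets. Expanding the exponentials termwise fails for Re s < 1, where every sum of
  n^(k-s) diverges; fractional integration replaces the usual contour shift and needs no growth
  bound for zeta on vertical lines. The expansion is used only for Re s < 1, where Gamma(1-s) has no
  pole; the half plane Re s > 2/3 belongs to the double series itself. With K Taylor terms the
  remainder is integrable for Re s > (1-K)/2, so each K yields one strip. All strips contain 2/3 <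
  Re s < 1, where they agree with the series, and the identity theorem glues them. The zeta values
  arise as limits at u = 0 and have to be identified with the continuation of the Dirichlet series
  before the residues can be stated. No cancellation is possible at 1/2 - j: a single index k
  contributes to the principal part, and its two powers of x are both positive.\<close>

lemma has_field_derivative_integral_dominated:
  fixes f :: "complex \<Rightarrow> 'a \<Rightarrow> complex"
  assumes r: "r > 0"
    and hol: "\<And>t. t \<in> space M \<Longrightarrow> (\<lambda>s. f s t) holomorphic_on ball z r"
    and meas: "\<And>s. s \<in> ball z r \<Longrightarrow> f s \<in> borel_measurable M"
    and B: "integrable M B" "\<And>s t. s \<in> ball z r \<Longrightarrow> t \<in> space M \<Longrightarrow> norm (f s t) \<le> B t"
  shows "((\<lambda>s. \<integral>t. f s t \<partial>M) has_field_derivative (\<integral>t. deriv (\<lambda>s. f s t) z \<partial>M)) (at z)"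
proof -
  have z: "z \<in> ball z r" using r by simp
  have int: "integrable M (f s)" if "s \<in> ball z r" for s
    by (rule Bochner_Integration.integrable_bound[OF B(1) meas[OF that]])
       (use B(2)[OF that] in \<open>force intro: AE_I2\<close>)
  have der: "((\<lambda>s. f s t) has_field_derivative deriv (\<lambda>s. f s t) y) (at y)"
    if "t \<in> space M" "y \<in> ball z r" for t y
    using hol[OF that(1)] that(2) holomorphic_derivI open_ball by blast
  \<comment> \<open>Cauchy's estimate on the disc of radius r/4, which stays inside
    \<open>ball z r\<close> for y in the ball of half the radius, takes the place of a hypothesis on
    the derivative in s.\<close>
  have dbd: "norm (deriv (\<lambda>s. f s t) y) \<le> 4 * B t / r" if t: "t \<in> space M" and y: "y \<in> ball z (r/2)" for t y
  proof -
    have sub: "cball y (r/4) \<subseteq> ball z r"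
    proof
      fix w assume "w \<in> cball y (r/4)"
      with y have "dist z w < r/2 + r/4"
        using dist_triangle[of z w y] by simp
      thus "w \<in> ball z r" using r by simp
    qed
    have "norm ((deriv ^^ 1) (\<lambda>s. f s t) y) \<le> fact 1 * B t / (r/4) ^ 1"
    proof (rule Cauchy_inequality)
      show "(\<lambda>s. f s t) holomorphic_on ball y (r/4)"
        using hol[OF t] sub ball_subset_cball holomorphic_on_subset by blast
      show "continuous_on (cball y (r/4)) (\<lambda>s. f s t)"
        using hol[OF t] sub holomorphic_on_subset holomorphic_on_imp_continuous_on by blast
      fix x assume "norm (y - x) = r/4"
      hence "x \<in> ball z r" using sub by (auto simp: dist_norm)
      thus "norm (f x t) \<le> B t" using B(2) t by blast
    qed (use r in auto)
    thus ?thesis by (simp add: mult_ac)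
  qed
  have quot: "norm ((f w t - f z t) / (w - z)) \<le> 4 * B t / r"
    if t: "t \<in> space M" and w: "w \<in> ball z (r/2)" for w t
  proof -
    have "norm (f w t - f z t) \<le> 4 * B t / r * norm (w - z)"
    proof (rule field_differentiable_bound[of "ball z (r/2)" "\<lambda>s. f s t" "deriv (\<lambda>s. f s t)"])
      fix y assume y: "y \<in> ball z (r/2)"
      hence "y \<in> ball z r" using r by auto
      thus "((\<lambda>s. f s t) has_field_derivative deriv (\<lambda>s. f s t) y) (at y within ball z (r/2))"
        using der[OF t] has_field_derivative_at_within by blast
      show "norm (deriv (\<lambda>s. f s t) y) \<le> 4 * B t / r" by (rule dbd[OF t y])
    qed (use w r in auto)
    moreover have "B t \<ge> 0" using B(2)[OF z t] norm_ge_zero order_trans by blast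
    ultimately show ?thesis using r by (cases "w = z") (auto simp: norm_divide field_simps)
  qed
  show ?thesis
    unfolding has_field_derivative_iff tendsto_at_iff_sequentially
  proof (intro allI impI)
    fix X :: "nat \<Rightarrow> complex"
    assume X: "\<forall>i. X i \<in> UNIV - {z}" and lim: "X \<longlonglongrightarrow> z"
    have "eventually (\<lambda>n. X n \<in> ball z (r/2)) sequentially"
      using lim r by (intro topological_tendstoD[OF lim]) auto
    then obtain N where N: "\<And>n. n \<ge> N \<Longrightarrow> X n \<in> ball z (r/2)"
      by (auto simp: eventually_sequentially)
    \<comment> \<open>Dropping the first N terms makes the bound on the difference quotient valid
      for every index, as dominated convergence requires; \<open>LIMSEQ_offset\<close> undoes the
      shift.\<close>
    define Y where "Y n = X (n + N)" for n
    have Y: "Y n \<in> ball z (r/2)" "Y n \<noteq> z" for n using N X by (auto simp: Y_def)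
    have Yb: "Y n \<in> ball z r" for n using Y(1)[of n] r by auto
    have Ylim: "Y \<longlonglongrightarrow> z" unfolding Y_def by (rule LIMSEQ_ignore_initial_segment[OF lim])
    have ql: "(\<lambda>n. (f (Y n) t - f z t) / (Y n - z)) \<longlonglongrightarrow> deriv (\<lambda>s. f s t) z" if "t \<in> space M" for t
      using der[OF that z] Y(2) Ylim unfolding has_field_derivative_iff tendsto_at_iff_sequentially o_def
      by auto
    have qm: "(\<lambda>t. (f (Y n) t - f z t) / (Y n - z)) \<in> borel_measurable M" for n
      using meas[OF Yb] meas[OF z] by measurable
    have "(\<lambda>n. \<integral>t. (f (Y n) t - f z t) / (Y n - z) \<partial>M) \<longlonglongrightarrow> (\<integral>t. deriv (\<lambda>s. f s t) z \<partial>M)"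
    proof (rule integral_dominated_convergence[where w = "\<lambda>t. 4 * B t / r"])
      show "(\<lambda>t. deriv (\<lambda>s. f s t) z) \<in> borel_measurable M"
        by (rule borel_measurable_LIMSEQ_metric[OF qm ql])
    qed (use B(1) qm ql quot Y in auto)
    also have "(\<lambda>n. \<integral>t. (f (Y n) t - f z t) / (Y n - z) \<partial>M) =
               (\<lambda>n. ((\<integral>t. f (Y n) t \<partial>M) - (\<integral>t. f z t \<partial>M)) / (Y n - z))"
      using int[OF Yb] int[OF z] by simp
    finally have "(\<lambda>n. ((\<integral>t. f (Y n) t \<partial>M) - (\<integral>t. f z t \<partial>M)) / (Y n - z)) \<longlonglongrightarrow> (\<integral>t. deriv (\<lambda>s. f s t) z \<partial>M)" .
    thus "((\<lambda>w. ((\<integral>t. f w t \<partial>M) - (\<integral>t. f z t \<partial>M)) / (w - z)) \<circ> X) \<longlonglongrightarrow> (\<integral>t. deriv (\<lambda>s. f s t) z \<partial>M)"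
      unfolding Y_def o_def by (rule LIMSEQ_offset)
  qed
qed

section \<open>Holomorphic dependence on a parameter in a vertical strip\<close>

definition complex_box :: "real \<Rightarrow> real \<Rightarrow> real \<Rightarrow> complex set" where
  "complex_box a b T = {s. a \<le> Re s \<and> Re s \<le> b \<and> \<bar>Im s\<bar> \<le> T}"

text \<open>Every point of the open strip has a ball inside some closed box strictly between the
  edges, so a majorant on each such box is enough. Extended real endpoints cover strips, half planes
  and the whole plane at once.\<close>

lemma
  fixes f :: "complex \<Rightarrow> 'a \<Rightarrow> complex" and l h :: ereal
  assumes S: "S = {s. l < ereal (Re s) \<and> ereal (Re s) < h}"
    and hol: "\<And>t. t \<in> space M \<Longrightarrow> (\<lambda>s. f s t) holomorphic_on S"
    and meas: "\<And>s. s \<in> S \<Longrightarrow> f s \<in> borel_measurable M"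
    and dom: "\<And>a b T. l < ereal a \<Longrightarrow> ereal b < h \<Longrightarrow> \<exists>B. integrable M B \<and>
               (\<forall>s\<in>complex_box a b T. \<forall>t\<in>space M. norm (f s t) \<le> B t)"
  shows holomorphic_on_integral_strip: "(\<lambda>s. \<integral>t. f s t \<partial>M) holomorphic_on S" (is ?A)
    and integrable_strip: "s \<in> S \<Longrightarrow> integrable M (f s)"
proof -
  have loc: "\<exists>r>0. ball z r \<subseteq> S \<and> (\<exists>B. integrable M B \<and> (\<forall>s\<in>ball z r. \<forall>t\<in>space M. norm (f s t) \<le> B t))"
    if z: "z \<in> S" for z
  proof -
    obtain a b where a: "l < ereal a" "a < Re z" and b: "ereal b < h" "Re z < b"
      using z ereal_dense2[of l "Re z"] ereal_dense2[of "Re z" h] by (auto simp: S)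
    define r where "r = min (Re z - a) (b - Re z)"
    have r: "r > 0" using a b by (simp add: r_def)
    have box: "s \<in> complex_box a b (\<bar>Im z\<bar> + r)" if "s \<in> ball z r" for s
      using that abs_Re_le_cmod[of "s - z"] abs_Im_le_cmod[of "s - z"]
      by (auto simp: complex_box_def r_def dist_norm norm_minus_commute)
    moreover have "complex_box a b T \<subseteq> S" for T
    proof
      fix s assume "s \<in> complex_box a b T"
      hence "ereal a \<le> ereal (Re s)" "ereal (Re s) \<le> ereal b" by (auto simp: complex_box_def)
      thus "s \<in> S" using a(1) b(1) unfolding S by (blast intro: order.strict_trans2 order.strict_trans1)
    qed
    ultimately show ?thesis
      using r dom[OF a(1) b(1), of "\<bar>Im z\<bar> + r"] by (intro exI[of _ r]) blast
  qed
  have "open S"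
    unfolding open_contains_ball using loc by blast
  thus ?A
    unfolding holomorphic_on_open[OF \<open>open S\<close>]
  proof (intro ballI)
    fix z assume "z \<in> S"
    then obtain r B where rB: "r > 0" "ball z r \<subseteq> S" "integrable M B"
       "\<And>s t. s \<in> ball z r \<Longrightarrow> t \<in> space M \<Longrightarrow> norm (f s t) \<le> B t" using loc by blast
    show "\<exists>f'. ((\<lambda>s. \<integral>t. f s t \<partial>M) has_field_derivative f') (at z)"
      by (rule exI, rule has_field_derivative_integral_dominated[OF rB(1) _ _ rB(3)])
         (use hol meas rB holomorphic_on_subset in blast)+
  qed
  assume s: "s \<in> S"
  then obtain r B where rB: "r > 0" "integrable M B" "\<forall>s\<in>ball s r. \<forall>t\<in>space M. norm (f s t) \<le> B t"
    using loc by blast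
  have "norm (f s t) \<le> norm (B t)" if "t \<in> space M" for t
    using bspec[OF bspec[OF rB(3), of s] that] rB(1) by (auto intro: order.trans[OF _ abs_ge_self])
  thus "integrable M (f s)"
    by (intro Bochner_Integration.integrable_bound[OF rB(2) meas[OF s]] AE_I2)
qed

section \<open>Lebesgue measure on subsets of the line, and Mellin transforms of Laplace
  integrals\<close>

abbreviation lborel_on :: "real set \<Rightarrow> real measure" where
  "lborel_on S \<equiv> restrict_space lborel S"

lemma sigma_finite_lborel_on:
  assumes "S \<in> sets borel"
  shows "sigma_finite_measure (lborel_on S)"
  using assms by (intro sigma_finite_measure_restrict_space lborel.sigma_finite_measure_axioms) auto

lemma integrable_lborel_on_iff:
  fixes f :: "real \<Rightarrow> 'b :: {banach, second_countable_topology}"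
  assumes "S \<in> sets borel"
  shows "integrable (lborel_on S) f \<longleftrightarrow> set_integrable lborel S f"
  using assms by (simp add: integrable_restrict_space set_integrable_def)

lemma integral_lborel_on_eq:
  fixes f :: "real \<Rightarrow> 'b :: {banach, second_countable_topology}"
  assumes "S \<in> sets borel"
  shows "integral\<^sup>L (lborel_on S) f = set_lebesgue_integral lborel S f"
  using assms by (simp add: integral_restrict_space set_lebesgue_integral_def)

lemma integral_lborel_on_cong:
  assumes "\<And>v. v \<in> S \<Longrightarrow> f v = g v"
  shows "integral\<^sup>L (lborel_on S) f = integral\<^sup>L (lborel_on S) g"
  by (intro Bochner_Integration.integral_cong) (simp_all add: assms space_restrict_space)

lemma integrable_lborel_on_cong:
  assumes "\<And>v. v \<in> S \<Longrightarrow> f v = g v"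
  shows "integrable (lborel_on S) f \<longleftrightarrow> integrable (lborel_on S) g"
  by (intro Bochner_Integration.integrable_cong) (simp_all add: assms space_restrict_space)

text \<open>Transfers a value known for a gauge integral, here Euler's integral for Gamma, to the
  Lebesgue integral.\<close>

lemma integral_lborel_on_eqI:
  fixes f :: "real \<Rightarrow> complex"
  assumes S: "S \<in> sets borel" and int: "integrable (lborel_on S) f" and hi: "(f has_integral c) S"
  shows "integral\<^sup>L (lborel_on S) f = c"
proof -
  have "set_integrable lborel S f" using int integrable_lborel_on_iff[OF S] by blast
  hence "(f has_integral set_lebesgue_integral lborel S f) S"
    using has_integral_set_lebesgue set_borel_integral_eq_integral
    by (metis integrable_integral)
  thus ?thesis using hi has_integral_unique integral_lborel_on_eq[OF S] by metis
qed

lemma integrable_lborel_on_absolutely: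
  fixes f :: "real \<Rightarrow> complex"
  assumes "S \<in> sets borel" "f \<in> borel_measurable (lborel_on S)"
  shows "integrable (lborel_on S) f \<longleftrightarrow> f absolutely_integrable_on S"
proof -
  have "(\<lambda>x. indicator S x *\<^sub>R f x) \<in> borel_measurable lborel"
    using assms by (simp add: borel_measurable_restrict_space_iff)
  thus ?thesis
    unfolding integrable_lborel_on_iff[OF assms(1)] set_integrable_def
    by (rule integrable_completion[symmetric])
qed

lemma measurable_lborel_on:
  assumes "continuous_on S f"
  shows "f \<in> borel_measurable (lborel_on S)"
  by (subst measurable_cong_sets[OF sets_restrict_space_cong[of lborel borel] refl])
     (auto intro: borel_measurable_continuous_on_restrict assms)

abbreviation "half_lborel \<equiv> lborel_on {0<..}"
abbreviation "unit_lborel \<equiv> lborel_on {0<..1}"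
abbreviation "tail_lborel \<equiv> lborel_on {1<..}"

text \<open>The value for w = 1 is Euler's integral; substituting w v for v, on the whole line with
  an indicator, produces the power of w.\<close>

lemma Gamma_lborel_on:
  assumes a: "Re a > 0" and w: "w > 0"
  shows "integrable half_lborel (\<lambda>v. of_real v powr (a - 1) * of_real (exp (-(v * w))) :: complex)"
    and "(\<integral>v. of_real v powr (a - 1) * of_real (exp (-(v * w))) \<partial>half_lborel) = (Gamma a * of_real w powr (-a) :: complex)"
proof -
  let ?f = "\<lambda>v::real. of_real v powr (a - 1) * of_real (exp (-(v * w))) :: complex"
  have eq: "?f = (\<lambda>t. complex_of_real t powr (a - 1) / of_real (exp (w * t)))"
    by (auto simp: exp_minus field_simps)
  have m: "?f \<in> borel_measurable half_lborel"
    by (intro measurable_lborel_on continuous_intros) auto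
  have ai: "?f absolutely_integrable_on {0<..}"
    unfolding eq using absolutely_integrable_Gamma_integral[OF a w] .
  thus int: "integrable half_lborel ?f"
    using integrable_lborel_on_absolutely[OF _ m] by simp
  define F :: "real \<Rightarrow> complex" where "F v = of_real v powr (a - 1) * of_real (exp (-v))" for v
  have mF: "F \<in> borel_measurable half_lborel"
    unfolding F_def by (intro measurable_lborel_on continuous_intros) auto
  have Feq: "F = (\<lambda>t. complex_of_real t powr (a - 1) / of_real (exp t))"
    by (auto simp: F_def exp_minus field_simps)
  have "integrable half_lborel F"
    using integrable_lborel_on_absolutely[OF _ mF] absolutely_integrable_Gamma_integral'[OF a]
    unfolding Feq by simp
  hence "integral\<^sup>L half_lborel F = Gamma a"
    by (rule integral_lborel_on_eqI[rotated]) (use Gamma_integral_complex'[OF a] in \<open>simp_all add: Feq\<close>)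
  hence "Gamma a = (\<integral>v. indicator {0<..} v *\<^sub>R F v \<partial>lborel)"
    by (simp add: integral_restrict_space)
  also have "\<dots> = \<bar>w\<bar> *\<^sub>R (\<integral>v. indicator {0<..} (0 + w * v) *\<^sub>R F (0 + w * v) \<partial>lborel)"
    using w by (intro lborel_integral_real_affine) auto
  also have "(\<integral>v. indicator {0<..} (0 + w * v) *\<^sub>R F (0 + w * v) \<partial>lborel) =
      (\<integral>v. of_real w powr (a - 1) * (indicator {0<..} v *\<^sub>R ?f v) \<partial>lborel)"
  proof (intro Bochner_Integration.integral_cong refl)
    fix v :: real
    show "indicator {0<..} (0 + w * v) *\<^sub>R F (0 + w * v) = of_real w powr (a - 1) * (indicator {0<..} v *\<^sub>R ?f v)"
    proof (cases "v > 0")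
      case True
      thus ?thesis using w by (simp add: F_def powr_times_real mult_ac)
    next
      case False
      thus ?thesis using w by (simp add: indicator_def zero_less_mult_iff)
    qed
  qed
  also have "\<dots> = of_real w powr (a - 1) * (\<integral>v. ?f v \<partial>half_lborel)"
    by (subst integral_mult_right_zero, subst integral_restrict_space) simp_all
  finally have *: "Gamma a = of_real w * (of_real w powr (a - 1)) * (\<integral>v. ?f v \<partial>half_lborel)"
    using w by (simp add: scaleR_conv_of_real)
  have "of_real w * (of_real w powr (a - 1)) * (of_real w powr (-a)) = (1 :: complex)"
    using w by (simp add: powr_diff powr_minus field_simps)
  hence "of_real w powr (-a) * Gamma a = (\<integral>v. ?f v \<partial>half_lborel)"
    by (subst *) (simp add: mult_ac)
  thus "(\<integral>v. ?f v \<partial>half_lborel) = Gamma a * of_real w powr (-a)" by (simp add: mult_ac)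
qed

text \<open>Fubini, with Euler's integral for each t. The measure is abstract because three are
  used: counting measure on the naturals (zeta and \<open>dexp\<close>), counting measure on pairs
  (the double series), and Lebesgue measure on the half line (Beta integrals).\<close>

lemma Mellin_laplace:
  fixes c :: "'a \<Rightarrow> complex" and \<tau> :: "'a \<Rightarrow> real"
  assumes M: "sigma_finite_measure M" and a: "Re a > 0"
    and c [measurable]: "c \<in> borel_measurable M" and \<tau> [measurable]: "\<tau> \<in> borel_measurable M"
    and pos: "\<And>t. t \<in> space M \<Longrightarrow> \<tau> t > 0"
    and int: "integrable M (\<lambda>t. norm (c t) * \<tau> t powr (- Re a))"
  shows "integrable half_lborel (\<lambda>v. of_real v powr (a - 1) * (\<integral>t. c t * of_real (exp (-(v * \<tau> t))) \<partial>M))" (is ?A)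
    and "(\<integral>v. of_real v powr (a - 1) * (\<integral>t. c t * of_real (exp (-(v * \<tau> t))) \<partial>M) \<partial>half_lborel) =
          Gamma a * (\<integral>t. c t * of_real (\<tau> t) powr (-a) \<partial>M)" (is ?B)
proof -
  interpret M: sigma_finite_measure M by (rule M)
  interpret L: sigma_finite_measure half_lborel by (rule sigma_finite_lborel_on) auto
  interpret P: pair_sigma_finite M half_lborel ..
  define f where "f t v = c t * (of_real v powr (a - 1) * of_real (exp (-(v * \<tau> t))))" for t v
  have [measurable]: "(\<lambda>v::real. of_real v powr (a - 1) :: complex) \<in> borel_measurable half_lborel"
    by (intro measurable_lborel_on continuous_intros) auto
  have [measurable]: "(\<lambda>v. v) \<in> borel_measurable half_lborel"
    by (intro measurable_lborel_on continuous_intros)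
  \<comment> \<open>The absolute value is again an Euler integrand, with Re a for a, so its integral
    is known exactly and \<open>int\<close> becomes the Fubini condition.\<close>
  have norm_f: "norm (f t v) = norm (c t) * Re (of_real v powr (of_real (Re a) - 1) * of_real (exp (-(v * \<tau> t))))"
    if "v > 0" for t v
  proof -
    have "(of_real v powr (of_real (Re a) - 1) :: complex) = of_real (v powr (Re a - 1))"
      using that by (metis less_imp_le of_real_1 of_real_diff powr_of_real)
    thus ?thesis using that by (simp add: f_def norm_mult norm_powr_real_powr)
  qed
  have ina: "(\<integral>v. norm (f t v) \<partial>half_lborel) = norm (c t) * (Gamma (Re a) * \<tau> t powr (- Re a))"
    if t: "t \<in> space M" for t
  proof -
    have "(\<integral>v. norm (f t v) \<partial>half_lborel) =
      (\<integral>v. norm (c t) * Re (of_real v powr (of_real (Re a) - 1) * of_real (exp (-(v * \<tau> t)))) \<partial>half_lborel)"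
      by (intro integral_lborel_on_cong norm_f) auto
    also have "\<dots> = norm (c t) * Re (\<integral>v. of_real v powr (of_real (Re a) - 1) * of_real (exp (-(v * \<tau> t))) \<partial>half_lborel)"
      using Gamma_lborel_on(1)[of "of_real (Re a)" "\<tau> t"] a pos[OF t]
      by (simp only: integral_mult_right_zero integral_Re Re_complex_of_real)
    also have "\<dots> = norm (c t) * Re (of_real (Gamma (Re a) * \<tau> t powr (- Re a)))"
      using Gamma_lborel_on(2)[of "of_real (Re a)" "\<tau> t"] a pos[OF t]
      by (simp add: Gamma_complex_of_real powr_of_real flip: of_real_minus)
    finally show ?thesis by simp
  qed
  have meas: "case_prod f \<in> borel_measurable (M \<Otimes>\<^sub>M half_lborel)"
    unfolding f_def by measurable
  have I: "integrable (M \<Otimes>\<^sub>M half_lborel) (case_prod f)"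
  proof (rule P.Fubini_integrable[OF meas])
    have "integrable M (\<lambda>t. Gamma (Re a) * (norm (c t) * \<tau> t powr (- Re a)))"
      using int by simp
    also have "?this \<longleftrightarrow> integrable M (\<lambda>t. \<integral>v. norm (case (t, v) of (x, y) \<Rightarrow> f x y) \<partial>half_lborel)"
      by (intro Bochner_Integration.integrable_cong) (auto simp: ina)
    finally show "integrable M (\<lambda>t. \<integral>v. norm (case (t, v) of (x, y) \<Rightarrow> f x y) \<partial>half_lborel)" .
    show "AE t in M. integrable half_lborel (\<lambda>v. case (t, v) of (x, y) \<Rightarrow> f x y)"
      using Gamma_lborel_on(1)[OF a] pos by (auto simp: f_def intro!: AE_I2)
  qed
  have eq: "(\<integral>t. f t v \<partial>M) = of_real v powr (a - 1) * (\<integral>t. c t * of_real (exp (-(v * \<tau> t))) \<partial>M)" for v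
    unfolding f_def by (subst integral_mult_right_zero[symmetric]) (simp add: mult_ac)
  show ?A
    using P.integrable_snd[OF I] by (simp add: eq)
  have "(\<integral>v. \<integral>t. f t v \<partial>M \<partial>half_lborel) = (\<integral>t. \<integral>v. f t v \<partial>half_lborel \<partial>M)"
    by (rule P.Fubini_integral[OF I])
  also have "\<dots> = (\<integral>t. Gamma a * (c t * of_real (\<tau> t) powr (-a)) \<partial>M)"
    using Gamma_lborel_on(2)[OF a] pos
    by (intro Bochner_Integration.integral_cong refl) (auto simp: f_def)
  also have "\<dots> = Gamma a * (\<integral>t. c t * of_real (\<tau> t) powr (-a) \<partial>M)" by simp
  finally show ?B
    by (simp add: eq)
qed

section \<open>The series \<open>\<Sum> n\<^sup>-\<^sup>s e\<^sup>-\<^sup>n\<^sup>z\<close>\<close>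

lemma norm_integral_le_integral:
  fixes f :: "'a \<Rightarrow> 'b :: {banach, second_countable_topology}"
  assumes "integrable M f" "integrable M g" "\<And>x. x \<in> space M \<Longrightarrow> norm (f x) \<le> g x"
  shows "norm (integral\<^sup>L M f) \<le> integral\<^sup>L M g"
  by (rule order_trans[OF integral_norm_bound[of M f] integral_mono[of M "\<lambda>x. norm (f x)" g]])
     (use assms in auto)

text \<open>This is the polylogarithm of order s at exp(-z). Writing the sum as an integral over
  counting measure lets the lemmas on parameter integrals, Mellin transforms and products apply
  directly.\<close>

definition dexp :: "complex \<Rightarrow> complex \<Rightarrow> complex" where
  "dexp s z = (\<integral>n. of_nat (Suc n) powr (-s) * exp (-(of_nat (Suc n) * z)) \<partial>count_space UNIV)"

definition dexp_majorant :: "real \<Rightarrow> real \<Rightarrow> nat \<Rightarrow> real" where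
  "dexp_majorant A d n = real (Suc n) powr A * exp (-(real (Suc n) * d))"

lemma summable_dexp_majorant:
  assumes "d > 0"
  shows "summable (dexp_majorant A d)"
proof (rule summable_comparison_test_bigo)
  show "summable (\<lambda>n. norm (1 / real n ^ 2))"
    using inverse_power_summable[of 2, where 'a = real] by (simp add: field_simps)
  show "dexp_majorant A d \<in> O(\<lambda>n. 1 / real n ^ 2)"
    unfolding dexp_majorant_def using assms by real_asymp
qed

lemma dexp_majorant_nonneg: "dexp_majorant A d n \<ge> 0"
  by (simp add: dexp_majorant_def)

lemma integrable_dexp_majorant:
  assumes "d > 0"
  shows "integrable (count_space UNIV) (dexp_majorant A d)"
  using summable_dexp_majorant[OF assms] dexp_majorant_nonneg
  by (simp add: integrable_count_space_nat_iff)

lemma norm_of_nat_Suc_powr: "norm (of_nat (Suc n) powr s :: complex) = real (Suc n) powr Re s"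
  using norm_powr_real_powr[of "of_nat (Suc n)" s] by simp

lemma norm_dexp_term_le:
  assumes "- Re s \<le> A" "Re z \<ge> d"
  shows "norm (of_nat (Suc n) powr (-s) * exp (-(of_nat (Suc n) * z))) \<le> dexp_majorant A d n"
proof -
  have "norm (of_nat (Suc n) powr (-s) * exp (-(of_nat (Suc n) * z))) =
      real (Suc n) powr (- Re s) * exp (-(real (Suc n) * Re z))"
    unfolding norm_mult norm_of_nat_Suc_powr by (simp flip: of_nat_Suc)
  also have "\<dots> \<le> dexp_majorant A d n"
    unfolding dexp_majorant_def using assms
    by (intro mult_mono powr_mono) (auto intro: mult_left_mono)
  finally show ?thesis .
qed

lemma integrable_dexp:
  assumes "Re z > 0"
  shows "integrable (count_space UNIV) (\<lambda>n. of_nat (Suc n) powr (-s) * exp (-(of_nat (Suc n) * z)))"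
  using assms norm_dexp_term_le[of s "- Re s" "Re z" z]
  by (intro Bochner_Integration.integrable_bound[OF integrable_dexp_majorant[of "Re z" "- Re s"]] AE_I2)
     (auto simp: dexp_majorant_nonneg)

lemma norm_dexp_le:
  assumes "- Re s \<le> A" "Re z \<ge> d" "d > 0"
  shows "norm (dexp s z) \<le> (\<Sum>n. dexp_majorant A d n)"
proof -
  have "norm (dexp s z) \<le> (\<integral>n. dexp_majorant A d n \<partial>count_space UNIV)"
    unfolding dexp_def
    by (rule norm_integral_le_integral)
       (use assms in \<open>auto intro!: integrable_dexp integrable_dexp_majorant norm_dexp_term_le simp del: of_nat_Suc\<close>)
  also have "\<dots> = (\<Sum>n. dexp_majorant A d n)"
    by (rule integral_count_space_nat[OF integrable_dexp_majorant[OF assms(3)]])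
  finally show ?thesis .
qed

lemma ball_Re_less:
  assumes "w \<in> ball z r"
  shows "\<bar>Re w - Re z\<bar> < r"
  using assms abs_Re_le_cmod[of "w - z"] by (auto simp: dist_norm norm_minus_commute)

lemma holomorphic_dexp:
  assumes "Re z > 0"
  shows "(\<lambda>s. dexp s z) holomorphic_on A"
proof -
  have "(\<lambda>s. dexp s z) holomorphic_on UNIV"
    unfolding dexp_def
  proof (rule holomorphic_on_integral_strip[where l = "-\<infinity>" and h = \<infinity>])
    fix a b T
    show "\<exists>B. integrable (count_space UNIV) B \<and> (\<forall>s\<in>complex_box a b T. \<forall>n\<in>space (count_space UNIV).
            norm (of_nat (Suc n) powr (-s) * exp (- (of_nat (Suc n) * z))) \<le> B n)"
      using assms
      by (intro exI[of _ "dexp_majorant (-a) (Re z)"] conjI ballI norm_dexp_term_le integrable_dexp_majorant)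
         (auto simp: complex_box_def)
  qed (auto intro!: holomorphic_intros simp del: of_nat_Suc)
  thus ?thesis by (rule holomorphic_on_subset) auto
qed

lemma has_field_derivative_dexp:
  assumes "Re z > 0"
  shows "((\<lambda>z. dexp s z) has_field_derivative - dexp (s - 1) z) (at z)"
proof -
  define f where "f z n = of_nat (Suc n) powr (-s) * exp (-(of_nat (Suc n) * z))" for z and n :: nat
  have "((\<lambda>z. \<integral>n. f z n \<partial>count_space UNIV) has_field_derivative
          (\<integral>n. deriv (\<lambda>z. f z n) z \<partial>count_space UNIV)) (at z)"
  proof (rule has_field_derivative_integral_dominated)
    fix w t assume "w \<in> ball z (Re z / 2)"
    hence "Re w \<ge> Re z / 2" using ball_Re_less[of w z "Re z / 2"] by linarith
    thus "norm (f w t) \<le> dexp_majorant (- Re s) (Re z / 2) t"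
      unfolding f_def by (intro norm_dexp_term_le) auto
  qed (use assms in \<open>auto simp: f_def intro!: holomorphic_intros integrable_dexp_majorant\<close>)
  also have "(\<lambda>n. deriv (\<lambda>z. f z n) z) = (\<lambda>n. - (of_nat (Suc n) powr (-(s - 1)) * exp (-(of_nat (Suc n) * z))))"
  proof
    fix n
    have "((\<lambda>z. f z n) has_field_derivative
             of_nat (Suc n) powr (-s) * (exp (-(of_nat (Suc n) * z)) * (- of_nat (Suc n)))) (at z)"
      unfolding f_def by (rule derivative_eq_intros refl)+ (simp flip: of_nat_Suc)
    hence "deriv (\<lambda>z. f z n) z = of_nat (Suc n) powr (-s) * (exp (-(of_nat (Suc n) * z)) * (- of_nat (Suc n)))"
      by (rule DERIV_imp_deriv)
    also have "\<dots> = - (of_nat (Suc n) powr (-(s - 1)) * exp (-(of_nat (Suc n) * z)))"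
    proof -
      have "of_nat (Suc n) powr (-(s - 1)) = (of_nat (Suc n) powr (-s) * of_nat (Suc n) :: complex)"
        using powr_add[of "of_nat (Suc n) :: complex" "-s" 1] by (simp flip: of_nat_Suc)
      thus ?thesis by (simp add: mult_ac del: of_nat_Suc)
    qed
    finally show "deriv (\<lambda>z. f z n) z = - (of_nat (Suc n) powr (-(s - 1)) * exp (-(of_nat (Suc n) * z)))" .
  qed
  finally show ?thesis by (simp add: f_def dexp_def)
qed

lemma dexp_0:
  assumes "Re z > 0"
  shows "dexp 0 z = 1 / (exp z - 1)"
proof -
  have "dexp 0 z = (\<Sum>n. of_nat (Suc n) powr (-0) * exp (-(of_nat (Suc n) * z)))"
    unfolding dexp_def by (rule integral_count_space_nat[OF integrable_dexp[OF assms]])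
  also have "(\<lambda>n. of_nat (Suc n) powr (-0) * exp (-(of_nat (Suc n) * z))) = (\<lambda>n. exp (-z) * exp (-z) ^ n)"
    by (auto simp: exp_add [symmetric] exp_of_nat_mult [symmetric] ring_distribs simp flip: of_nat_Suc)
       (simp add: ring_distribs exp_diff exp_minus field_simps)
  also have "(\<Sum>n. exp (-z) * exp (-z) ^ n) = exp (-z) * (1 / (1 - exp (-z)))"
    using assms by (intro sums_unique[symmetric] sums_mult geometric_sums) simp
  also have "\<dots> = 1 / (exp z - 1)"
  proof -
    have "norm (exp z) \<noteq> 1" using assms by simp
    hence "exp z \<noteq> 1" by (metis norm_one)
    thus ?thesis by (simp add: exp_minus field_simps)
  qed
  finally show ?thesis .
qed

text \<open>Factoring out \<open>e\<^sup>-\<^sup>u\<^sup>/\<^sup>2\<close> works because \<open>n u \<ge> (n + u) / 2\<close> for \<open>n, u \<ge> 1\<close>.\<close>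
lemma norm_dexp_le_exp:
  assumes "- Re s \<le> A" "u \<ge> 1"
  shows "norm (dexp s (of_real u)) \<le> exp (-(u / 2)) * (\<Sum>n. dexp_majorant A (1/2) n)"
proof -
  have "norm (dexp s (of_real u)) \<le> (\<integral>n. exp (-(u / 2)) * dexp_majorant A (1/2) n \<partial>count_space UNIV)"
    unfolding dexp_def
  proof (rule norm_integral_le_integral)
    fix n :: nat
    have "norm (of_nat (Suc n) powr (-s) * exp (-(of_nat (Suc n) * complex_of_real u))) \<le> dexp_majorant A u n"
      using assms by (intro norm_dexp_term_le) auto
    also have "\<dots> \<le> exp (-(u / 2)) * dexp_majorant A (1/2) n"
    proof -
      have "(real (Suc n) - 1) * (u - 1) \<ge> 0" using assms by (intro mult_nonneg_nonneg) auto
      moreover have "(1 + real n) * 1 \<le> (1 + real n) * u" "1 * u \<le> (1 + real n) * u"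
        using assms by (auto intro!: mult_left_mono mult_right_mono)
      ultimately have "u / 2 + real (Suc n) * (1/2) \<le> real (Suc n) * u"
        by (simp add: field_simps)
      hence "exp (-(real (Suc n) * u)) \<le> exp (-(u/2)) * exp (-(real (Suc n) * (1/2)))"
        unfolding exp_add [symmetric] exp_le_cancel_iff by linarith
      thus ?thesis unfolding dexp_majorant_def
        by (simp add: mult.left_commute mult_left_mono del: of_nat_Suc)
    qed
    finally show "norm (of_nat (Suc n) powr (-s) * exp (-(of_nat (Suc n) * complex_of_real u))) \<le>
       exp (-(u / 2)) * dexp_majorant A (1/2) n" .
  qed (use assms in \<open>auto intro!: integrable_dexp integrable_dexp_majorant simp del: of_nat_Suc\<close>)
  also have "\<dots> = exp (-(u / 2)) * (\<Sum>n. dexp_majorant A (1/2) n)"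
    using integral_count_space_nat[OF integrable_dexp_majorant[of "1/2" A]] by simp
  finally show ?thesis .
qed

lemma suminf_dexp_nonneg:
  assumes "d > 0" shows "(\<Sum>n. dexp_majorant A d n) \<ge> 0"
  by (rule suminf_nonneg[OF summable_dexp_majorant[OF assms] dexp_majorant_nonneg])

section \<open>The function \<open>1 / (e\<^sup>z - 1) - 1 / z\<close>\<close>

definition bose :: "complex \<Rightarrow> complex" where
  "bose z = (if z = 0 then -1/2 else 1 / (exp z - 1) - 1 / z)"

text \<open>The zeros of exp z - 1 other than 0 are the nonzero multiples of 2 pi i. Since 6 < 2 pi,
  this open set contains the real axis and the right half plane but none of them.\<close>

definition bose_domain :: "complex set" where
  "bose_domain = {z. \<bar>Im z\<bar> < 6} \<union> {z. Re z > 0}"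

lemma open_bose_domain: "open bose_domain"
  unfolding bose_domain_def
  by (intro open_Un open_Collect_less continuous_intros)

lemma exp_neq_1_bose_domain:
  assumes "z \<in> bose_domain" "z \<noteq> 0"
  shows "exp z \<noteq> 1"
proof
  assume "exp z = 1"
  then obtain n :: int where n: "Re z = 0" "Im z = of_int (2 * n) * pi"
    by (auto simp: exp_eq_1)
  from n(1) assms have "\<bar>Im z\<bar> < 6" by (auto simp: bose_domain_def)
  moreover have "n \<noteq> 0" using n assms by (auto simp: complex_eq_iff)
  hence "\<bar>real_of_int (2 * n)\<bar> \<ge> 2" by simp
  hence "2 * pi \<le> \<bar>Im z\<bar>" unfolding n(2) abs_mult by (intro mult_mono) auto
  ultimately show False using pi_gt3 by linarith
qed

text \<open>With k(z) = (exp z - 1)/z the function equals -((k z - k 0)/z) / k z, so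
  differentiability of k at 0 gives a limit; its value is then read off along the positive real
  axis.\<close>

lemma bose_tendsto_0: "(\<lambda>z. 1 / (exp z - 1) - 1 / z) \<midarrow>0\<rightarrow> (-1/2 :: complex)"
proof -
  define k where "k z = (if z = 0 then 1 else (exp z - 1) / z)" for z :: complex
  have "(\<lambda>z. (exp z - exp 0) / (z - 0)) \<midarrow>0\<rightarrow> exp (0::complex)"
    using DERIV_exp[of "0::complex"] unfolding has_field_derivative_iff .
  hence "(\<lambda>z::complex. (exp z - 1) / z) \<midarrow>0\<rightarrow> 1" by simp
  hence hol: "k holomorphic_on UNIV"
    unfolding k_def by (intro removable_singularity[of "\<lambda>z. (exp z - 1) / z"] holomorphic_intros) auto
  then obtain k' where "(k has_field_derivative k') (at 0)"
    by (metis UNIV_I holomorphic_derivI open_UNIV)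
  hence "(\<lambda>z. (k z - k 0) / (z - 0)) \<midarrow>0\<rightarrow> k'" by (simp add: has_field_derivative_iff)
  moreover have "k \<midarrow>0\<rightarrow> k 0"
    using hol by (metis holomorphic_on_imp_continuous_on continuous_on_eq_continuous_at UNIV_I isContD open_UNIV)
  moreover have "k 0 \<noteq> 0" by (simp add: k_def)
  ultimately have "(\<lambda>z. - ((k z - k 0) / (z - 0)) / k z) \<midarrow>0\<rightarrow> - k' / k 0"
    by (intro tendsto_intros)
  moreover have "eventually (\<lambda>z. - ((k z - k 0) / (z - 0)) / k z = 1 / (exp z - 1) - 1 / z) (at 0)"
  proof -
    have "eventually (\<lambda>z::complex. z \<in> bose_domain) (at 0)"
      by (intro eventually_at_in_open' open_bose_domain) (simp add: bose_domain_def)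
    moreover have "eventually (\<lambda>z::complex. z \<noteq> 0) (at 0)" by (simp add: eventually_at_filter)
    ultimately show ?thesis
    proof eventually_elim
      case (elim z)
      hence "exp z - 1 \<noteq> 0" using exp_neq_1_bose_domain by auto
      thus ?case using elim by (simp add: k_def field_simps)
    qed
  qed
  ultimately have *: "(\<lambda>z. 1 / (exp z - 1) - 1 / z) \<midarrow>0\<rightarrow> - k' / k 0"
    by (rule Lim_transform_eventually)
  have "filterlim complex_of_real (at 0) (at_right 0)"
    unfolding filterlim_at
    by (auto simp: eventually_at_filter intro!: tendsto_eq_intros)
  from filterlim_compose[OF * this]
  have "((\<lambda>x. complex_of_real (1 / (exp x - 1) - 1 / x)) \<longlongrightarrow> - k' / k 0) (at_right 0)"
    by (simp add: exp_of_real)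
  moreover have "((\<lambda>x::real. 1 / (exp x - 1) - 1 / x) \<longlongrightarrow> -1/2) (at_right 0)"
    by real_asymp
  hence "((\<lambda>x. complex_of_real (1 / (exp x - 1) - 1 / x)) \<longlongrightarrow> of_real (-1/2)) (at_right 0)"
    by (rule tendsto_of_real)
  ultimately have "- k' / k 0 = of_real (-1/2)"
    using tendsto_unique trivial_limit_at_right_real by blast
  with * show ?thesis by (simp only: of_real_minus of_real_divide of_real_1 of_real_numeral)
qed

lemma bose_holomorphic: "bose holomorphic_on bose_domain"
  unfolding bose_def
  by (intro removable_singularity bose_tendsto_0 open_bose_domain holomorphic_intros)
     (use exp_neq_1_bose_domain in auto)

lemma of_real_in_bose_domain [simp]: "complex_of_real v \<in> bose_domain"
  by (simp add: bose_domain_def)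

text \<open>On the positive axis this is \<open>dreg\<close> at the exponent -p, continued
  analytically across the origin. The sign cancels the one that each differentiation of
  \<open>dexp\<close> produces.\<close>

definition bosed :: "nat \<Rightarrow> complex \<Rightarrow> complex" where
  "bosed p z = (-1) ^ p * (deriv ^^ p) bose z"

lemma bosed_holomorphic: "bosed p holomorphic_on bose_domain"
  unfolding bosed_def
  by (intro holomorphic_intros holomorphic_higher_deriv bose_holomorphic open_bose_domain)

lemma bosed_eq:
  assumes "Re z > 0"
  shows "bosed p z = dexp (- of_nat p) z - fact p / z ^ Suc p"
  using assms
proof (induction p arbitrary: z)
  case 0
  thus ?case using dexp_0[of z] by (auto simp: bosed_def bose_def)
next
  case (Suc p)
  have "((\<lambda>z. dexp (- of_nat p) z - fact p * inverse z ^ Suc p) has_field_derivative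
          (- dexp (- of_nat p - 1) z - fact p * (of_nat (Suc p) * inverse z ^ p * - (inverse z * inverse z)))) (at z)"
    using Suc.prems
    by (auto intro!: derivative_eq_intros has_field_derivative_dexp simp del: power_Suc)
  hence "((\<lambda>z. dexp (- of_nat p) z - fact p / z ^ Suc p) has_field_derivative
          (- dexp (- of_nat p - 1) z + fact (Suc p) / z ^ Suc (Suc p))) (at z)"
    by (simp add: divide_inverse power_inverse mult_ac)
  moreover have "open {z. Re z > 0}" by (intro open_Collect_less continuous_intros)
  ultimately have "(bosed p has_field_derivative (- dexp (- of_nat p - 1) z + fact (Suc p) / z ^ Suc (Suc p))) (at z)"
    by (rule has_field_derivative_transform_within_open[where S = "{z. Re z > 0}"])
       (use Suc.IH Suc.prems in auto)
  hence "((\<lambda>z. (-1) ^ p * bosed p z) has_field_derivative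
          (-1) ^ p * (- dexp (- of_nat p - 1) z + fact (Suc p) / z ^ Suc (Suc p))) (at z)"
    by (intro DERIV_cmult)
  hence "(deriv ^^ Suc p) bose z = (-1) ^ p * (- dexp (- of_nat p - 1) z + fact (Suc p) / z ^ Suc (Suc p))"
    by (simp add: bosed_def DERIV_imp_deriv flip: mult.assoc power_mult_distrib)
  moreover have "(-1) ^ Suc p * ((-1) ^ p * w) = - w" for w :: complex
    by (simp flip: mult.assoc power_mult_distrib)
  moreover have "dexp (- of_nat p - 1) z = dexp (- of_nat (Suc p)) z"
    by (rule arg_cong[of _ _ "\<lambda>s. dexp s z"]) simp
  ultimately show ?case by (simp only: bosed_def) simp
qed

lemma norm_bose_le:
  assumes "Re z > 0"
  shows "norm (bose z) \<le> 2 / Re z"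
proof -
  have "Re z \<le> exp (Re z) - 1" using exp_ge_add_one_self[of "Re z"] by linarith
  also have "\<dots> = norm (exp z) - norm (1::complex)" by simp
  also have "\<dots> \<le> norm (exp z - 1)" by (rule norm_triangle_ineq2)
  finally have 1: "norm (1 / (exp z - 1)) \<le> 1 / Re z"
    using assms by (simp add: norm_divide divide_left_mono frac_le)
  have 2: "norm (1 / z) \<le> 1 / Re z"
    using assms complex_Re_le_cmod[of z] by (simp add: norm_divide frac_le)
  have "norm (bose z) \<le> norm (1 / (exp z - 1)) + norm (1 / z)"
    using assms by (auto simp: bose_def norm_triangle_ineq4)
  thus ?thesis using 1 2 by simp
qed

text \<open>For large v, Cauchy's estimate on the disc of radius v/2 turns the bound 2 / Re z for
  \<open>bose\<close> into the order v^(-p-1); for small v compactness suffices.\<close>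

lemma bosed_bound:
  obtains C where "C \<ge> 0" "\<And>v. v \<ge> 0 \<Longrightarrow> norm (bosed p (of_real v)) \<le> C / (1 + v) ^ Suc p"
proof -
  have "continuous_on {0..2} (\<lambda>v. bosed p (of_real v))"
    by (rule continuous_on_compose2[OF holomorphic_on_imp_continuous_on[OF bosed_holomorphic]])
       (auto intro!: continuous_intros)
  hence "bounded ((\<lambda>v. bosed p (of_real v)) ` {0..2})"
    by (intro compact_imp_bounded compact_continuous_image) auto
  then obtain C1 where C1: "\<And>v. v \<in> {0..2} \<Longrightarrow> norm (bosed p (of_real v)) \<le> C1"
    unfolding bounded_iff by blast
  have C1pos: "C1 \<ge> 0" using order_trans[OF norm_ge_zero C1[of 0]] by simp
  \<comment> \<open>The Cauchy bound p! (4/v) / (v/2)^p, together with the factor 2^(p+1) lost in v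
    >= (1+v)/2.\<close>
  define C2 where "C2 = (fact p * 4 * 2 ^ p * 2 ^ Suc p :: real)"
  have C2pos: "C2 \<ge> 0" by (simp add: C2_def)
  show ?thesis
  proof (rule that[of "C1 * 3 ^ Suc p + C2"])
    show "C1 * 3 ^ Suc p + C2 \<ge> 0" using C1pos C2pos by simp
    fix v :: real assume v: "v \<ge> 0"
    show "norm (bosed p (of_real v)) \<le> (C1 * 3 ^ Suc p + C2) / (1 + v) ^ Suc p"
    proof (cases "v \<le> 2")
      case True
      have "norm (bosed p (of_real v)) * (1 + v) ^ Suc p \<le> C1 * 3 ^ Suc p"
        using True v C1pos by (intro mult_mono C1 power_mono) auto
      thus ?thesis using v C2pos by (simp add: field_simps del: power_Suc)
    next
      case False
      have "norm ((deriv ^^ p) bose (of_real v)) \<le> fact p * (4 / v) / (v / 2) ^ p"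
      proof (rule Cauchy_inequality)
        have sub: "cball (of_real v) (v / 2) \<subseteq> {z. Re z \<ge> v / 2}"
        proof safe
          fix z assume "z \<in> cball (complex_of_real v) (v/2)"
          thus "Re z \<ge> v / 2" using abs_Re_le_cmod[of "of_real v - z"] by (auto simp: dist_norm)
        qed
        have sub': "cball (of_real v) (v / 2) \<subseteq> bose_domain"
          using sub False by (auto simp: bose_domain_def)
        show "bose holomorphic_on ball (of_real v) (v / 2)"
          using sub' ball_subset_cball by (blast intro: holomorphic_on_subset[OF bose_holomorphic])
        show "continuous_on (cball (of_real v) (v / 2)) bose"
          using sub' by (intro holomorphic_on_imp_continuous_on holomorphic_on_subset[OF bose_holomorphic])
        fix z assume "norm (complex_of_real v - z) = v / 2"
        hence "Re z \<ge> v / 2" using sub by (auto simp: dist_norm subset_iff)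
        thus "norm (bose z) \<le> 4 / v"
          using norm_bose_le[of z] False by (intro order.trans[OF norm_bose_le]) (auto simp: field_simps)
      qed (use False in auto)
      also have "\<dots> = fact p * 4 * 2 ^ p / v ^ Suc p"
        using False by (simp add: field_simps)
      also have "\<dots> \<le> fact p * 4 * 2 ^ p / ((1 + v) / 2) ^ Suc p"
        using False by (intro divide_left_mono power_mono mult_pos_pos zero_less_power) auto
      also have "\<dots> = C2 / (1 + v) ^ Suc p"
        by (simp add: C2_def field_simps)
      also have "\<dots> \<le> (C1 * 3 ^ Suc p + C2) / (1 + v) ^ Suc p"
        using C1pos v by (intro divide_right_mono) auto
      finally show ?thesis by (simp add: bosed_def norm_mult norm_power)
    qed
  qed
qed

text \<open>A Beta integral obtained from two Euler integrals: p!/(u+v)^(p+1) is the Laplace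
  transform in v of t^p exp(-t u), so \<open>Mellin_laplace\<close> applies with Lebesgue measure in
  t.\<close>

lemma Mellin_inverse_power:
  assumes u: "u > 0" and a: "0 < Re a" "Re a < real p + 1"
  shows "integrable half_lborel (\<lambda>v. of_real v powr (a - 1) * (fact p / of_real (u + v) ^ Suc p) :: complex)" (is ?A)
    and "(\<integral>v. of_real v powr (a - 1) * (fact p / of_real (u + v) ^ Suc p) \<partial>half_lborel) =
           Gamma a * (Gamma (of_nat p + 1 - a) * of_real u powr (a - of_nat p - 1))" (is ?B)
proof -
  define c where "c t = (of_real t powr (of_nat p) * of_real (exp (-(t * u))) :: complex)" for t :: real
  have cm: "c \<in> borel_measurable half_lborel"
    unfolding c_def by (intro measurable_lborel_on continuous_intros) auto
  have idm: "(\<lambda>t. t) \<in> borel_measurable half_lborel"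
    by (intro measurable_lborel_on continuous_intros)
  have prod: "c t * of_real t powr (-a) = of_real t powr ((of_nat p + 1 - a) - 1) * of_real (exp (-(t * u)))"
    if "t > 0" for t
    using that by (simp add: c_def powr_diff powr_minus field_simps)
  have G: "Re (of_nat p + 1 - a) > 0" using a by simp
  have I: "integrable half_lborel (\<lambda>t. c t * of_real t powr (-a))"
    using Gamma_lborel_on(1)[OF G u] 
    by (rule integrable_lborel_on_cong[THEN iffD2, rotated]) (simp add: prod)
  have int: "integrable half_lborel (\<lambda>t. norm (c t) * t powr (- Re a))"
    using integrable_norm[OF I]
    by (rule integrable_lborel_on_cong[THEN iffD2, rotated]) (simp add: norm_mult norm_powr_real_powr)
  have inner: "(\<integral>t. c t * of_real (exp (-(v * t))) \<partial>half_lborel) = fact p / of_real (u + v) ^ Suc p"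
    if v: "v > 0" for v
  proof -
    have "(\<integral>t. c t * of_real (exp (-(v * t))) \<partial>half_lborel) =
          (\<integral>t. of_real t powr ((of_nat p + 1) - 1) * of_real (exp (-(t * (u + v)))) \<partial>half_lborel)"
    proof (intro Bochner_Integration.integral_cong refl)
      fix t :: real
      have "exp (-(t * (u + v))) = exp (-(t * u)) * exp (-(v * t))"
        by (simp add: exp_add [symmetric] algebra_simps)
      thus "c t * of_real (exp (-(v * t))) = of_real t powr ((of_nat p + 1) - 1) * of_real (exp (-(t * (u + v))))"
        by (simp add: c_def)
    qed
    also have "\<dots> = Gamma (of_nat p + 1) * of_real (u + v) powr (-(of_nat p + 1))"
      by (rule Gamma_lborel_on(2)) (use u v in auto)
    also have "of_real (u + v) powr (-(of_nat p + 1)) = 1 / (of_real (u + v) ^ Suc p :: complex)"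
    proof -
      have "of_real (u + v) powr (of_nat (Suc p)) = (of_real (u + v) ^ Suc p :: complex)"
        using u v by (intro powr_nat') (auto simp flip: of_real_add)
      thus ?thesis by (simp only: powr_minus of_nat_Suc add.commute[of 1] divide_inverse) simp
    qed
    finally show ?thesis by (simp add: Gamma_fact add.commute)
  qed
  note * = Mellin_laplace[OF sigma_finite_lborel_on a(1) cm idm _ int]
  show ?A
    using *(1) 
    by (rule integrable_lborel_on_cong[THEN iffD2, rotated]) (auto simp: inner space_restrict_space)
  have "(\<integral>v. of_real v powr (a - 1) * (fact p / of_real (u + v) ^ Suc p) \<partial>half_lborel) =
      (\<integral>v. of_real v powr (a - 1) * (\<integral>t. c t * of_real (exp (-(v * t))) \<partial>half_lborel) \<partial>half_lborel)"
    by (intro Bochner_Integration.integral_cong refl) (auto simp: inner space_restrict_space)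
  also have "\<dots> = Gamma a * (\<integral>t. c t * of_real t powr (-a) \<partial>half_lborel)"
    by (rule *(2)) (auto simp: space_restrict_space)
  also have "(\<integral>t. c t * of_real t powr (-a) \<partial>half_lborel) =
     (\<integral>t. of_real t powr ((of_nat p + 1 - a) - 1) * of_real (exp (-(t * u))) \<partial>half_lborel)"
    by (intro integral_lborel_on_cong prod) auto
  also have "\<dots> = Gamma (of_nat p + 1 - a) * of_real u powr (-(of_nat p + 1 - a))"
    by (rule Gamma_lborel_on(2)[OF G u])
  finally show ?B
    by (simp add: algebra_simps)
qed

lemma integrable_powr_over_power:
  assumes "-1 < \<alpha>" "\<alpha> < real p"
  shows "integrable half_lborel (\<lambda>v. v powr \<alpha> / (1 + v) ^ Suc p)"
proof -
  have "integrable half_lborel 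
     (\<lambda>v. norm (of_real v powr (of_real (\<alpha> + 1) - 1) * (fact p / of_real (1 + v) ^ Suc p) :: complex) / fact p)"
    using assms by (intro Bochner_Integration.integrable_divide_zero integrable_norm Mellin_inverse_power) auto
  thus ?thesis
  proof (rule integrable_lborel_on_cong[THEN iffD2, rotated])
    fix v :: real assume "v \<in> {0<..}"
    hence v: "v > 0" by simp
    have "norm (of_real (1 + v) ^ Suc p :: complex) = (1 + v) ^ Suc p"
      unfolding norm_power norm_of_real using v by simp
    thus "v powr \<alpha> / (1 + v) ^ Suc p =
       norm (of_real v powr (of_real (\<alpha> + 1) - 1) * (fact p / of_real (1 + v) ^ Suc p) :: complex) / fact p"
      using v by (simp add: norm_mult norm_divide norm_powr_real_powr del: of_real_add power_Suc)
  qed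
qed

section \<open>The regularised series and its limit at the origin\<close>

definition dreg :: "complex \<Rightarrow> real \<Rightarrow> complex" where
  "dreg s u = dexp s (of_real u) - Gamma (1 - s) * of_real u powr (s - 1)"

text \<open>Two powers, so that one function dominates all exponents Re s between a and b: the first
  is decisive for v <= 1, the second for v >= 1.\<close>

definition bose_majorant :: "nat \<Rightarrow> real \<Rightarrow> real \<Rightarrow> real \<Rightarrow> real" where
  "bose_majorant p a b v = (v powr (a + real p - 1) + v powr (b + real p - 1)) / (1 + v) ^ Suc p"

lemma integrable_bose_majorant:
  assumes "- real p < a" "a < 1" "- real p < b" "b < 1"
  shows "integrable half_lborel (bose_majorant p a b)"
  unfolding bose_majorant_def add_divide_distrib
  by (intro Bochner_Integration.integrable_add integrable_powr_over_power) (use assms in auto)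

lemma powr_le_powr_add_powr:
  fixes v :: real
  assumes "v > 0" "a \<le> c" "c \<le> b"
  shows "v powr c \<le> v powr a + v powr b"
proof (cases "v \<le> 1")
  case True
  have "v powr c \<le> v powr a" using assms True by (intro powr_mono') auto
  thus ?thesis by (simp add: add_increasing2)
next
  case False
  have "v powr c \<le> v powr b" using assms False by (intro powr_mono) auto
  thus ?thesis by (simp add: add_increasing)
qed

abbreviation bosed_kernel :: "nat \<Rightarrow> complex \<Rightarrow> real \<Rightarrow> real \<Rightarrow> complex" where
  "bosed_kernel p s w v \<equiv> of_real v powr (s + of_nat p - 1) * bosed p (of_real w)"

text \<open>The right-hand side is free of u, which later allows u to tend to 0 by dominated
  convergence.\<close>

lemma norm_bose_integrand_le:
  assumes C: "\<And>v. v \<ge> 0 \<Longrightarrow> norm (bosed p (of_real v)) \<le> C / (1 + v) ^ Suc p" "C \<ge> 0"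
    and "a \<le> Re s" "Re s \<le> b" "u \<ge> 0" "v > 0"
  shows "norm (bosed_kernel p s (u + v) v) \<le> C * bose_majorant p a b v"
proof -
  have "norm (bosed_kernel p s (u + v) v) \<le>
      v powr (Re s + real p - 1) * (C / (1 + v) ^ Suc p)"
    unfolding norm_mult
  proof (intro mult_mono)
    have "norm (bosed p (of_real (u + v))) \<le> C / (1 + (u + v)) ^ Suc p"
      using assms by (intro C(1)) auto
    also have "\<dots> \<le> C / (1 + v) ^ Suc p"
      using assms by (intro divide_left_mono power_mono mult_pos_pos zero_less_power) auto
    finally show "norm (bosed p (of_real (u + v))) \<le> C / (1 + v) ^ Suc p" .
  qed (use assms in \<open>auto simp: norm_powr_real_powr\<close>)
  also have "\<dots> \<le> (v powr (a + real p - 1) + v powr (b + real p - 1)) * (C / (1 + v) ^ Suc p)"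
    using assms by (intro mult_right_mono powr_le_powr_add_powr) auto
  finally show ?thesis by (simp add: bose_majorant_def mult_ac)
qed

lemma measurable_bose_integrand:
  assumes "u \<ge> 0"
  shows "(\<lambda>v. bosed_kernel p s (u + v) v) \<in> borel_measurable half_lborel"
proof (intro measurable_lborel_on continuous_intros)
  show "continuous_on {0<..} (\<lambda>v. bosed p (of_real (u + v)))"
    by (rule continuous_on_compose2[OF holomorphic_on_imp_continuous_on[OF bosed_holomorphic]])
       (auto intro!: continuous_intros simp flip: of_real_add)
qed auto

lemma
  assumes u: "u \<ge> 0"
  shows holomorphic_bose_integral:
      "(\<lambda>s. \<integral>v. bosed_kernel p s (u + v) v \<partial>half_lborel)
         holomorphic_on {s. - real p < Re s \<and> Re s < 1}" (is ?A)
    and integrable_bose_integrand: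
      "- real p < Re s \<Longrightarrow> Re s < 1 \<Longrightarrow>
         integrable half_lborel (\<lambda>v. bosed_kernel p s (u + v) v)" (is "PROP ?B")
proof -
  obtain C where C: "C \<ge> 0" "\<And>v. v \<ge> 0 \<Longrightarrow> norm (bosed p (of_real v)) \<le> C / (1 + v) ^ Suc p"
    using bosed_bound by blast
  define f where "f s v = bosed_kernel p s (u + v) v" for s v
  have dom: "\<exists>B. integrable half_lborel B \<and> (\<forall>s\<in>complex_box a b T. \<forall>v\<in>space (half_lborel). norm (f s v) \<le> B v)"
    if "ereal (- real p) < ereal a" "ereal b < ereal 1" for a b T
  proof (cases "a \<le> b")
    case True
    thus ?thesis using that u C unfolding f_def
      by (intro exI[of _ "\<lambda>v. C * bose_majorant p a b v"] conjI ballI integrable_mult_right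
            integrable_bose_majorant norm_bose_integrand_le)
         (auto simp: complex_box_def space_restrict_space simp del: of_real_add)
  next
    \<comment> \<open>The strip lemmas ask for a majorant even when a > b; the box is then
      empty.\<close>
    case False
    hence "complex_box a b T = {}" by (auto simp: complex_box_def)
    thus ?thesis by (intro exI[of _ "\<lambda>_. 0"]) simp
  qed
  have hol: "(\<lambda>s. f s v) holomorphic_on {s. - real p < Re s \<and> Re s < 1}" if "v \<in> space half_lborel" for v
    using that unfolding f_def by (intro holomorphic_intros) (auto simp: space_restrict_space)
  have meas: "f s \<in> borel_measurable half_lborel" for s
    unfolding f_def by (rule measurable_bose_integrand[OF u])
  have S: "{s. - real p < Re s \<and> Re s < 1} = {s. ereal (- real p) < ereal (Re s) \<and> ereal (Re s) < ereal 1}" by simp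
  note * = holomorphic_on_integral_strip[OF S hol meas dom] integrable_strip[OF S hol meas dom]
  show ?A
    using *(1) unfolding f_def .
  show "PROP ?B"
    using *(2)[of s] unfolding f_def by simp
qed

text \<open>The exponent \<open>s\<close> is reached from the integer exponent \<open>-p\<close> by a fractional integral of order
  \<open>s + p\<close>; it acts in the same way on the series and on the singular term \<open>\<Gamma>(1-s) u\<^sup>s\<^sup>-\<^sup>1\<close>.\<close>
lemma dreg_eq:
  assumes u: "u > 0" and s: "- real p < Re s" "Re s < 1"
  shows "dreg s u = rGamma (s + of_nat p) * 
          (\<integral>v. bosed_kernel p s (u + v) v \<partial>half_lborel)"
proof -
  define a where "a = s + of_nat p"
  have a: "Re a > 0" "Re a < real p + 1" using s by (auto simp: a_def)
  define c where "c n = (of_nat (Suc n) powr (of_nat p) * exp (-(of_nat (Suc n) * of_real u)) :: complex)" for n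
  have c_eq: "norm (c n) * real (Suc n) powr (- Re a) = dexp_majorant (real p - Re a) u n" for n
  proof -
    have "norm (c n) = real (Suc n) powr real p * exp (-(real (Suc n) * u))"
      unfolding c_def norm_mult norm_of_nat_Suc_powr by (simp flip: of_nat_Suc)
    thus ?thesis by (simp add: dexp_majorant_def powr_diff powr_minus field_simps)
  qed
  have sf: "sigma_finite_measure (count_space (UNIV :: nat set))"
    by (intro sigma_finite_measure_count_space)
  note M = Mellin_laplace[where M = "count_space (UNIV :: nat set)" and c = c and \<tau> = "\<lambda>n. real (Suc n)", OF sf a(1)]
  have int: "integrable (count_space UNIV) (\<lambda>n. norm (c n) * real (Suc n) powr (- Re a))"
    unfolding c_eq by (rule integrable_dexp_majorant[OF u])
  have inner: "(\<integral>n. c n * of_real (exp (-(v * real (Suc n)))) \<partial>count_space UNIV) = dexp (- of_nat p) (of_real (u + v))" for v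
    unfolding dexp_def c_def
    by (intro Bochner_Integration.integral_cong refl)
       (simp add: ring_distribs exp_add exp_diff exp_minus exp_of_real [symmetric] field_simps)
  have outer: "(\<integral>n. c n * of_real (real (Suc n)) powr (-a) \<partial>count_space UNIV) = dexp s (of_real u)"
    unfolding dexp_def c_def a_def
    by (intro Bochner_Integration.integral_cong refl)
       (simp add: powr_diff powr_minus powr_add field_simps del: of_nat_Suc)
  have M1: "integrable half_lborel (\<lambda>v. of_real v powr (a - 1) * dexp (- of_nat p) (of_real (u + v)))"
    and M2: "(\<integral>v. of_real v powr (a - 1) * dexp (- of_nat p) (of_real (u + v)) \<partial>half_lborel) = Gamma a * dexp s (of_real u)"
    using M[OF _ _ _ int] unfolding inner outer by simp_all
  note P = Mellin_inverse_power[OF u a]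
  \<comment> \<open>By \<open>bosed_eq\<close> the integrand is a difference of two kernels whose
    Mellin transforms share the factor Gamma a, and the second one leaves Gamma(p+1-a) =
    Gamma(1-s).\<close>
  have "(\<integral>v. of_real v powr (a - 1) * bosed p (of_real (u + v)) \<partial>half_lborel) =
      (\<integral>v. of_real v powr (a - 1) * dexp (- of_nat p) (of_real (u + v)) - of_real v powr (a - 1) * (fact p / of_real (u + v) ^ Suc p) \<partial>half_lborel)"
    using u by (intro Bochner_Integration.integral_cong refl) (auto simp: bosed_eq space_restrict_space ring_distribs)
  also have "\<dots> = Gamma a * dexp s (of_real u) - Gamma a * (Gamma (of_nat p + 1 - a) * of_real u powr (a - of_nat p - 1))"
    by (subst Bochner_Integration.integral_diff[OF M1 P(1)]) (simp only: M2 P(2))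
  also have "\<dots> = Gamma a * dreg s u"
    by (simp add: dreg_def a_def algebra_simps)
  finally have "rGamma a * (\<integral>v. of_real v powr (a - 1) * bosed p (of_real (u + v)) \<partial>half_lborel) = 
     (rGamma a * Gamma a) * dreg s u" by (simp add: mult_ac)
  also have "rGamma a * Gamma a = 1"
  proof -
    have "a \<notin> \<int>\<^sub>\<le>\<^sub>0" using a(1) by (auto elim!: nonpos_Ints_cases)
    thus ?thesis by (simp add: rGamma_inverse_Gamma Gamma_eq_zero_iff)
  qed
  finally show ?thesis by (simp add: a_def)
qed

lemma complex_box_altdef: "complex_box a b T = cbox (Complex a (-T)) (Complex b T)"
  by (auto simp: complex_box_def in_cbox_complex_iff)

lemma compact_complex_box: "compact (complex_box a b T)"
  by (simp add: complex_box_altdef)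

lemma bounded_on_complex_box:
  fixes f :: "complex \<Rightarrow> complex"
  assumes "continuous_on (complex_box a b T) f"
  obtains C where "C \<ge> 0" "\<And>s. s \<in> complex_box a b T \<Longrightarrow> norm (f s) \<le> C"
proof -
  have "bounded (f ` complex_box a b T)"
    by (intro compact_imp_bounded compact_continuous_image assms compact_complex_box)
  then obtain C where "\<And>s. s \<in> complex_box a b T \<Longrightarrow> norm (f s) \<le> C"
    by (auto simp: bounded_iff)
  thus ?thesis by (intro that[of "max C 0"]) (auto simp: le_max_iff_disj)
qed

lemma dreg_bound:
  assumes "b < 1"
  obtains C where "C \<ge> 0" "\<And>s u. s \<in> complex_box a b T \<Longrightarrow> u > 0 \<Longrightarrow> norm (dreg s u) \<le> C"
proof -
  \<comment> \<open>Large enough that the strip of \<open>dreg_eq\<close> contains the box; -p < b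
    enters through \<open>integrable_bose_majorant\<close>.\<close>
  define p where "p = nat \<lceil>\<bar>a\<bar> + \<bar>b\<bar>\<rceil> + 1"
  have p: "- real p < a" "- real p < b" unfolding p_def by linarith+
  obtain C where C: "C \<ge> 0" "\<And>v. v \<ge> 0 \<Longrightarrow> norm (bosed p (of_real v)) \<le> C / (1 + v) ^ Suc p"
    using bosed_bound by blast
  obtain D where D: "D \<ge> 0" "\<And>s. s \<in> complex_box a b T \<Longrightarrow> norm (rGamma (s + of_nat p)) \<le> D"
    by (rule bounded_on_complex_box[of a b T "\<lambda>s. rGamma (s + of_nat p)"])
       (auto intro!: holomorphic_on_imp_continuous_on holomorphic_intros)
  define J where "J = \<bar>\<integral>v. C * bose_majorant p a b v \<partial>half_lborel\<bar>"
  show ?thesis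
  proof (rule that[of "D * J"])
    show "D * J \<ge> 0" using D(1) by (simp add: J_def)
    fix s and u :: real assume s: "s \<in> complex_box a b T" and u: "u > 0"
    have s': "a \<le> Re s" "Re s \<le> b" using s by (auto simp: complex_box_def)
    have "norm (\<integral>v. bosed_kernel p s (u + v) v \<partial>half_lborel) \<le>
       (\<integral>v. C * bose_majorant p a b v \<partial>half_lborel)"
      by (rule norm_integral_le_integral)
         (use s' u p assms C in \<open>auto intro!: integrable_bose_integrand integrable_mult_right integrable_bose_majorant
            norm_bose_integrand_le simp: space_restrict_space simp del: of_real_add\<close>)
    also have "\<dots> \<le> J" by (simp add: J_def)
    finally show "norm (dreg s u) \<le> D * J"
      using D s s' u p assms unfolding dreg_eq[of u p s, OF u order.strict_trans2[OF p(1) s'(1)] order.strict_trans1[OF s'(2) assms]] norm_mult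
      by (intro mult_mono) auto
  qed
qed

text \<open>The Riemann zeta function on \<open>Re s < 1\<close>; see \<open>Riemann_zeta_eq_zt\<close>.\<close>
definition zt :: "complex \<Rightarrow> complex" where
  "zt s = Lim (at_right 0) (dreg s)"

text \<open>Passage to u = 0 under the integral of \<open>dreg_eq\<close>: \<open>bosed p\<close> is
  continuous on the whole real axis, and its majorant does not depend on u.\<close>

lemma
  assumes s: "- real p < Re s" "Re s < 1"
  shows zt_eq: "zt s = rGamma (s + of_nat p) * 
          (\<integral>v. bosed_kernel p s v v \<partial>half_lborel)" (is "_ = ?I")
    and dreg_tendsto_strip: "(dreg s \<longlongrightarrow> zt s) (at_right 0)" (is ?C)
proof -
  obtain C where C: "C \<ge> 0" "\<And>v. v \<ge> 0 \<Longrightarrow> norm (bosed p (of_real v)) \<le> C / (1 + v) ^ Suc p"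
    using bosed_bound by blast
  have "((\<lambda>u. rGamma (s + of_nat p) * (\<integral>v. bosed_kernel p s (u + v) v \<partial>half_lborel))
          \<longlongrightarrow> ?I) (at_right 0)"
  proof (rule tendsto_mult_left, unfold tendsto_at_iff_sequentially o_def, safe)
    fix X :: "nat \<Rightarrow> real" assume X: "\<forall>i. X i \<in> {0<..} - {0}" "X \<longlonglongrightarrow> 0"
    show "(\<lambda>n. \<integral>v. bosed_kernel p s (X n + v) v \<partial>half_lborel)
           \<longlonglongrightarrow> (\<integral>v. bosed_kernel p s v v \<partial>half_lborel)"
    proof (rule integral_dominated_convergence[where w = "\<lambda>v. C * bose_majorant p (Re s) (Re s) v"])
      show "integrable half_lborel (\<lambda>v. C * bose_majorant p (Re s) (Re s) v)"
        using assms by (intro integrable_mult_right integrable_bose_majorant) auto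
      show "AE v in half_lborel. (\<lambda>n. bosed_kernel p s (X n + v) v)
              \<longlonglongrightarrow> bosed_kernel p s v v"
      proof (rule AE_I2, rule tendsto_mult_left)
        fix v :: real
        have "isCont (bosed p) (of_real v)"
          using holomorphic_on_imp_continuous_on[OF bosed_holomorphic[of p]] open_bose_domain
          by (simp add: continuous_on_eq_continuous_at)
        moreover have "(\<lambda>n. complex_of_real (X n + v)) \<longlonglongrightarrow> of_real v"
          using tendsto_add[OF X(2) tendsto_const[of v]] by (intro tendsto_of_real) simp
        ultimately show "(\<lambda>n. bosed p (of_real (X n + v))) \<longlonglongrightarrow> bosed p (of_real v)"
          by (rule isCont_tendsto_compose)
      qed
      show "AE v in half_lborel. norm (bosed_kernel p s (X n + v) v) \<le> C * bose_majorant p (Re s) (Re s) v" for n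
        using X(1) C by (intro AE_I2 norm_bose_integrand_le) (auto simp: space_restrict_space intro: less_imp_le)
      show "(\<lambda>v. bosed_kernel p s v v) \<in> borel_measurable half_lborel"
        using measurable_bose_integrand[of 0 s p] by simp
      show "(\<lambda>v. bosed_kernel p s (X n + v) v) \<in> borel_measurable half_lborel" for n
        using X(1) by (intro measurable_bose_integrand) (auto intro: less_imp_le)
    qed
  qed
  hence *: "(dreg s \<longlongrightarrow> ?I) (at_right 0)"
  proof (rule Lim_transform_eventually)
    have "eventually (\<lambda>u::real. u > 0) (at_right 0)" by (simp add: eventually_at_right_less)
    thus "\<forall>\<^sub>F u in at_right 0. rGamma (s + of_nat p) * (\<integral>v. bosed_kernel p s (u + v) v \<partial>half_lborel) = dreg s u"
      by eventually_elim (use dreg_eq s in simp)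
  qed
  show "zt s = ?I" unfolding zt_def by (rule tendsto_Lim[OF _ *]) simp
  with * show ?C by simp
qed

text \<open>Near each point some p makes the integral formula available. As \<open>zt\<close> is
  defined as a limit, the formulas for different p need no separate comparison.\<close>

lemma zt_holomorphic: "zt holomorphic_on {s. Re s < 1}"
  unfolding holomorphic_on_def
proof
  fix s assume s: "s \<in> {s. Re s < 1}"
  define p where "p = nat \<lceil>\<bar>Re s\<bar>\<rceil> + 1"
  define S where "S = {s. - real p < Re s \<and> Re s < 1}"
  have op: "open S" unfolding S_def by (intro open_Collect_less open_Collect_conj continuous_intros)
  have "(\<lambda>s. rGamma (s + of_nat p) * (\<integral>v. bosed_kernel p s (0 + v) v \<partial>half_lborel))
          holomorphic_on S"
    unfolding S_def by (intro holomorphic_intros holomorphic_bose_integral) auto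
  hence "zt holomorphic_on S" by (rule holomorphic_transform) (use zt_eq in \<open>auto simp: S_def\<close>)
  moreover have "- real p < Re s" unfolding p_def by linarith
  ultimately have "zt field_differentiable at s"
    using op s by (intro holomorphic_on_imp_differentiable_at[of zt S]) (auto simp: S_def)
  thus "zt field_differentiable at s within {s. Re s < 1}" by (rule field_differentiable_at_within)
qed

lemma dreg_tendsto:
  assumes "Re s < 1"
  shows "(dreg s \<longlongrightarrow> zt s) (at_right 0)"
proof (rule dreg_tendsto_strip[of "nat \<lceil>\<bar>Re s\<bar>\<rceil> + 1"])
  show "- real (nat \<lceil>\<bar>Re s\<bar>\<rceil> + 1) < Re s" by linarith
qed fact

section \<open>Taylor expansion of the regularised series at the origin\<close>

lemma vector_derivative_compose_of_real:
  assumes "(f has_field_derivative f') (at (complex_of_real u))"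
  shows "((\<lambda>u. f (complex_of_real u)) has_vector_derivative f') (at u)"
proof -
  have "((f \<circ> complex_of_real) has_vector_derivative (1 * f')) (at u)"
    by (rule field_vector_diff_chain_at) (use assms in \<open>auto intro!: derivative_eq_intros\<close>)
  thus ?thesis by (simp add: o_def)
qed

text \<open>The singular term follows the same rule as the series because Gamma(2-s) = (1-s)
  Gamma(1-s).\<close>

lemma has_vector_derivative_dreg:
  assumes "u > 0" "Re s < 1"
  shows "(dreg s has_vector_derivative - dreg (s - 1) u) (at u)"
proof -
  have nz: "1 - s \<notin> \<int>\<^sub>\<le>\<^sub>0" using assms by (auto elim!: nonpos_Ints_cases simp: complex_eq_iff)
  have "((\<lambda>z. dexp s z - Gamma (1 - s) * z powr (s - 1)) has_field_derivative
          - dexp (s - 1) (of_real u) - Gamma (1 - s) * ((s - 1) * of_real u powr (s - 1 - 1))) (at (of_real u))"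
    using assms by (auto intro!: derivative_eq_intros has_field_derivative_dexp)
  moreover have "Gamma (1 - (s - 1)) = (1 - s) * Gamma (1 - s)"
    using Gamma_plus1[of "1 - s"] nz by (auto simp: algebra_simps)
  hence "- dexp (s - 1) (of_real u) - Gamma (1 - s) * ((s - 1) * of_real u powr (s - 1 - 1)) = - dreg (s - 1) u"
    unfolding dreg_def by (simp only:) (simp add: algebra_simps)
  ultimately have "((\<lambda>z. dexp s z - Gamma (1 - s) * z powr (s - 1)) has_field_derivative
          - dreg (s - 1) u) (at (of_real u))" by (simp only:)
  from vector_derivative_compose_of_real[OF this] show ?thesis
    unfolding dreg_def[abs_def] .
qed

definition zcoeff :: "nat \<Rightarrow> complex \<Rightarrow> complex" where
  "zcoeff k s = zt (s - of_nat k) * (-1) ^ k / fact k"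

definition drem :: "nat \<Rightarrow> complex \<Rightarrow> real \<Rightarrow> complex" where
  "drem K s u = dreg s u - (\<Sum>k<K. zcoeff k s * of_real u ^ k)"

lemma zcoeff_Suc: "of_nat (Suc k) * zcoeff (Suc k) s = - zcoeff k (s - 1)"
proof -
  have "s - of_nat (Suc k) = s - 1 - of_nat k" by simp
  thus ?thesis unfolding zcoeff_def by (simp only:) (simp add: fact_Suc del: of_nat_Suc)
qed

lemma has_vector_derivative_drem:
  assumes "u > 0" "Re s < 1"
  shows "(drem (Suc K) s has_vector_derivative - drem K (s - 1) u) (at u)"
proof -
  have "((\<lambda>z. zcoeff 0 s + (\<Sum>k<K. zcoeff (Suc k) s * z ^ Suc k)) has_field_derivative
          (\<Sum>k<K. - zcoeff k (s - 1) * z ^ k)) (at z)" for z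
  proof -
    have "((\<lambda>z. zcoeff 0 s + (\<Sum>k<K. zcoeff (Suc k) s * z ^ Suc k)) has_field_derivative
          (\<Sum>k<K. zcoeff (Suc k) s * (of_nat (Suc k) * z ^ k))) (at z)"
      by (auto intro!: derivative_eq_intros sum.cong simp del: power_Suc)
    also have "(\<Sum>k<K. zcoeff (Suc k) s * (of_nat (Suc k) * z ^ k)) = (\<Sum>k<K. - zcoeff k (s - 1) * z ^ k)"
      by (intro sum.cong refl) (simp only: zcoeff_Suc[symmetric] mult_ac)
    finally show ?thesis .
  qed
  from vector_derivative_compose_of_real[OF this]
  have "((\<lambda>u. \<Sum>k<Suc K. zcoeff k s * of_real u ^ k) has_vector_derivative
          (\<Sum>k<K. - zcoeff k (s - 1) * of_real u ^ k)) (at u)"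
    by (simp add: sum.lessThan_Suc_shift del: sum.lessThan_Suc)
  from has_vector_derivative_diff[OF has_vector_derivative_dreg[OF assms] this]
  show ?thesis by (simp add: drem_def[abs_def] sum_negf)
qed

lemma drem_tendsto_0:
  assumes "Re s < 1"
  shows "(drem (Suc K) s \<longlongrightarrow> 0) (at_right 0)"
proof -
  have "(drem (Suc K) s \<longlongrightarrow> zt s - (\<Sum>k<Suc K. zcoeff k s * of_real 0 ^ k)) (at_right 0)"
    unfolding drem_def[abs_def] by (intro tendsto_intros dreg_tendsto assms)
  also have "(\<Sum>k<Suc K. zcoeff k s * of_real 0 ^ k) = zt s"
    by (simp add: sum.lessThan_Suc_shift zcoeff_def del: sum.lessThan_Suc)
  finally show ?thesis by simp
qed

text \<open>Induction on K, the base being \<open>dreg_bound\<close>. The u-derivative of the next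
  remainder at s is minus the present one at s - 1, so the hypothesis is needed on the box shifted
  by 1, whence the arbitrary a and b. The series has no value at u = 0, so the mean value inequality
  is used on [e,u] and e tends to 0, where the remainder vanishes.\<close>

lemma drem_bound:
  assumes "b < 1"
  shows "\<exists>C\<ge>0. \<forall>s\<in>complex_box a b T. \<forall>u>0. norm (drem K s u) \<le> C * u ^ K"
  using assms
proof (induction K arbitrary: a b)
  case 0
  obtain C where "C \<ge> 0" "\<And>s u. s \<in> complex_box a b T \<Longrightarrow> u > 0 \<Longrightarrow> norm (dreg s u) \<le> C"
    using dreg_bound[OF 0] by metis
  thus ?case by (intro exI[of _ C]) (auto simp: drem_def)
next
  case (Suc K)
  have "b - 1 < 1" using Suc.prems by linarith
  from Suc.IH[OF this, of "a - 1"]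
  obtain C where C: "C \<ge> 0" "\<And>s u. s \<in> complex_box (a - 1) (b - 1) T \<Longrightarrow> u > 0 \<Longrightarrow> norm (drem K s u) \<le> C * u ^ K"
    by blast
  have "norm (drem (Suc K) s u) \<le> C * u ^ Suc K" if s: "s \<in> complex_box a b T" and u: "u > 0" for s u
  proof -
    have s1: "s - 1 \<in> complex_box (a - 1) (b - 1) T" "Re s < 1"
      using s Suc.prems by (auto simp: complex_box_def)
    have le: "norm (drem (Suc K) s u - drem (Suc K) s e) \<le> C * u ^ Suc K" if e: "0 < e" "e < u" for e
    proof -
      have "norm (drem (Suc K) s u - drem (Suc K) s e) \<le> (C * u ^ K) * norm (u - e)"
      proof (rule differentiable_bound[of "{e..u}" "drem (Suc K) s" "\<lambda>x h. h *\<^sub>R (- drem K (s - 1) x)"])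
        fix x assume x: "x \<in> {e..u}"
        have x0: "x > 0" using x e by simp
        show "(drem (Suc K) s has_derivative (\<lambda>h. h *\<^sub>R (- drem K (s - 1) x))) (at x within {e..u})"
          using has_vector_derivative_drem[OF x0 s1(2), of K]
          unfolding has_vector_derivative_def by (rule has_derivative_at_withinI)
        have "norm (drem K (s - 1) x) \<le> C * x ^ K" by (rule C(2)[OF s1(1) x0])
        also have "\<dots> \<le> C * u ^ K" using x e C(1) by (intro mult_left_mono power_mono) auto
        finally show "onorm (\<lambda>h. h *\<^sub>R (- drem K (s - 1) x)) \<le> C * u ^ K"
          by (intro onorm_le) (simp add: mult.commute[of _ "\<bar>_\<bar>"] mult_left_mono)
      qed (use e in auto)
      also have "\<dots> \<le> (C * u ^ K) * u" using e C(1) by (intro mult_left_mono) auto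
      finally show ?thesis by (simp add: mult_ac)
    qed
    have "((\<lambda>e. norm (drem (Suc K) s u - drem (Suc K) s e)) \<longlongrightarrow> norm (drem (Suc K) s u - 0)) (at_right 0)"
      by (intro tendsto_intros drem_tendsto_0 s1)
    moreover have "eventually (\<lambda>e. e \<in> {0<..<u}) (at_right 0)"
      using u eventually_at_right_real by blast
    hence "eventually (\<lambda>e. norm (drem (Suc K) s u - drem (Suc K) s e) \<le> C * u ^ Suc K) (at_right 0)"
      by eventually_elim (use le in auto)
    ultimately have "norm (drem (Suc K) s u - 0) \<le> C * u ^ Suc K"
      by (rule tendsto_upperbound) simp
    thus ?thesis by simp
  qed
  thus ?case using C(1) by blast
qed

lemma drem_holomorphic:
  assumes "u > 0"
  shows "(\<lambda>s. drem K s u) holomorphic_on {s. Re s < 1}"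
  unfolding drem_def dreg_def zcoeff_def
proof (intro holomorphic_intros holomorphic_dexp)
  show "(\<lambda>s. zt (s - of_nat k)) holomorphic_on {s. Re s < 1}" for k
    by (rule holomorphic_on_compose_gen[OF _ zt_holomorphic, unfolded o_def]) (auto intro!: holomorphic_intros)
  show "1 - s \<notin> \<int>\<^sub>\<le>\<^sub>0" if "s \<in> {s. Re s < 1}" for s
    using that by (auto elim!: nonpos_Ints_cases simp: complex_eq_iff)
qed (use assms in auto)

lemma zcoeff_holomorphic: "zcoeff k holomorphic_on {s. Re s < 1}"
  unfolding zcoeff_def
proof (intro holomorphic_intros)
  show "(\<lambda>s. zt (s - of_nat k)) holomorphic_on {s. Re s < 1}"
    by (rule holomorphic_on_compose_gen[OF _ zt_holomorphic, unfolded o_def]) (auto intro!: holomorphic_intros)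
qed auto

lemma continuous_on_dexp_of_real: "continuous_on {0<..} (\<lambda>u. dexp s (complex_of_real u))"
proof (intro continuous_at_imp_continuous_on ballI)
  fix u :: real assume "u \<in> {0<..}"
  hence "isCont (dexp s) (of_real u)"
    using DERIV_isCont[OF has_field_derivative_dexp] by simp
  thus "isCont (\<lambda>u. dexp s (complex_of_real u)) u"
    by (rule isCont_o2[rotated]) (intro continuous_intros)
qed

lemma continuous_on_drem: "continuous_on {0<..} (drem K s)"
  unfolding drem_def[abs_def] dreg_def
  by (intro continuous_intros continuous_on_dexp_of_real) auto

section \<open>Integrals of powers on the two halves of the positive axis\<close>

lemma integrable_lborel_on_split_iff:
  fixes f :: "real \<Rightarrow> complex"
  shows "integrable half_lborel f \<longleftrightarrow> integrable unit_lborel f \<and> integrable tail_lborel f"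
proof -
  have eq: "({0<..} :: real set) = {0<..1} \<union> {1<..}" by auto
  show ?thesis
    by (auto simp: integrable_lborel_on_iff eq intro!: set_integrable_Un intro: set_integrable_subset)
qed

lemma integral_lborel_on_split:
  fixes f :: "real \<Rightarrow> complex"
  assumes "integrable unit_lborel f" "integrable tail_lborel f"
  shows "integral\<^sup>L half_lborel f = integral\<^sup>L unit_lborel f + integral\<^sup>L tail_lborel f"
proof -
  have eq: "({0<..} :: real set) = {0<..1} \<union> {1<..}" by auto
  have "integral\<^sup>L half_lborel f = set_lebesgue_integral lborel ({0<..1} \<union> {1<..}) f"
    by (simp add: integral_lborel_on_eq eq)
  also have "\<dots> = set_lebesgue_integral lborel {0<..1} f + set_lebesgue_integral lborel {1<..} f"
    using assms by (intro set_integral_Un) (auto simp: integrable_lborel_on_iff)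
  finally show ?thesis by (simp add: integral_lborel_on_eq)
qed

lemma powr_FTC:
  assumes AB: "0 \<le> A" "A < B" and a: "a + 1 \<noteq> 0"
    and int: "set_integrable lborel (einterval A B) (\<lambda>x. complex_of_real x powr a)"
    and lim: "(((\<lambda>x. complex_of_real x powr (a + 1)) \<circ> real_of_ereal) \<longlongrightarrow> p) (at_right A)"
      "(((\<lambda>x. complex_of_real x powr (a + 1)) \<circ> real_of_ereal) \<longlongrightarrow> q) (at_left B)"
  shows "(LBINT x=A..B. complex_of_real x powr a) = q / (a + 1) - p / (a + 1)"
proof (rule interval_integral_FTC_integrable[OF AB(2), where F = "\<lambda>x. complex_of_real x powr (a + 1) / (a + 1)"])
  fix x assume x: "A < ereal x" "ereal x < B"
  have "0 < ereal x" using AB(1) x(1) by (rule order.strict_trans1)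
  hence x0: "x > 0" by simp
  show "((\<lambda>x. complex_of_real x powr (a + 1) / (a + 1)) has_vector_derivative of_real x powr a) (at x)"
    by (rule vector_derivative_compose_of_real) (use a x0 in \<open>auto intro!: derivative_eq_intros\<close>)
  show "isCont (\<lambda>x. complex_of_real x powr a) x"
    using x0 by (intro continuous_intros) auto
qed (use tendsto_divide[OF lim(1) tendsto_const a] tendsto_divide[OF lim(2) tendsto_const a] int in \<open>simp_all add: o_def\<close>)

lemma norm_powr_tendsto_0:
  assumes "((\<lambda>x::real. x powr Re b) \<longlongrightarrow> 0) F" "eventually (\<lambda>x. x > 0) F"
  shows "((\<lambda>x. complex_of_real x powr b) \<longlongrightarrow> 0) F"
proof (rule tendsto_norm_zero_cancel, rule Lim_transform_eventually[OF assms(1)])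
  show "eventually (\<lambda>x. x powr Re b = norm (complex_of_real x powr b)) F"
    using assms(2) by eventually_elim (simp add: norm_powr_real_powr)
qed

lemma powr_tendsto_1: "((\<lambda>x. complex_of_real x powr a) \<longlongrightarrow> 1) (at 1 within S)"
proof -
  have "isCont (\<lambda>x. complex_of_real x powr a) 1" by (intro continuous_intros) auto
  hence "((\<lambda>x. complex_of_real x powr a) \<longlongrightarrow> 1) (at 1)" by (simp add: isCont_def)
  thus ?thesis by (rule filterlim_mono) (auto simp: at_le)
qed

lemma powr_integral_0_1:
  assumes a: "Re a > -1"
  shows "integrable unit_lborel (\<lambda>v. complex_of_real v powr a)"
    and "(\<integral>v. complex_of_real v powr a \<partial>unit_lborel) = 1 / (a + 1)" (is ?B)
proof -
  have meas: "(\<lambda>v. complex_of_real v powr a) \<in> borel_measurable unit_lborel"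
    by (intro measurable_lborel_on continuous_intros) auto
  have "(\<lambda>v::real. v powr Re a) absolutely_integrable_on {0<..1}"
    by (intro nonnegative_absolutely_integrable_1 integrable_on_powr_from_0') (use a in auto)
  hence "set_integrable lborel {0<..1} (\<lambda>v::real. v powr Re a)"
    unfolding set_integrable_def by (subst (asm) integrable_completion) auto
  hence "integrable unit_lborel (\<lambda>v::real. v powr Re a)"
    by (simp add: integrable_lborel_on_iff)
  thus int: "integrable unit_lborel (\<lambda>v. complex_of_real v powr a)"
    by (rule Bochner_Integration.integrable_bound[OF _ meas])
       (auto intro!: AE_I2 simp: norm_powr_real_powr space_restrict_space)
  have "(LBINT x=0..1. complex_of_real x powr a) = 1 / (a + 1) - 0 / (a + 1)"
  proof (rule powr_FTC)
    show "a + 1 \<noteq> 0" using a by (auto simp: complex_eq_iff)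
    have "set_integrable lborel {0<..1} (\<lambda>x. complex_of_real x powr a)"
      using int by (simp add: integrable_lborel_on_iff)
    thus "set_integrable lborel (einterval 0 1) (\<lambda>x. complex_of_real x powr a)"
      by (rule set_integrable_subset) (auto simp: einterval_def)
    have "((\<lambda>x::real. x powr Re (a + 1)) \<longlongrightarrow> 0) (at_right 0)"
      using a by simp real_asymp
    hence "((\<lambda>x. complex_of_real x powr (a + 1)) \<longlongrightarrow> 0) (at_right 0)"
      using eventually_at_right_less by (rule norm_powr_tendsto_0)
    thus "(((\<lambda>x. complex_of_real x powr (a + 1)) \<circ> real_of_ereal) \<longlongrightarrow> 0) (at_right 0)"
      by (simp add: zero_ereal_def ereal_tendsto_simps)
    show "(((\<lambda>x. complex_of_real x powr (a + 1)) \<circ> real_of_ereal) \<longlongrightarrow> 1) (at_left 1)"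
      using powr_tendsto_1 by (simp add: one_ereal_def ereal_tendsto_simps)
  qed auto
  thus ?B
    using interval_integral_Ioc[of 0 1 "\<lambda>x. complex_of_real x powr a"]
    by (simp add: integral_lborel_on_eq zero_ereal_def one_ereal_def)
qed

lemma powr_integral_1_inf:
  assumes a: "Re a < -1"
  shows "integrable tail_lborel (\<lambda>v. complex_of_real v powr a)"
    and "(\<integral>v. complex_of_real v powr a \<partial>tail_lborel) = - 1 / (a + 1)" (is ?B)
proof -
  have meas: "(\<lambda>v. complex_of_real v powr a) \<in> borel_measurable tail_lborel"
    by (intro measurable_lborel_on continuous_intros) auto
  have "set_integrable lborel (einterval 1 \<infinity>) (\<lambda>x::real. x powr Re a)"
  proof (rule interval_integral_FTC_nonneg(1))
    fix x assume x: "1 < ereal x" "ereal x < \<infinity>"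
    show "((\<lambda>x. x powr (Re a + 1) / (Re a + 1)) has_real_derivative x powr Re a) (at x)"
      using x a by (auto intro!: derivative_eq_intros)
    show "isCont (\<lambda>x::real. x powr Re a) x"
      using x by (intro continuous_intros) auto
  next
    have "((\<lambda>x. x powr (Re a + 1) / (Re a + 1)) \<longlongrightarrow> 1 powr (Re a + 1) / (Re a + 1)) (at_right 1)"
      using a by (intro tendsto_intros) auto
    thus "(((\<lambda>x. x powr (Re a + 1) / (Re a + 1)) \<circ> real_of_ereal) \<longlongrightarrow> 1 / (Re a + 1)) (at_right 1)"
      by (simp add: one_ereal_def ereal_tendsto_simps)
    have "((\<lambda>x. x powr (Re a + 1)) \<longlongrightarrow> 0) at_top"
      using a by real_asymp
    from tendsto_divide_zero[OF this]
    show "(((\<lambda>x. x powr (Re a + 1) / (Re a + 1)) \<circ> real_of_ereal) \<longlongrightarrow> 0) (at_left \<infinity>)"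
      by (simp add: ereal_tendsto_simps)
  qed auto
  hence "integrable tail_lborel (\<lambda>v::real. v powr Re a)"
    by (simp add: integrable_lborel_on_iff one_ereal_def)
  thus int: "integrable tail_lborel (\<lambda>v. complex_of_real v powr a)"
    by (rule Bochner_Integration.integrable_bound[OF _ meas])
       (auto intro!: AE_I2 simp: norm_powr_real_powr space_restrict_space)
  have "(LBINT x=1..\<infinity>. complex_of_real x powr a) = 0 / (a + 1) - 1 / (a + 1)"
  proof (rule powr_FTC)
    show "a + 1 \<noteq> 0" using a by (auto simp: complex_eq_iff)
    show "set_integrable lborel (einterval 1 \<infinity>) (\<lambda>x. complex_of_real x powr a)"
      using int by (simp add: integrable_lborel_on_iff one_ereal_def)
    have "((\<lambda>x::real. x powr Re (a + 1)) \<longlongrightarrow> 0) at_top"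
      using a by simp real_asymp
    hence "((\<lambda>x. complex_of_real x powr (a + 1)) \<longlongrightarrow> 0) at_top"
      using eventually_gt_at_top by (rule norm_powr_tendsto_0)
    thus "(((\<lambda>x. complex_of_real x powr (a + 1)) \<circ> real_of_ereal) \<longlongrightarrow> 0) (at_left \<infinity>)"
      by (simp add: ereal_tendsto_simps)
    show "(((\<lambda>x. complex_of_real x powr (a + 1)) \<circ> real_of_ereal) \<longlongrightarrow> 1) (at_right 1)"
      using powr_tendsto_1 by (simp add: one_ereal_def ereal_tendsto_simps)
  qed auto
  thus ?B
    using interval_integral_to_infinity_eq[where a = 1 and M = lborel and f = "\<lambda>x. complex_of_real x powr a"]
    by (simp add: integral_lborel_on_eq one_ereal_def)
qed

section \<open>The Riemann zeta function\<close>

text \<open>The property is a condition at each single point and depends only on f near it. This is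
  what permits the continuations of zeta and of Theta to be glued from pieces.\<close>

lemma nicely_meromorphic_on_UNIV_local:
  assumes "\<And>z. \<exists>S g. open S \<and> z \<in> S \<and> g nicely_meromorphic_on S \<and> (\<forall>w\<in>S. f w = g w)"
  shows "f nicely_meromorphic_on UNIV"
proof -
  have "f meromorphic_on {z} \<and> ((is_pole f z \<and> f z = 0) \<or> f \<midarrow>z\<rightarrow> f z)" for z
  proof -
    obtain S g where S: "open S" "z \<in> S" "g nicely_meromorphic_on S" "\<And>w. w \<in> S \<Longrightarrow> f w = g w"
      using assms[of z] by blast
    have "eventually (\<lambda>w. w \<in> S) (at z)" using S by (intro eventually_at_in_open')
    hence ev: "eventually (\<lambda>w. f w = g w) (at z)" by eventually_elim (use S in auto)
    have "g meromorphic_on {z}"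
      using S by (auto simp: nicely_meromorphic_on_def intro: meromorphic_on_subset)
    hence "f meromorphic_on {z}" by (subst meromorphic_on_cong[of _ f g]) (use ev in auto)
    moreover have "(is_pole g z \<and> g z = 0) \<or> g \<midarrow>z\<rightarrow> g z"
      using S by (auto simp: nicely_meromorphic_on_def)
    hence "(is_pole f z \<and> f z = 0) \<or> f \<midarrow>z\<rightarrow> f z"
      using is_pole_cong[OF ev refl] tendsto_cong[OF ev] S(2,4) by simp
    ultimately show ?thesis by blast
  qed
  thus ?thesis
    by (auto simp: nicely_meromorphic_on_def meromorphic_on_meromorphic_at[of f UNIV])
qed

lemma infsum_eq_integral_count_space:
  fixes f :: "'a \<Rightarrow> complex"
  assumes "integrable (count_space A) f"
  shows "infsum f A = (\<integral>x. f x \<partial>count_space A)"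
proof -
  have "Infinite_Set_Sum.abs_summable_on f A"
    using assms by (simp add: Infinite_Set_Sum.abs_summable_on_def)
  from infsetsum_infsum[OF this] show ?thesis by (simp add: infsetsum_def)
qed

definition zeta_series :: "complex \<Rightarrow> complex" where
  "zeta_series s = (\<integral>n. of_nat (Suc n) powr (-s) \<partial>count_space UNIV)"

lemma integrable_real_powr_Suc:
  assumes "\<sigma> > 1"
  shows "integrable (count_space UNIV) (\<lambda>n. real (Suc n) powr (-\<sigma>))"
proof -
  have "summable (\<lambda>n. real n powr (-\<sigma>))" using assms by (simp add: summable_real_powr_iff)
  hence "summable (\<lambda>n. real (Suc n) powr (-\<sigma>))" by (subst summable_Suc_iff)
  thus ?thesis by (simp add: integrable_count_space_nat_iff)
qed

lemma
  shows zeta_series_holomorphic: "zeta_series holomorphic_on {s. Re s > 1}" (is ?A)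
    and integrable_zeta_series: "Re s > 1 \<Longrightarrow> integrable (count_space UNIV) (\<lambda>n. of_nat (Suc n) powr (-s) :: complex)" (is "PROP ?B")
proof -
  define f where "f s n = (of_nat (Suc n) powr (-s) :: complex)" for s n
  have dom: "\<exists>B. integrable (count_space UNIV) B \<and> (\<forall>s\<in>complex_box a b T. \<forall>n\<in>space (count_space UNIV). norm (f s n) \<le> B n)"
    if "ereal 1 < ereal a" for a b T
    using integrable_real_powr_Suc[of a] that unfolding f_def norm_of_nat_Suc_powr
    by (intro exI[of _ "\<lambda>n. real (Suc n) powr (-a)"]) (auto simp: complex_box_def intro!: powr_mono)
  have hol: "(\<lambda>s. f s n) holomorphic_on {s. Re s > 1}" for n
    unfolding f_def by (intro holomorphic_intros) (simp del: of_nat_Suc)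
  have S: "{s. Re s > 1} = {s. ereal 1 < ereal (Re s) \<and> ereal (Re s) < \<infinity>}" by simp
  note * = holomorphic_on_integral_strip[OF S hol _ dom] integrable_strip[OF S hol _ dom]
  show ?A
    using *(1) unfolding f_def by (simp add: zeta_series_def[abs_def])
  show "PROP ?B"
    using *(2)[of s] unfolding f_def by simp
qed

lemma zeta_series_infsum:
  assumes "Re s > 1"
  shows "(\<Sum>\<^sub>\<infinity>n\<in>{1::nat..}. 1 / of_nat n powr s) = zeta_series s"
proof -
  have "(\<Sum>\<^sub>\<infinity>n\<in>{1::nat..}. 1 / of_nat n powr s) = infsum (\<lambda>n. 1 / of_nat n powr s) (Suc ` UNIV)"
    by (intro arg_cong[of _ _ "infsum _"]) (auto simp: image_iff Suc_le_eq gr0_conv_Suc)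
  also have "\<dots> = infsum (\<lambda>n. of_nat (Suc n) powr (-s)) UNIV"
    by (subst infsum_reindex) (auto simp: o_def powr_minus field_simps)
  also have "\<dots> = zeta_series s" unfolding zeta_series_def
    by (rule infsum_eq_integral_count_space[OF integrable_zeta_series[OF assms]])
  finally show ?thesis .
qed

section \<open>Riemann's splitting of the Mellin integral of 1/(e^v - 1)\<close>

abbreviation tail_kernel :: "complex \<Rightarrow> real \<Rightarrow> complex" where
  "tail_kernel s v \<equiv> of_real v powr (s - 1) * dexp 0 (of_real v)"

text \<open>Removing both the pole 1/v and the constant -1/2 leaves a factor of size O(v), so the
  integral over (0,1] converges for Re s > -1.\<close>

abbreviation head_kernel :: "complex \<Rightarrow> real \<Rightarrow> complex" where
  "head_kernel s v \<equiv> of_real v powr (s - 1) * (bose (of_real v) + 1/2)"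

lemma Mellin_dexp_0:
  assumes "Re s > 1"
  shows "integrable half_lborel (\<lambda>v. tail_kernel s v)" (is ?A)
    and "(\<integral>v. tail_kernel s v \<partial>half_lborel) = Gamma s * zeta_series s" (is ?B)
proof -
  have sf: "sigma_finite_measure (count_space (UNIV :: nat set))"
    by (intro sigma_finite_measure_count_space)
  have s: "Re s > 0" using assms by simp
  note M = Mellin_laplace[where M = "count_space (UNIV :: nat set)" and c = "\<lambda>_. 1" and \<tau> = "\<lambda>n. real (Suc n)", OF sf s]
  have inner: "(\<integral>n. 1 * complex_of_real (exp (-(v * real (Suc n)))) \<partial>count_space UNIV) = dexp 0 (of_real v)" for v
    unfolding dexp_def
    by (intro Bochner_Integration.integral_cong refl)
       (simp add: exp_of_real [symmetric] mult.commute of_nat_neq_0 del: of_nat_Suc)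
  have outer: "(\<integral>n. 1 * complex_of_real (real (Suc n)) powr (-s) \<partial>count_space UNIV) = zeta_series s"
    unfolding zeta_series_def by simp
  have int: "integrable (count_space UNIV) (\<lambda>n. norm (1::complex) * real (Suc n) powr (- Re s))"
    using integrable_real_powr_Suc[OF assms] by simp
  show ?A
    using M(1)[OF _ _ _ int] unfolding inner by simp
  show ?B
    using M(2)[OF _ _ _ int] unfolding inner outer by simp
qed

lemma integrable_powr_exp:
  "integrable tail_lborel (\<lambda>v::real. v powr B * exp (-(v / 2)))"
proof -
  have sub: "integrable half_lborel (\<lambda>v. of_real v powr (of_real (\<bar>B\<bar> + 1) - 1) * of_real (exp (-(v * (1/2)))) :: complex)"
    by (rule Gamma_lborel_on) auto
  hence "integrable tail_lborel (\<lambda>v. of_real v powr (of_real (\<bar>B\<bar> + 1) - 1) * of_real (exp (-(v * (1/2)))) :: complex)"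
    by (simp add: integrable_lborel_on_split_iff)
  thus ?thesis
  proof (rule Bochner_Integration.integrable_bound)
    show "(\<lambda>v::real. v powr B * exp (-(v / 2))) \<in> borel_measurable tail_lborel"
      by (intro measurable_lborel_on continuous_intros) auto
    show "AE v in tail_lborel. norm (v powr B * exp (-(v / 2))) \<le>
         norm (of_real v powr (of_real (\<bar>B\<bar> + 1) - 1) * of_real (exp (-(v * (1/2)))) :: complex)"
    proof (rule AE_I2)
      fix v assume "v \<in> space tail_lborel"
      hence v: "v > 1" by (simp add: space_restrict_space)
      have "v powr B \<le> v powr \<bar>B\<bar>" using v by (intro powr_mono) auto
      thus "norm (v powr B * exp (-(v / 2))) \<le>
         norm (of_real v powr (of_real (\<bar>B\<bar> + 1) - 1) * of_real (exp (-(v * (1/2)))) :: complex)"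
        using v by (simp add: norm_mult norm_powr_real_powr)
    qed
  qed
qed

text \<open>Exponential decay beats every power, so one majorant serves a whole closed strip; this
  makes the tails for zeta and for Theta entire.\<close>

lemma holomorphic_integral_exp_decay:
  fixes f :: "complex \<Rightarrow> real \<Rightarrow> complex"
  assumes hol: "\<And>v. v > 1 \<Longrightarrow> (\<lambda>s. f s v) holomorphic_on UNIV"
    and cont: "\<And>s. continuous_on {1<..} (f s)"
    and bound: "\<And>a b. \<exists>C B. \<forall>s v. a \<le> Re s \<longrightarrow> Re s \<le> b \<longrightarrow> v > 1 \<longrightarrow> norm (f s v) \<le> C * (v powr B * exp (-(v / 2)))"
  shows "(\<lambda>s. \<integral>v. f s v \<partial>tail_lborel) holomorphic_on UNIV" (is ?A)
    and "integrable tail_lborel (f s)"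
proof -
  have meas: "f s \<in> borel_measurable tail_lborel" for s
    by (intro measurable_lborel_on cont)
  have dom: "\<exists>B. integrable tail_lborel B \<and> (\<forall>s\<in>complex_box a b T. \<forall>v\<in>space (tail_lborel). norm (f s v) \<le> B v)"
    for a b T
  proof -
    obtain C B where "\<And>s v. a \<le> Re s \<Longrightarrow> Re s \<le> b \<Longrightarrow> v > 1 \<Longrightarrow> norm (f s v) \<le> C * (v powr B * exp (-(v / 2)))"
      using bound[of a b] by blast
    thus ?thesis
      by (intro exI[of _ "\<lambda>v. C * (v powr B * exp (-(v / 2)))"])
         (auto intro!: integrable_mult_right integrable_powr_exp simp: complex_box_def space_restrict_space)
  qed
  have hol': "(\<lambda>s. f s v) holomorphic_on UNIV" if "v \<in> space tail_lborel" for v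
    using hol that by (simp add: space_restrict_space)
  have S: "UNIV = {s. - \<infinity> < ereal (Re s) \<and> ereal (Re s) < \<infinity>}" by simp
  show ?A
    by (rule holomorphic_on_integral_strip[OF S hol' meas dom])
  show "integrable tail_lborel (f s)"
    by (rule integrable_strip[OF S hol' meas dom]) auto
qed

definition zeta_tail :: "complex \<Rightarrow> complex" where
  "zeta_tail s = (\<integral>v. tail_kernel s v \<partial>tail_lborel)"

lemma zeta_tail:
  shows zeta_tail_holomorphic: "zeta_tail holomorphic_on UNIV"
    and integrable_zeta_tail: "integrable tail_lborel (\<lambda>v. tail_kernel s v)" (is ?B)
proof -
  define f where "f s v = (tail_kernel s v :: complex)" for s and v :: real
  have 1: "(\<lambda>s. f s v) holomorphic_on UNIV" if "v > 1" for v
    unfolding f_def using that by (intro holomorphic_intros) auto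
  have 2: "continuous_on {1<..} (f s)" for s
    unfolding f_def
    by (intro continuous_intros continuous_on_subset[OF continuous_on_dexp_of_real]) auto
  define S where "S = (\<Sum>n. dexp_majorant 0 (1/2) n)"
  have S: "S \<ge> 0" unfolding S_def by (rule suminf_dexp_nonneg) auto
  have 3: "\<exists>C B. \<forall>s v. a \<le> Re s \<longrightarrow> Re s \<le> b \<longrightarrow> v > 1 \<longrightarrow> norm (f s v) \<le> C * (v powr B * exp (-(v / 2)))" for a b
  proof (rule exI[of _ S], rule exI[of _ "b - 1"], intro allI impI)
    fix s and v :: real assume *: "Re s \<le> b" "v > 1"
    have "norm (dexp 0 (of_real v)) \<le> exp (-(v / 2)) * S"
      unfolding S_def using * by (intro norm_dexp_le_exp) auto
    moreover have "norm (complex_of_real v powr (s - 1)) \<le> v powr (b - 1)"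
      using * by (simp add: norm_powr_real_powr)
    ultimately have "norm (f s v) \<le> v powr (b - 1) * (exp (-(v / 2)) * S)"
      unfolding f_def norm_mult by (intro mult_mono) auto
    thus "norm (f s v) \<le> S * (v powr (b - 1) * exp (-(v / 2)))" by (simp add: mult_ac)
  qed
  note * = holomorphic_integral_exp_decay[of f, OF 1 2 3]
  have "(\<lambda>s. zeta_tail s) holomorphic_on UNIV" using *(1) by (simp add: zeta_tail_def f_def)
  thus "zeta_tail holomorphic_on UNIV" .
  show ?B
    using *(2)[of s] by (simp add: f_def[abs_def])
qed

text \<open>Mean value inequality, the derivative being bounded by \<open>bosed_bound\<close> with p
  = 1; the constant 1/2 offsets the value of \<open>bose\<close> at 0.\<close>

lemma bose_half_bound:
  obtains C where "C \<ge> 0" "\<And>v. v \<in> {0<..1} \<Longrightarrow> norm (bose (of_real v) + 1/2) \<le> C * v"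
proof -
  obtain C where C: "C \<ge> 0" "\<And>v. v \<ge> 0 \<Longrightarrow> norm (bosed 1 (of_real v)) \<le> C / (1 + v) ^ Suc 1"
    using bosed_bound by blast
  have "norm (bose (of_real v) - bose (of_real 0)) \<le> C * norm (v - 0)" if v: "v \<in> {0<..1}" for v :: real
  proof (rule differentiable_bound[of "{0..v}" "\<lambda>v. bose (of_real v)" "\<lambda>x h. h *\<^sub>R (deriv bose (of_real x))"])
    fix x assume x: "x \<in> {0..v}"
    have "(bose has_field_derivative deriv bose (of_real x)) (at (of_real x))"
      by (rule holomorphic_derivI[OF bose_holomorphic open_bose_domain]) simp
    from vector_derivative_compose_of_real[OF this]
    show "((\<lambda>v. bose (of_real v)) has_derivative (\<lambda>h. h *\<^sub>R (deriv bose (of_real x)))) (at x within {0..v})"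
      unfolding has_vector_derivative_def by (rule has_derivative_at_withinI)
    have "norm (deriv bose (of_real x)) \<le> C / (1 + x) ^ Suc 1"
      using C(2)[of x] x by (simp add: bosed_def norm_mult)
    also have "\<dots> \<le> C / 1"
      using x C(1) by (intro divide_left_mono one_le_power) auto
    finally show "onorm (\<lambda>h. h *\<^sub>R (deriv bose (of_real x))) \<le> C"
      by (intro onorm_le) (simp add: mult.commute[of _ "\<bar>_\<bar>"] mult_left_mono)
  qed (use v in auto)
  thus ?thesis using C(1) by (intro that[of C]) (auto simp: bose_def[of 0])
qed

definition zeta_head :: "complex \<Rightarrow> complex" where
  "zeta_head s = (\<integral>v. head_kernel s v \<partial>unit_lborel)"

lemma integrable_real_powr_0_1:
  assumes "a > -1"
  shows "integrable unit_lborel (\<lambda>v::real. v powr a)"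
proof -
  have "integrable unit_lborel (\<lambda>v. norm (complex_of_real v powr of_real a))"
    using assms by (intro integrable_norm powr_integral_0_1) auto
  thus ?thesis
    by (rule integrable_lborel_on_cong[THEN iffD2, rotated]) (simp add: norm_powr_real_powr)
qed

lemma zeta_head:
  shows zeta_head_holomorphic: "zeta_head holomorphic_on {s. Re s > -1}"
    and integrable_zeta_head: "Re s > -1 \<Longrightarrow> integrable unit_lborel (\<lambda>v. head_kernel s v)" (is "PROP ?B")
proof -
  obtain C where C: "C \<ge> 0" "\<And>v. v \<in> {0<..1} \<Longrightarrow> norm (bose (of_real v) + 1/2) \<le> C * v"
    using bose_half_bound by blast
  have meas: "(\<lambda>v. head_kernel s v) \<in> borel_measurable unit_lborel" for s
  proof (intro measurable_lborel_on continuous_intros)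
    show "continuous_on {0<..1} (\<lambda>v. bose (of_real v))"
      by (rule continuous_on_compose2[OF holomorphic_on_imp_continuous_on[OF bose_holomorphic]])
         (auto intro!: continuous_intros)
  qed auto
  have bd: "norm (head_kernel s v) \<le> C * v powr a"
    if "a \<le> Re s" "v \<in> {0<..1}" for a s v
  proof -
    have "norm (head_kernel s v) \<le> v powr (a - 1) * (C * v)"
      unfolding norm_mult using that C by (intro mult_mono) (auto simp: norm_powr_real_powr intro!: powr_mono')
    also have "\<dots> = C * v powr a" using that by (simp add: powr_diff)
    finally show ?thesis .
  qed
  define f where "f s v = head_kernel s v" for s and v :: real
  have dom: "\<exists>B. integrable unit_lborel B \<and> (\<forall>s\<in>complex_box a b T. \<forall>v\<in>space (unit_lborel). norm (f s v) \<le> B v)"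
    if "ereal (-1) < ereal a" for a b T
    using that bd unfolding f_def
    by (intro exI[of _ "\<lambda>v. C * v powr a"])
       (auto intro!: integrable_mult_right integrable_real_powr_0_1 simp: complex_box_def space_restrict_space)
  have hol: "(\<lambda>s. f s v) holomorphic_on {s. Re s > -1}" if "v \<in> space unit_lborel" for v
    using that unfolding f_def by (intro holomorphic_intros) (auto simp: space_restrict_space)
  have S: "{s. Re s > -1} = {s. ereal (-1) < ereal (Re s) \<and> ereal (Re s) < \<infinity>}" by simp
  note * = holomorphic_on_integral_strip[OF S hol meas[folded f_def] dom] integrable_strip[OF S hol meas[folded f_def] dom]
  show "zeta_head holomorphic_on {s. Re s > -1}"
    using *(1) unfolding f_def by (simp add: zeta_head_def[abs_def])
  show "PROP ?B"
    using *(2)[of s] unfolding f_def by simp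
qed

text \<open>The Mellin integral of \<open>1/(e\<^sup>v - 1)\<close> split at \<open>v = 1\<close>. The term \<open>-1/(2s)\<close> of the head, multiplied by
  \<open>1/\<Gamma>(s)\<close>, is written as \<open>- rGamma (s + 1) / 2\<close> to make it regular at \<open>s = 0\<close>.\<close>
definition zeta_main :: "complex \<Rightarrow> complex" where
  "zeta_main s = rGamma s * (zeta_tail s + 1 / (s - 1) + zeta_head s) - rGamma (s + 1) / 2"

lemma zeta_main_holomorphic: "zeta_main holomorphic_on {s. Re s > -1} - {1}"
  unfolding zeta_main_def
  by (intro holomorphic_intros holomorphic_on_subset[OF zeta_tail_holomorphic]
        holomorphic_on_subset[OF zeta_head_holomorphic]) auto

lemma rGamma_over_self:
  fixes s :: complex
  assumes "s \<noteq> 0"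
  shows "rGamma s * (1 / (2 * s)) = rGamma (s + 1) / 2"
  using rGamma_plus1[of s] assms by (simp add: field_simps)

lemma dexp_0_eq_bose:
  assumes "v > 0"
  shows "dexp 0 (of_real v) = bose (of_real v) + 1 / complex_of_real v"
  using dexp_0[of "of_real v"] assms by (simp add: bose_def)

lemma powr_minus_1_over:
  assumes "v > 0"
  shows "complex_of_real v powr (s - 1) * (1 / of_real v) = of_real v powr (s - 2)"
proof -
  have "complex_of_real v powr (s - 2) = of_real v powr (s - 1) * of_real v powr (-1)"
    using assms by (subst powr_add [symmetric]) simp
  thus ?thesis using assms by (simp add: powr_minus divide_inverse)
qed

lemma rGamma_Gamma_cancel:
  assumes "Re s > 0"
  shows "rGamma s * (Gamma s * w) = (w :: complex)"
proof -
  have "s \<notin> \<int>\<^sub>\<le>\<^sub>0" using assms by (auto elim!: nonpos_Ints_cases)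
  thus ?thesis by (simp add: rGamma_inverse_Gamma Gamma_eq_zero_iff)
qed

text \<open>On (0,1] the kernel 1/(e^v - 1) splits into the head, 1/v and -1/2; for Re s > 1 the
  last two contribute 1/(s-1) and -1/(2s).\<close>

lemma zeta_main_eq_series:
  assumes s: "Re s > 1"
  shows "zeta_main s = zeta_series s"
proof -
  note M = Mellin_dexp_0[OF s]
  have i1: "integrable unit_lborel (\<lambda>v. complex_of_real v powr (s - 2))"
       and v1: "(\<integral>v. complex_of_real v powr (s - 2) \<partial>unit_lborel) = 1 / (s - 1)"
    using powr_integral_0_1[of "s - 2"] s by (auto simp: algebra_simps)
  have i2: "integrable unit_lborel (\<lambda>v. complex_of_real v powr (s - 1))"
       and v2: "(\<integral>v. complex_of_real v powr (s - 1) \<partial>unit_lborel) = 1 / s"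
    using powr_integral_0_1[of "s - 1"] s by (auto simp: algebra_simps)
  have i3: "integrable unit_lborel (\<lambda>v. head_kernel s v)"
    using s by (intro integrable_zeta_head) auto
  have "Gamma s * zeta_series s = (\<integral>v. tail_kernel s v \<partial>unit_lborel) + zeta_tail s"
    unfolding M(2)[symmetric] zeta_tail_def
    by (rule integral_lborel_on_split) (use M(1) in \<open>auto simp: integrable_lborel_on_split_iff\<close>)
  also have "(\<integral>v. tail_kernel s v \<partial>unit_lborel) =
     (\<integral>v. head_kernel s v + of_real v powr (s - 2) - 1/2 * of_real v powr (s - 1) \<partial>unit_lborel)"
    by (intro integral_lborel_on_cong)
       (auto simp: dexp_0_eq_bose powr_minus_1_over [symmetric] algebra_simps)
  also have "\<dots> = zeta_head s + 1 / (s - 1) - 1/2 * (1 / s)"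
    using i1 i2 i3 by (simp add: zeta_head_def v1 v2)
  finally have *: "Gamma s * zeta_series s = zeta_tail s + 1 / (s - 1) + zeta_head s - 1 / (2 * s)"
    by simp
  have "zeta_series s = rGamma s * (Gamma s * zeta_series s)"
    using rGamma_Gamma_cancel[of s] s by simp
  also have "\<dots> = zeta_main s" unfolding * zeta_main_def
    using s by (subst rGamma_over_self [symmetric]) (auto simp: ring_distribs)
  finally show ?thesis ..
qed

text \<open>The term 1/(s-1), which stems from 1/v on (0,1] when Re s > 1, now stems from -1/v on
  the tail. Both Mellin integrals thus give the same closed expression, on either side of the pole
  at 1.\<close>

lemma zt_eq_zeta_main_0_1:
  assumes s: "0 < Re s" "Re s < 1"
  shows "zt s = zeta_main s"
proof -
  have int: "integrable half_lborel (\<lambda>v. of_real v powr (s - 1) * bose (of_real v))"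
    using integrable_bose_integrand[of 0 0 s] s by (simp add: bosed_def)
  have i1: "integrable tail_lborel (\<lambda>v. complex_of_real v powr (s - 2))"
       and v1: "(\<integral>v. complex_of_real v powr (s - 2) \<partial>tail_lborel) = - 1 / (s - 1)"
    using powr_integral_1_inf[of "s - 2"] s by (auto simp: algebra_simps)
  have i2: "integrable unit_lborel (\<lambda>v. complex_of_real v powr (s - 1))"
       and v2: "(\<integral>v. complex_of_real v powr (s - 1) \<partial>unit_lborel) = 1 / s"
    using powr_integral_0_1[of "s - 1"] s by (auto simp: algebra_simps)
  have i3: "integrable unit_lborel (\<lambda>v. head_kernel s v)"
    using s by (intro integrable_zeta_head) auto
  have "zt s = rGamma s * (\<integral>v. of_real v powr (s - 1) * bose (of_real v) \<partial>half_lborel)"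
    using zt_eq[of 0 s] s by (simp add: bosed_def)
  also have "(\<integral>v. of_real v powr (s - 1) * bose (of_real v) \<partial>half_lborel) =
      (\<integral>v. of_real v powr (s - 1) * bose (of_real v) \<partial>unit_lborel) +
      (\<integral>v. of_real v powr (s - 1) * bose (of_real v) \<partial>tail_lborel)"
    by (rule integral_lborel_on_split) (use int in \<open>auto simp: integrable_lborel_on_split_iff\<close>)
  also have "(\<integral>v. of_real v powr (s - 1) * bose (of_real v) \<partial>unit_lborel) =
      (\<integral>v. head_kernel s v - 1/2 * of_real v powr (s - 1) \<partial>unit_lborel)"
    by (intro Bochner_Integration.integral_cong refl) (auto simp: algebra_simps)
  also have "\<dots> = zeta_head s - 1/2 * (1/s)"
    using i2 i3 by (simp add: zeta_head_def v2)
  also have "(\<integral>v. of_real v powr (s - 1) * bose (of_real v) \<partial>tail_lborel) =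
      (\<integral>v. tail_kernel s v - of_real v powr (s - 2) \<partial>tail_lborel)"
    by (intro integral_lborel_on_cong)
       (auto simp: dexp_0_eq_bose powr_minus_1_over [symmetric] algebra_simps)
  also have "\<dots> = zeta_tail s + 1 / (s - 1)"
    using i1 integrable_zeta_tail[of s] by (simp add: zeta_tail_def v1 field_simps)
  also have "rGamma s * (zeta_head s - 1/2 * (1/s) + (zeta_tail s + 1 / (s - 1))) = zeta_main s"
    unfolding zeta_main_def using s
    by (subst rGamma_over_self [symmetric]) (auto simp: ring_distribs)
  finally show ?thesis .
qed

text \<open>Identity theorem from the strip 0 < Re s < 1. The part with Re s < 0 is where the
  functional equation is derived.\<close>

lemma zt_eq_zeta_main:
  assumes "-1 < Re s" "Re s < 1"
  shows "zt s = zeta_main s"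
proof (rule analytic_continuation_open[where f = zt and g = zeta_main and s = "{s. 0 < Re s \<and> Re s < 1}" and s' = "{s. -1 < Re s \<and> Re s < 1}"])
  show "open {s. 0 < Re s \<and> Re s < 1}" "open {s. -1 < Re s \<and> Re s < 1}"
    by (intro open_Collect_less open_Collect_conj continuous_intros)+
  show "{s. 0 < Re s \<and> Re s < 1} \<noteq> {}" by (auto intro!: exI[of _ "1/2"])
  have "{s. -1 < Re s \<and> Re s < 1} = {s. -1 < Re s} \<inter> {s. Re s < 1}" by auto
  thus "connected {s. -1 < Re s \<and> Re s < 1}"
    by (auto intro!: convex_connected convex_Int convex_halfspace_Re_gt convex_halfspace_Re_lt)
  show "zt holomorphic_on {s. -1 < Re s \<and> Re s < 1}"
    by (rule holomorphic_on_subset[OF zt_holomorphic]) auto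
  show "zeta_main holomorphic_on {s. -1 < Re s \<and> Re s < 1}"
    by (rule holomorphic_on_subset[OF zeta_main_holomorphic]) auto
qed (use assms zt_eq_zeta_main_0_1 in auto)

text \<open>The continuation is glued from \<open>zt\<close> and \<open>zeta_main\<close>, which
  agree on 0 < Re s < 1. Applying \<open>remove_sings\<close> gives the value 0 at the pole 1, as
  the normalisation demands; uniqueness of the normalised continuation does the rest.\<close>

lemma Riemann_zeta_eq_zt:
  assumes "Re s < 1"
  shows "Riemann_zeta s = zt s"
proof -
  define F where "F s = (if Re s < 1 then zt s else remove_sings zeta_main s)" for s
  have op: "open {s. Re s < 1}" "open {s. Re s > 0}" "open {s. Re s > 1}"
    by (intro open_Collect_less continuous_intros)+
  have opm: "open ({s. Re s > -1} - {1})"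
    by (intro open_Diff open_Collect_less continuous_intros)
  have an: "zeta_main analytic_on {s}" if "Re s > -1" "s \<noteq> 1" for s
    using zeta_main_holomorphic opm that by (auto simp: analytic_on_open[symmetric] intro: analytic_on_subset)
  have rs: "remove_sings zeta_main s = zeta_main s" if "Re s > -1" "s \<noteq> 1" for s
    using an[OF that] by (rule remove_sings_at_analytic)
  have tail: "zeta_tail meromorphic_on {s. Re s > 0}"
    by (intro analytic_on_imp_meromorphic_on)
       (auto simp: analytic_on_open[OF op(2)] intro: holomorphic_on_subset[OF zeta_tail_holomorphic])
  have head: "zeta_head meromorphic_on {s. Re s > 0}"
    by (intro analytic_on_imp_meromorphic_on)
       (auto simp: analytic_on_open[OF op(2)] intro: holomorphic_on_subset[OF zeta_head_holomorphic])
  have rG: "rGamma meromorphic_on {s. Re s > 0}" "(\<lambda>s. rGamma (s + 1)) meromorphic_on {s. Re s > 0}"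
    by (intro analytic_on_imp_meromorphic_on;
        simp add: analytic_on_open[OF op(2)]; intro holomorphic_intros)+
  have mero: "zeta_main meromorphic_on {s. Re s > 0}"
    unfolding zeta_main_def[abs_def] by (intro meromorphic_intros tail head rG)
  have F: "F nicely_meromorphic_on UNIV"
  proof (rule nicely_meromorphic_on_UNIV_local)
    fix z
    show "\<exists>S g. open S \<and> z \<in> S \<and> g nicely_meromorphic_on S \<and> (\<forall>w\<in>S. F w = g w)"
    proof (cases "Re z < 1")
      case True
      have "zt nicely_meromorphic_on {s. Re s < 1}"
        by (intro analytic_on_imp_nicely_meromorphic_on) (auto simp: analytic_on_open[OF op(1)] zt_holomorphic)
      thus ?thesis using True op
        by (intro exI[of _ "{s. Re s < 1}"] exI[of _ zt]) (auto simp: F_def)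
    next
      case False
      have "remove_sings zeta_main nicely_meromorphic_on {s. Re s > 0}"
        by (rule remove_sings_nicely_meromorphic[OF mero])
      moreover have "F w = remove_sings zeta_main w" if "Re w > 0" for w
        using that zt_eq_zeta_main[of w] rs[of w] by (cases "w = 1") (auto simp: F_def)
      ultimately show ?thesis using False op
        by (intro exI[of _ "{s. Re s > 0}"] exI[of _ "remove_sings zeta_main"]) auto
    qed
  qed
  have RF: "Riemann_zeta = F"
    unfolding Riemann_zeta_def
  proof (rule meromorphic_continuation_eqI[OF F op(3)])
    show "{s. Re s > 1} \<noteq> {}" by (auto intro!: exI[of _ 2])
    fix s assume s: "s \<in> {s. Re s > 1}"
    thus "F s = (\<Sum>\<^sub>\<infinity>n\<in>{1::nat..}. 1 / of_nat n powr s)"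
      using rs[of s] zeta_series_infsum[of s] zeta_main_eq_series[of s] by (cases "s = 1") (auto simp: F_def)
  qed
  show ?thesis unfolding RF F_def using assms by simp
qed

section \<open>The functional equation and nonvanishing at \<open>1/2 - 3j\<close>\<close>

text \<open>Differentiating the constant Gamma(z) Gamma(1-z) sin(pi z) = pi produces this expression
  times a nonvanishing Gamma product. Divided by the sine it is the cotangent formula.\<close>

lemma Digamma_reflection:
  fixes z :: complex
  assumes "z \<notin> \<int>"
  shows "(Digamma z - Digamma (1 - z)) * sin (of_real pi * z) + of_real pi * cos (of_real pi * z) = 0"
proof -
  have z: "z \<notin> \<int>\<^sub>\<le>\<^sub>0" "1 - z \<notin> \<int>\<^sub>\<le>\<^sub>0"
    using assms nonpos_Ints_Int by (blast, metis Ints_1 Ints_diff diff_diff_eq2 add_diff_cancel_left')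
  define g where "g z = Gamma z * Gamma (1 - z) * sin (of_real pi * z)" for z :: complex
  have "g w = of_real pi" if "w \<in> - \<int>" for w
  proof -
    have "sin (of_real pi * w) \<noteq> 0"
      using that sin_eq_0[of "of_real pi * w"] by (auto simp: field_simps)
    thus ?thesis by (simp add: g_def Gamma_reflection_complex)
  qed
  moreover have "open (- \<int> :: complex set)" by (simp add: open_Compl)
  ultimately have "(g has_field_derivative 0) (at z)"
    using assms by (intro has_field_derivative_transform_within_open[OF DERIV_const]) auto
  moreover have "(g has_field_derivative Gamma z * Gamma (1 - z) *
      ((Digamma z - Digamma (1 - z)) * sin (of_real pi * z) + of_real pi * cos (of_real pi * z))) (at z)"
    unfolding g_def using z by (auto intro!: derivative_eq_intros simp: algebra_simps)
  ultimately have "Gamma z * Gamma (1 - z) *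
      ((Digamma z - Digamma (1 - z)) * sin (of_real pi * z) + of_real pi * cos (of_real pi * z)) = 0"
    using DERIV_unique by blast
  moreover have "Gamma z \<noteq> 0" "Gamma (1 - z) \<noteq> 0" using z by (auto simp: Gamma_eq_zero_iff)
  ultimately show ?thesis by simp
qed

text \<open>The two partial fractions of 1/(e^v - 1) at the conjugate poles 2 pi i (k+1) and -2 pi i
  (k+1), added up.\<close>

definition pfd_term :: "nat \<Rightarrow> real \<Rightarrow> real" where
  "pfd_term k v = 2 * v / (v ^ 2 + (2 * pi * real (Suc k)) ^ 2)"

text \<open>At z = i v/(2 pi) the series for Digamma(1+z) - Digamma(1-z) has the terms
  \<open>pfd_term\<close> up to the factor 2 pi i, while reflection evaluates the difference through
  cot(i v/2), that is, through e^v.\<close>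

lemma bose_pfd:
  assumes v: "v > 0"
  shows "(\<lambda>k. complex_of_real (pfd_term k v)) sums (bose (of_real v) + 1/2)"
proof -
  define z where "z = \<i> * of_real (v / (2 * pi))"
  have Im_z: "Im z = v / (2 * pi)" by (simp add: z_def)
  have z: "z \<notin> \<int>" using v by (auto elim!: Ints_cases simp: complex_eq_iff z_def)
  have z0: "z \<noteq> 0" "1 + z \<noteq> 0" "1 - z \<noteq> 0" using v Im_z by (auto simp: complex_eq_iff)
  have "(\<lambda>k. (inverse (of_nat (Suc k)) - inverse (1 + z + of_nat k)) - (inverse (of_nat (Suc k)) - inverse (1 - z + of_nat k)))
          sums ((Digamma (1 + z) + euler_mascheroni) - (Digamma (1 - z) + euler_mascheroni))"
    unfolding Digamma_def diff_add_cancel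
    by (intro sums_diff summable_sums summable_Digamma z0)
  hence "(\<lambda>k. inverse (1 - z + of_nat k) - inverse (1 + z + of_nat k)) sums (Digamma (1 + z) - Digamma (1 - z))"
    by simp
  also have "(\<lambda>k. inverse (1 - z + of_nat k) - inverse (1 + z + of_nat k)) = (\<lambda>k. 2 * of_real pi * \<i> * of_real (pfd_term k v))"
  proof
    fix k
    define m where "m = real (Suc k)"
    have m: "m > 0" by (simp add: m_def)
    have m_eq: "1 + of_nat k = complex_of_real m" by (simp add: m_def)
    have nz: "complex_of_real m - z \<noteq> 0" "complex_of_real m + z \<noteq> 0"
      using v Im_z by (auto simp: complex_eq_iff)
    have nz': "v ^ 2 + (2 * pi * m) ^ 2 \<noteq> 0" using v by (simp add: sum_power2_eq_zero_iff)
    have zz: "(complex_of_real m - z) * (complex_of_real m + z) = of_real ((v ^ 2 + (2 * pi * m) ^ 2) / (4 * pi ^ 2))"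
      by (simp add: z_def field_simps power2_eq_square)
    have "inverse (1 - z + of_nat k) - inverse (1 + z + of_nat k) = inverse (of_real m - z) - inverse (of_real m + z)"
      by (simp add: m_eq [symmetric] algebra_simps)
    also have "\<dots> = 2 * z / ((of_real m - z) * (of_real m + z))"
      using nz by (simp add: field_simps)
    also have "\<dots> = 2 * of_real pi * \<i> * of_real (2 * v / (v ^ 2 + (2 * pi * m) ^ 2))"
      unfolding zz using nz'
      by (simp add: z_def divide_simps flip: of_real_power of_real_mult of_real_add) 
         (simp add: power2_eq_square)
    finally show "inverse (1 - z + of_nat k) - inverse (1 + z + of_nat k) = 2 * of_real pi * \<i> * of_real (pfd_term k v)"
      by (simp only: pfd_term_def m_def)
  qed
  also have "Digamma (1 + z) - Digamma (1 - z) = 2 * of_real pi * \<i> * (bose (of_real v) + 1/2)"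
  proof -
    define E where "E = exp (complex_of_real v)"
    define e where "e = exp (complex_of_real (v / 2))"
    have E: "E = e * e" "e \<noteq> 0" by (simp_all add: E_def e_def exp_add [symmetric])
    have E1: "E \<noteq> 1" using exp_neq_1_bose_domain[of "of_real v"] v by (simp add: E_def)
    have iz: "\<i> * (of_real pi * z) = - of_real (v / 2)" by (simp add: z_def)
    have ex: "exp (\<i> * (of_real pi * z)) = inverse e" "exp (- (\<i> * (of_real pi * z))) = e"
      unfolding iz e_def exp_minus by simp_all
    have s: "sin (of_real pi * z) = (inverse e - e) / (2 * \<i>)" 
      unfolding sin_exp_eq using ex by (simp add: mult_ac)
    have c: "cos (of_real pi * z) = (inverse e + e) / 2"
      unfolding cos_exp_eq using ex by (simp add: mult_ac)
    \<comment> \<open>Multiplying by 2 i e^(v/2) clears the half exponentials, so that only E = e^v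
      remains.\<close>
    have s': "sin (of_real pi * z) * (2 * \<i> * e) = 1 - E" unfolding s using E by (simp add: field_simps)
    have c': "cos (of_real pi * z) * (2 * \<i> * e) = \<i> * (1 + E)" unfolding c using E by (simp add: field_simps)
    have "(Digamma z - Digamma (1 - z)) * (sin (of_real pi * z) * (2 * \<i> * e)) + of_real pi * (cos (of_real pi * z) * (2 * \<i> * e)) =
          ((Digamma z - Digamma (1 - z)) * sin (of_real pi * z) + of_real pi * cos (of_real pi * z)) * (2 * \<i> * e)"
      by (simp add: algebra_simps)
    hence "(Digamma z - Digamma (1 - z)) * (1 - E) + of_real pi * (\<i> * (1 + E)) = 0"
      unfolding s' c' Digamma_reflection[OF z] by simp
    hence "(Digamma z - Digamma (1 - z)) * (E - 1) = of_real pi * \<i> * (1 + E)"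
      by algebra
    hence D: "Digamma z - Digamma (1 - z) = of_real pi * \<i> * (1 + E) / (E - 1)"
      using E1 by (simp add: eq_divide_eq)
    have iz2: "1 / z = - (2 * of_real pi * \<i>) / of_real v"
      using v by (simp add: z_def field_simps)
    have "Digamma (1 + z) - Digamma (1 - z) = (Digamma z - Digamma (1 - z)) + 1 / z"
      using Digamma_plus1[OF z0(1)] by (simp add: add_ac)
    also have "\<dots> = 2 * of_real pi * \<i> * (((1 + E) / (E - 1)) / 2 - 1 / of_real v)"
      unfolding D iz2 using v E1 by (simp add: field_simps)
    also have "((1 + E) / (E - 1)) / 2 = 1 / (E - 1) + 1 / 2"
      using E1 by (simp add: field_simps)
    also have "\<dots> - 1 / of_real v = bose (of_real v) + 1/2"
      using v by (simp add: bose_def E_def)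
    finally show ?thesis .
  qed
  finally have "(\<lambda>k. 2 * of_real pi * \<i> * complex_of_real (pfd_term k v)) sums (2 * of_real pi * \<i> * (bose (of_real v) + 1/2))" .
  thus ?thesis by (subst (asm) sums_mult_iff) auto
qed

lemma powr_of_real_mult_self:
  assumes "x > 0"
  shows "(complex_of_real x * of_real x) powr b = of_real x powr (2 * b)"
  unfolding mult_2 powr_add by (rule powr_times_real) (use assms in auto)

text \<open>The substitution v = sqrt w reduces this to \<open>Mellin_inverse_power\<close> with p =
  0, c^2 for u and (1+s)/2 for a.\<close>

lemma integral_powr_over_square:
  assumes s: "-1 < Re s" "Re s < 1" and c: "c > 0"
  shows "integrable half_lborel (\<lambda>v. of_real v powr (s - 1) * of_real (2 * v / (v ^ 2 + c ^ 2)))" (is ?A)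
    and "(\<integral>v. of_real v powr (s - 1) * of_real (2 * v / (v ^ 2 + c ^ 2)) \<partial>half_lborel) =
           Gamma ((1 + s) / 2) * Gamma ((1 - s) / 2) * of_real c powr (s - 1)" (is ?B)
proof -
  define a where "a = (1 + s) / 2"
  define f where "f v = (of_real v powr (s - 1) * of_real (2 * v / (v ^ 2 + c ^ 2)) :: complex)" for v :: real
  have ein: "einterval 0 \<infinity> = {0<..}" by (auto simp: einterval_def zero_ereal_def)
  have a2: "2 * (a - 1) = s - 1" by (simp add: a_def field_simps)
  have a: "0 < Re a" "Re a < real 0 + 1" using s by (auto simp: a_def)
  have c2: "c ^ 2 > 0" using c by simp
  note M = Mellin_inverse_power[OF c2 a]
  have M1: "integrable half_lborel (\<lambda>w. of_real w powr (a - 1) * (1 / of_real (c ^ 2 + w)) :: complex)"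
    using M(1) by simp
  have sub: "(1 / (2 * sqrt w)) *\<^sub>R f (sqrt w) = of_real w powr (a - 1) * (1 / of_real (c ^ 2 + w))"
    if w: "w > 0" for w
  proof -
    have "of_real w powr (a - 1) = (of_real (sqrt w) * of_real (sqrt w) :: complex) powr (a - 1)"
      using w by (simp flip: of_real_mult)
    also have "\<dots> = of_real (sqrt w) powr (s - 1)"
      using w by (simp only: powr_of_real_mult_self real_sqrt_gt_zero a2)
    finally have *: "of_real w powr (a - 1) = complex_of_real (sqrt w) powr (s - 1)" .
    have "1 / (2 * sqrt w) * (2 * sqrt w / ((sqrt w) ^ 2 + c ^ 2)) = 1 / (c ^ 2 + w)"
      using w by (simp add: add.commute)
    hence "(1 / (2 * sqrt w)) *\<^sub>R f (sqrt w) = of_real (sqrt w) powr (s - 1) * of_real (1 / (c ^ 2 + w))"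
      unfolding f_def scaleR_conv_of_real by (simp only: mult.left_commute of_real_mult [symmetric])
    thus ?thesis unfolding * by simp
  qed
  have DERIV_sqrt: "DERIV sqrt w :> 1 / (2 * sqrt w)" if "0 < ereal w" for w
    using that by (auto intro!: derivative_eq_intros simp: field_simps)
  have cont_f: "isCont f v" if "v > 0" for v
    unfolding f_def using that c2 by (intro continuous_intros) (auto simp: sum_power2_eq_zero_iff add_nonneg_eq_0_iff)
  have cont_g: "isCont (\<lambda>w. 1 / (2 * sqrt w)) w" if "0 < ereal w" for w
    using that by (intro continuous_intros) auto
  have lim0: "((ereal \<circ> sqrt \<circ> real_of_ereal) \<longlongrightarrow> 0) (at_right 0)"
  proof -
    have "(sqrt \<longlongrightarrow> sqrt 0) (at_right 0)" by (intro tendsto_intros)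
    hence "((ereal \<circ> sqrt) \<longlongrightarrow> ereal 0) (at_right 0)" unfolding o_def by (intro tendsto_intros) simp
    thus ?thesis unfolding zero_ereal_def ereal_tendsto_simps .
  qed
  have lim1: "((ereal \<circ> sqrt \<circ> real_of_ereal) \<longlongrightarrow> \<infinity>) (at_left \<infinity>)"
  proof -
    have "((ereal \<circ> sqrt) \<longlongrightarrow> \<infinity>) at_top"
      using sqrt_at_top by (simp add: o_def tendsto_PInfty_eq_at_top)
    thus ?thesis unfolding ereal_tendsto_simps .
  qed
  have "integrable half_lborel (\<lambda>w. (1 / (2 * sqrt w)) *\<^sub>R f (sqrt w))"
    by (subst integrable_lborel_on_cong[OF sub]) (use M1 in simp_all)
  hence si: "set_integrable lborel {0<..} (\<lambda>w. (1 / (2 * sqrt w)) *\<^sub>R f (sqrt w))"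
    by (subst integrable_lborel_on_iff [symmetric]) auto
  \<comment> \<open>Integrability is transported by the substitution rule for nonnegative functions,
    hence the norm; the rule for complex values then needs integrability on both sides.\<close>
  have "set_integrable lborel (einterval 0 \<infinity>) (\<lambda>v. norm (f v))"
  proof (rule interval_integral_substitution_nonneg(1)[where g = sqrt and g' = "\<lambda>w. 1 / (2 * sqrt w)" and a = 0 and b = \<infinity>])
    show "set_integrable lborel (einterval 0 \<infinity>) (\<lambda>w. norm (f (sqrt w)) * (1 / (2 * sqrt w)))"
    proof -
      have "set_integrable lborel {0<..} (\<lambda>w. norm ((1 / (2 * sqrt w)) *\<^sub>R f (sqrt w)))"
        by (rule set_integrable_norm[OF si])
      also have "?this \<longleftrightarrow> set_integrable lborel {0<..} (\<lambda>w. norm (f (sqrt w)) * (1 / (2 * sqrt w)))"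
        by (intro set_integrable_cong) auto
      finally show ?thesis unfolding ein .
    qed
  qed (use DERIV_sqrt cont_f cont_g lim0 lim1 in \<open>auto intro!: continuous_intros simp: zero_ereal_def\<close>)
  hence nint: "integrable half_lborel (\<lambda>v. norm (f v))"
    unfolding ein by (simp add: integrable_lborel_on_iff)
  have meas: "f \<in> borel_measurable half_lborel"
    by (intro measurable_lborel_on continuous_at_imp_continuous_on) (use cont_f in auto)
  have int: "integrable half_lborel f"
    using nint integrable_norm_iff[OF meas] by simp
  thus ?A
    unfolding f_def .
  have "(LBINT v=0..\<infinity>. f v) = (LBINT w=0..\<infinity>. (1 / (2 * sqrt w)) *\<^sub>R f (sqrt w))"
    by (rule interval_integral_substitution_integrable)
       (use DERIV_sqrt cont_f cont_g lim0 lim1 si int in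
          \<open>auto simp: ein integrable_lborel_on_iff zero_ereal_def\<close>)
  hence "integral\<^sup>L half_lborel f = (\<integral>w. (1 / (2 * sqrt w)) *\<^sub>R f (sqrt w) \<partial>half_lborel)"
    by (simp add: interval_lebesgue_integral_0_infty integral_lborel_on_eq)
  also have "\<dots> = (\<integral>w. of_real w powr (a - 1) * (1 / of_real (c ^ 2 + w)) \<partial>half_lborel)"
    by (intro integral_lborel_on_cong sub) auto
  also have "\<dots> = Gamma a * (Gamma (1 - a) * of_real (c ^ 2) powr (a - 1))"
    using M(2) by simp
  also have "of_real (c ^ 2) powr (a - 1) = (of_real c * of_real c :: complex) powr (a - 1)"
    by (simp add: power2_eq_square)
  also have "\<dots> = of_real c powr (s - 1)"
    using c by (simp only: powr_of_real_mult_self a2)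
  also have "1 - a = (1 - s) / 2" by (simp add: a_def field_simps)
  finally show ?B
    by (simp add: f_def[abs_def] a_def mult_ac)
qed

text \<open>For Re s < 0 both 1/(s-1) and -1/(2s) are integrals of powers over the tail, so
  \<open>zeta_main\<close> becomes one Mellin integral over the whole half line.\<close>

lemma zeta_main_strip:
  assumes s: "-1 < Re s" "Re s < 0"
  shows "zeta_main s = rGamma s * (\<integral>v. head_kernel s v \<partial>half_lborel)"
proof -
  have i1: "integrable tail_lborel (\<lambda>v. complex_of_real v powr (s - 2))"
       and v1: "(\<integral>v. complex_of_real v powr (s - 2) \<partial>tail_lborel) = - 1 / (s - 1)"
    using powr_integral_1_inf[of "s - 2"] s by (auto simp: algebra_simps)
  have i2: "integrable tail_lborel (\<lambda>v. complex_of_real v powr (s - 1))"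
       and v2: "(\<integral>v. complex_of_real v powr (s - 1) \<partial>tail_lborel) = - 1 / s"
    using powr_integral_1_inf[of "s - 1"] s by (auto simp: algebra_simps)
  have eq: "head_kernel s v =
      tail_kernel s v - of_real v powr (s - 2) + 1/2 * of_real v powr (s - 1)"
    if "v > 1" for v
    using that by (simp add: dexp_0_eq_bose powr_minus_1_over [symmetric] algebra_simps)
  have i3: "integrable tail_lborel (\<lambda>v. head_kernel s v)"
    by (subst integrable_lborel_on_cong[OF eq]) (use i1 i2 integrable_zeta_tail[of s] in auto)
  have "(\<integral>v. head_kernel s v \<partial>half_lborel) =
      zeta_head s + (\<integral>v. head_kernel s v \<partial>tail_lborel)"
    unfolding zeta_head_def by (rule integral_lborel_on_split[OF integrable_zeta_head i3]) (use s in auto)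
  also have "(\<integral>v. head_kernel s v \<partial>tail_lborel) =
      (\<integral>v. tail_kernel s v - of_real v powr (s - 2) + 1/2 * of_real v powr (s - 1) \<partial>tail_lborel)"
    by (intro integral_lborel_on_cong eq) auto
  also have "\<dots> = zeta_tail s + 1 / (s - 1) - 1/2 * (1/s)"
    using i1 i2 integrable_zeta_tail[of s] by (simp add: zeta_tail_def v1 v2)
  also have "rGamma s * (zeta_head s + (zeta_tail s + 1 / (s - 1) - 1/2 * (1/s))) = zeta_main s"
    unfolding zeta_main_def using s
    by (subst rGamma_over_self [symmetric]) (auto simp: ring_distribs)
  finally show ?thesis ..
qed

text \<open>Termwise integration of the partial fractions of \<open>bose_pfd\<close>. The integral
  needs Re s > -1 at the origin, and the resulting series in (k+1)^(s-1) needs Re s < 0.\<close>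

lemma zt_functional_equation_strip:
  assumes s: "-1 < Re s" "Re s < 0"
  shows "zt s = rGamma s * (Gamma ((1 + s) / 2) * Gamma ((1 - s) / 2) * (of_real (2 * pi) powr (s - 1) * zeta_series (1 - s)))"
proof -
  define f where "f k v = (of_real v powr (s - 1) * of_real (pfd_term k v) :: complex)" for k v
  define \<sigma> where "\<sigma> = complex_of_real (Re s)"
  define G where "G s = Gamma ((1 + s) / 2) * Gamma ((1 - s) / 2)" for s :: complex
  have pfd_pos: "pfd_term k v \<ge> 0" if "v > 0" for k v using that by (simp add: pfd_term_def)
  have int: "integrable half_lborel (f k)" 
    and val: "integral\<^sup>L half_lborel (f k) = G s * of_real (2 * pi * real (Suc k)) powr (s - 1)" for k
    using integral_powr_over_square[of s "2 * pi * real (Suc k)"] s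
    unfolding f_def pfd_term_def G_def by (simp_all del: of_nat_Suc)
  \<comment> \<open>The norm of a term is the same term at the real point Re s, so the integrals of
    the norms come from the same formula and are summable.\<close>
  have normf: "complex_of_real (norm (f k v)) = of_real v powr (\<sigma> - 1) * of_real (pfd_term k v)" if "v > 0" for k v
  proof -
    have "of_real v powr (\<sigma> - 1) = complex_of_real (v powr (Re s - 1))"
      using that powr_of_real[of v "Re s - 1"] by (simp add: \<sigma>_def)
    thus ?thesis using that pfd_pos[OF that, of k]
      by (simp add: f_def norm_mult norm_powr_real_powr)
  qed
  have norm_int: "(\<integral>v. norm (f k v) \<partial>half_lborel) = norm (G \<sigma>) * (2 * pi) powr (Re s - 1) * real (Suc k) powr (-(1 - Re s))" for k
  proof -
    have "complex_of_real (\<integral>v. norm (f k v) \<partial>half_lborel) = (\<integral>v. complex_of_real (norm (f k v)) \<partial>half_lborel)"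
      by simp
    also have "\<dots> = (\<integral>v. of_real v powr (\<sigma> - 1) * of_real (pfd_term k v) \<partial>half_lborel)"
      by (intro integral_lborel_on_cong normf) auto
    also have "\<dots> = G \<sigma> * of_real (2 * pi * real (Suc k)) powr (\<sigma> - 1)"
      using integral_powr_over_square(2)[of \<sigma> "2 * pi * real (Suc k)"] s
      unfolding pfd_term_def G_def by (simp add: \<sigma>_def del: of_nat_Suc)
    finally have "norm (complex_of_real (\<integral>v. norm (f k v) \<partial>half_lborel)) = norm (G \<sigma> * of_real (2 * pi * real (Suc k)) powr (\<sigma> - 1))"
      by simp
    also have "norm (of_real (2 * pi * real (Suc k)) powr (\<sigma> - 1)) = (2 * pi * real (Suc k)) powr (Re s - 1)"
      by (subst norm_powr_real_powr) (auto simp: \<sigma>_def)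
    hence "norm (G \<sigma> * of_real (2 * pi * real (Suc k)) powr (\<sigma> - 1)) = norm (G \<sigma>) * (2 * pi) powr (Re s - 1) * real (Suc k) powr (-(1 - Re s))"
      by (simp add: norm_mult powr_mult del: of_nat_Suc)
    finally show ?thesis by (simp del: of_nat_Suc)
  qed
  have sums: "summable (\<lambda>k. \<integral>v. norm (f k v) \<partial>half_lborel)"
    unfolding norm_int
    using integrable_real_powr_Suc[of "1 - Re s"] s by (intro summable_mult) (simp add: integrable_count_space_nat_iff)
  have fs: "(\<lambda>k. f k v) sums (head_kernel s v)" if "v > 0" for v
    unfolding f_def by (intro sums_mult bose_pfd that)
  have summ: "summable (\<lambda>k. norm (f k v))" if "v > 0" for v
  proof -
    have "summable (\<lambda>k. complex_of_real (pfd_term k v))" using bose_pfd[OF that] by (rule sums_summable)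
    hence "summable (\<lambda>k. norm (complex_of_real v powr (s - 1)) * pfd_term k v)"
      by (intro summable_mult) (simp add: summable_of_real_iff)
    thus ?thesis using pfd_pos[OF that] by (simp add: f_def norm_mult)
  qed
  have "(\<integral>v. head_kernel s v \<partial>half_lborel) = (\<integral>v. (\<Sum>k. f k v) \<partial>half_lborel)"
    by (intro integral_lborel_on_cong sums_unique fs) auto
  also have "\<dots> = (\<Sum>k. integral\<^sup>L half_lborel (f k))"
    by (rule integral_suminf[OF int _ sums]) (auto intro!: AE_I2 summ simp: space_restrict_space)
  also have "\<dots> = (\<Sum>k. G s * of_real (2 * pi) powr (s - 1) * (of_nat (Suc k) powr (-(1 - s))))"
  proof (intro suminf_cong)
    fix k
    have "complex_of_real (2 * pi * real (Suc k)) powr (s - 1) = of_real (2 * pi) powr (s - 1) * of_real (real (Suc k)) powr (s - 1)"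
      by (subst of_real_mult, rule powr_times_real) auto
    thus "integral\<^sup>L half_lborel (f k) = G s * of_real (2 * pi) powr (s - 1) * (of_nat (Suc k) powr (-(1 - s)))"
      unfolding val by (simp del: of_nat_Suc)
  qed
  also have "\<dots> = G s * of_real (2 * pi) powr (s - 1) * zeta_series (1 - s)"
  proof -
    have "integrable (count_space UNIV) (\<lambda>k. of_nat (Suc k) powr (-(1 - s)) :: complex)"
      using s by (intro integrable_zeta_series) auto
    from sums_mult[OF sums_integral_count_space_nat[OF this], of "G s * of_real (2 * pi) powr (s - 1)"]
    show ?thesis unfolding zeta_series_def by (simp add: sums_iff del: of_nat_Suc)
  qed
  finally show ?thesis
    using zt_eq_zeta_main[of s] zeta_main_strip[of s] s by (simp add: G_def mult_ac)
qed

text \<open>Identity theorem from the strip. Gamma((1+s)/2) has poles at the negative odd integers;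
  moved to the left as \<open>rGamma\<close>, it leaves both sides holomorphic for Re s < 0.\<close>

lemma zt_functional_equation:
  assumes "Re s < 0"
  shows "zt s * rGamma ((1 + s) / 2) = rGamma s * (Gamma ((1 - s) / 2) * (of_real (2 * pi) powr (s - 1) * zeta_series (1 - s)))"
proof (rule analytic_continuation_open[where s = "{s. -1 < Re s \<and> Re s < 0}" and s' = "{s. Re s < 0}"
         and f = "\<lambda>s. zt s * rGamma ((1 + s) / 2)" and g = "\<lambda>s. rGamma s * (Gamma ((1 - s) / 2) * (of_real (2 * pi) powr (s - 1) * zeta_series (1 - s)))"])
  show "open {s. -1 < Re s \<and> Re s < 0}" "open {s. Re s < 0}"
    by (intro open_Collect_less open_Collect_conj continuous_intros)+
  show "{s. -1 < Re s \<and> Re s < 0} \<noteq> {}" by (auto intro!: exI[of _ "-1/2"])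
  show "connected {s. Re s < 0}" by (intro convex_connected convex_halfspace_Re_lt)
  show "(\<lambda>s. zt s * rGamma ((1 + s) / 2)) holomorphic_on {s. Re s < 0}"
    by (intro holomorphic_intros holomorphic_on_subset[OF zt_holomorphic]) auto
  show "(\<lambda>s. rGamma s * (Gamma ((1 - s) / 2) * (of_real (2 * pi) powr (s - 1) * zeta_series (1 - s)))) holomorphic_on {s. Re s < 0}"
  proof (intro holomorphic_intros)
    show "(\<lambda>s. zeta_series (1 - s)) holomorphic_on {s. Re s < 0}"
      by (rule holomorphic_on_compose_gen[OF _ zeta_series_holomorphic, unfolded o_def]) (auto intro!: holomorphic_intros)
    show "(1 - s) / 2 \<notin> \<int>\<^sub>\<le>\<^sub>0" if "s \<in> {s. Re s < 0}" for s
      using that by (auto elim!: nonpos_Ints_cases simp: complex_eq_iff)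
  qed auto
  fix s assume s: "s \<in> {s. -1 < Re s \<and> Re s < 0}"
  hence "rGamma ((1 + s) / 2) * (Gamma ((1 + s) / 2) * w) = w" for w
    by (intro rGamma_Gamma_cancel) auto
  thus "zt s * rGamma ((1 + s) / 2) = rGamma s * (Gamma ((1 - s) / 2) * (of_real (2 * pi) powr (s - 1) * zeta_series (1 - s)))"
    using s zt_functional_equation_strip[of s] by (simp add: mult_ac)
qed (use assms in auto)

lemma zeta_series_real_nonzero:
  assumes "\<sigma> > 1"
  shows "zeta_series (of_real \<sigma>) \<noteq> 0"
proof -
  have "zeta_series (of_real \<sigma>) = (\<integral>n. complex_of_real (real (Suc n) powr (-\<sigma>)) \<partial>count_space UNIV)"
    unfolding zeta_series_def
  proof (intro Bochner_Integration.integral_cong refl)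
    fix n show "of_nat (Suc n) powr - complex_of_real \<sigma> = complex_of_real (real (Suc n) powr (-\<sigma>))"
      using powr_of_real[of "real (Suc n)" "-\<sigma>"] by (simp del: of_nat_Suc)
  qed
  also have "\<dots> = of_real (\<Sum>n. real (Suc n) powr (-\<sigma>))"
    using integral_count_space_nat[OF integrable_real_powr_Suc[OF assms]] by (simp del: of_nat_Suc)
  finally have *: "zeta_series (of_real \<sigma>) = of_real (\<Sum>n. real (Suc n) powr (-\<sigma>))" .
  have "(\<Sum>n. real (Suc n) powr (-\<sigma>)) > 0"
    using integrable_real_powr_Suc[OF assms]
    by (intro suminf_pos) (auto simp: integrable_count_space_nat_iff simp del: of_nat_Suc)
  with * show ?thesis by simp
qed

lemma quarter_not_nonpos_Int:
  assumes "z = complex_of_real (real_of_int m / 4)" "\<not> 4 dvd m"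
  shows "z \<notin> \<int>\<^sub>\<le>\<^sub>0"
proof
  assume "z \<in> \<int>\<^sub>\<le>\<^sub>0"
  then obtain n :: int where "z = of_int n" by (auto elim!: nonpos_Ints_cases)
  hence "real_of_int m / 4 = real_of_int n"
    using assms(1) by (metis of_real_eq_iff of_real_of_int_eq)
  hence "m = 4 * n" by linarith
  thus False using assms(2) by simp
qed

lemma zt_nonzero_half:
  "zt (1/2) \<noteq> 0"
proof
  assume z: "zt (1/2) = 0"
  define g where "g v = v powr (-1/2) * (1 / v - 1 / (exp v - 1))" for v :: real
  have gpos: "g v > 0" if "v > 0" for v
  proof -
    \<comment> \<open>Squaring 1 + v/2 <= exp(v/2) gives exp v - 1 >= v + v^2/4.\<close>
    have "4 + 4 * v + v * v \<le> 4 * exp v"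
      using power_mono[OF exp_ge_add_one_self[of "v/2"], of 2] exp_double[of "v/2"] that
      by (simp add: power2_eq_square field_simps)
    hence "v < exp v - 1"
      using that mult_pos_pos[OF that that] by linarith
    hence "1 / (exp v - 1) < 1 / v" using that by (intro divide_strict_left_mono) auto
    thus ?thesis using that by (simp add: g_def)
  qed
  have eq: "of_real v powr (1/2 + of_nat 0 - 1) * bosed 0 (of_real v) = - complex_of_real (g v)" if "v > 0" for v
  proof -
    have "of_real v powr (1/2 + of_nat 0 - 1) = complex_of_real (v powr (-1/2))"
      using powr_of_real[of v "-1/2"] that by simp
    moreover have "bosed 0 (of_real v) = complex_of_real (1 / (exp v - 1) - 1 / v)"
      using that by (simp add: bosed_def bose_def exp_of_real)
    ultimately show ?thesis by (simp only: g_def) (simp add: algebra_simps)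
  qed
  have int: "integrable half_lborel (\<lambda>v. of_real v powr (1/2 + of_nat 0 - 1) * bosed 0 (of_real v))"
    using integrable_bose_integrand[of 0 0 "1/2"] by simp
  hence "integrable half_lborel (\<lambda>v. - complex_of_real (g v))"
    by (rule integrable_lborel_on_cong[THEN iffD1, rotated]) (use eq in simp_all)
  hence "integrable half_lborel (\<lambda>v. complex_of_real (g v))" by simp
  from integrable_Re[OF this] have gint: "integrable half_lborel g" by simp
  have "(\<integral>v. of_real v powr (1/2 + of_nat 0 - 1) * bosed 0 (of_real v) \<partial>half_lborel) = (\<integral>v. - complex_of_real (g v) \<partial>half_lborel)"
    by (intro integral_lborel_on_cong eq) auto
  also have "\<dots> = - of_real (\<integral>v. g v \<partial>half_lborel)" by simp
  finally have "rGamma (1/2) * of_real (\<integral>v. g v \<partial>half_lborel) = (0::complex)"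
    using zt_eq[of 0 "1/2"] z by simp
  moreover have "rGamma (1/2) \<noteq> (0::complex)"
    using quarter_not_nonpos_Int[of "1/2" 2] by (simp add: rGamma_eq_zero_iff)
  ultimately have "(\<integral>v. g v \<partial>half_lborel) = 0" by simp
  moreover have "AE v in half_lborel. 0 \<le> g v"
    by (rule AE_I2) (use gpos in \<open>auto simp: space_restrict_space intro: less_imp_le\<close>)
  \<comment> \<open>A nonnegative function with integral 0 vanishes almost everywhere; as
    \<open>g\<close> is strictly positive, the half line would be a null set.\<close>
  ultimately have "AE v in half_lborel. g v = 0"
    using integral_nonneg_eq_0_iff_AE[OF gint] by blast
  hence "AE v in half_lborel. False"
    using AE_space by eventually_elim (use gpos in \<open>force simp: space_restrict_space\<close>)
  from AE_E2[OF this] have "emeasure lborel ({0<..} :: real set) = 0"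
    by (simp add: space_restrict_space emeasure_restrict_space flip: greaterThan_def)
  moreover have "emeasure lborel ({0<..1} :: real set) \<le> emeasure lborel ({0<..} :: real set)"
    by (intro emeasure_mono) auto
  ultimately show False by simp
qed

text \<open>For j > 0 the point 1 - s = 1/2 + 3j exceeds 1, where the Dirichlet series has positive
  terms, and s is not an integer; so no factor on the right of \<open>zt_functional_equation\<close>
  vanishes.\<close>

lemma zt_nonzero: "zt (1/2 - 3 * of_nat j) \<noteq> 0"
proof (cases "j = 0")
  case True
  thus ?thesis using zt_nonzero_half by simp
next
  case False
  define s where "s = complex_of_real (1/2 - 3 * real j)"
  have s: "Re s < 0" using False by (simp add: s_def)
  have "zeta_series (1 - s) \<noteq> 0"
    using zeta_series_real_nonzero[of "1/2 + 3 * real j"] False by (simp add: s_def)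
  moreover have "s \<notin> \<int>\<^sub>\<le>\<^sub>0"
  proof (rule quarter_not_nonpos_Int)
    show "s = complex_of_real (real_of_int (2 - 12 * int j) / 4)" by (simp add: s_def field_simps)
    show "\<not> 4 dvd 2 - 12 * int j" by presburger
  qed
  moreover have "(1 - s) / 2 \<notin> \<int>\<^sub>\<le>\<^sub>0"
    using s by (auto elim!: nonpos_Ints_cases simp: complex_eq_iff)
  ultimately have "zt s \<noteq> 0"
    using zt_functional_equation[OF s] by (auto simp: rGamma_eq_zero_iff Gamma_eq_zero_iff powr_eq_0_iff)
  thus ?thesis by (simp add: s_def)
qed

section \<open>The double series as a Mellin transform\<close>

lemma integral_count_space_prod:
  fixes f g :: "nat \<Rightarrow> 'c :: {real_normed_field, banach, second_countable_topology}"
  assumes f: "integrable (count_space UNIV) f" and g: "integrable (count_space UNIV) g"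
  shows "integrable (count_space UNIV) (\<lambda>(n, m). f n * g m)" (is ?A)
    and "(\<integral>(n, m). f n * g m \<partial>count_space UNIV) = (\<integral>n. f n \<partial>count_space UNIV) * (\<integral>m. g m \<partial>count_space UNIV)" (is ?B)
proof -
  interpret C: sigma_finite_measure "count_space (UNIV :: nat set)"
    by (intro sigma_finite_measure_count_space)
  interpret P: pair_sigma_finite "count_space (UNIV :: nat set)" "count_space (UNIV :: nat set)" ..
  have eq: "count_space (UNIV :: nat set) \<Otimes>\<^sub>M count_space (UNIV :: nat set) = count_space UNIV"
    by (subst pair_measure_countable) auto
  have I: "integrable (count_space (UNIV :: nat set) \<Otimes>\<^sub>M count_space (UNIV :: nat set)) (\<lambda>(n, m). f n * g m)"
  proof (rule P.Fubini_integrable)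
    show "(\<lambda>(n, m). f n * g m) \<in> borel_measurable (count_space UNIV \<Otimes>\<^sub>M count_space UNIV)"
      unfolding eq by simp
    show "integrable (count_space UNIV) (\<lambda>x. \<integral>y. norm (case (x, y) of (n, m) \<Rightarrow> f n * g m) \<partial>count_space UNIV)"
      using f g by (simp add: norm_mult)
    show "AE x in count_space UNIV. integrable (count_space UNIV) (\<lambda>y. case (x, y) of (n, m) \<Rightarrow> f n * g m)"
      using g by simp
  qed
  thus ?A unfolding eq .
  have "(\<integral>(n, m). f n * g m \<partial>count_space UNIV) = (\<integral>n. \<integral>m. f n * g m \<partial>count_space UNIV \<partial>count_space UNIV)"
    unfolding eq [symmetric] by (rule P.integral_fst[OF I, symmetric])
  thus ?B
    by simp
qed

definition lin_form :: "real \<Rightarrow> nat \<times> nat \<Rightarrow> real" where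
  "lin_form x = (\<lambda>(n, m). real (Suc n) + real (Suc m) * x)"

definition theta_term :: "real \<Rightarrow> complex \<Rightarrow> nat \<times> nat \<Rightarrow> complex" where
  "theta_term x s p = of_nat (Suc (fst p)) powr (-s) * of_nat (Suc (snd p)) powr (-s) * of_real (lin_form x p) powr (-s)"

lemma lin_form_pos: "x > 0 \<Longrightarrow> lin_form x p > 0"
  by (auto simp: lin_form_def add_pos_pos split: prod.splits)

text \<open>The exponent 3/2 \<sigma> is \<sigma> from each single factor plus \<sigma>/2 from the
  geometric mean; it exceeds 1 exactly when \<sigma> > 2/3.\<close>

definition theta_majorant :: "real \<Rightarrow> real \<Rightarrow> nat \<times> nat \<Rightarrow> real" where
  "theta_majorant x \<sigma> = (\<lambda>(n, m). (2 * sqrt x) powr (-\<sigma>) * (real (Suc n) powr (-(3/2 * \<sigma>)) * real (Suc m) powr (-(3/2 * \<sigma>))))"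

lemma integrable_theta_majorant:
  assumes "\<sigma> > 2/3"
  shows "integrable (count_space UNIV) (theta_majorant x \<sigma>)"
proof -
  have "integrable (count_space UNIV) (\<lambda>n. real (Suc n) powr (-(3/2 * \<sigma>)))"
    using assms by (intro integrable_real_powr_Suc) auto
  from integral_count_space_prod(1)[OF this this]
  have "integrable (count_space UNIV) (\<lambda>p. (2 * sqrt x) powr (-\<sigma>) *
          (case p of (n, m) \<Rightarrow> real (Suc n) powr (-(3/2 * \<sigma>)) * real (Suc m) powr (-(3/2 * \<sigma>))))"
    by (rule integrable_mult_right)
  thus ?thesis by (simp add: theta_majorant_def case_prod_unfold del: of_nat_Suc)
qed

text \<open>By the arithmetic-geometric mean inequality \<open>n + m x \<ge> 2 \<surd>(n m x)\<close>, the double series is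
  dominated by a product of two single series.\<close>
lemma theta_majorant_ge:
  assumes x: "x > 0" and \<sigma>: "\<sigma> \<ge> 0"
  shows "real (Suc n) powr (-\<sigma>) * real (Suc m) powr (-\<sigma>) * lin_form x (n, m) powr (-\<sigma>) \<le> theta_majorant x \<sigma> (n, m)"
proof -
  define N M where "N = real (Suc n)" and "M = real (Suc m)"
  have NM: "N > 0" "M > 0" by (auto simp: N_def M_def)
  have "0 \<le> (sqrt N - sqrt (M * x)) ^ 2" by simp
  also have "\<dots> = N + M * x - 2 * (sqrt N * sqrt (M * x))"
    using NM x by (simp add: power2_diff)
  finally have "2 * sqrt x * (sqrt N * sqrt M) \<le> N + M * x"
    by (simp add: real_sqrt_mult mult_ac)
  hence "(N + M * x) powr (-\<sigma>) \<le> (2 * sqrt x * (sqrt N * sqrt M)) powr (-\<sigma>)"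
    using NM x \<sigma> by (intro powr_mono2') auto
  also have "\<dots> = (2 * sqrt x) powr (-\<sigma>) * (N powr (-\<sigma>/2) * M powr (-\<sigma>/2))"
    using NM x by (simp add: powr_mult powr_half_sqrt [symmetric] powr_powr)
  finally have "N powr (-\<sigma>) * M powr (-\<sigma>) * (N + M * x) powr (-\<sigma>) \<le>
      N powr (-\<sigma>) * M powr (-\<sigma>) * ((2 * sqrt x) powr (-\<sigma>) * (N powr (-\<sigma>/2) * M powr (-\<sigma>/2)))"
    by (rule mult_left_mono) simp
  also have "\<dots> = (2 * sqrt x) powr (-\<sigma>) * ((N powr (-\<sigma>) * N powr (-\<sigma>/2)) * (M powr (-\<sigma>) * M powr (-\<sigma>/2)))"
    by (simp add: mult_ac)
  also have "\<dots> = theta_majorant x \<sigma> (n, m)"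
    unfolding powr_add [symmetric] by (simp add: theta_majorant_def N_def M_def)
  finally show ?thesis by (simp add: N_def M_def lin_form_def)
qed

lemma norm_theta_term:
  assumes x: "x > 0"
  shows "norm (theta_term x s p) = real (Suc (fst p)) powr (- Re s) * real (Suc (snd p)) powr (- Re s) * lin_form x p powr (- Re s)"
  unfolding theta_term_def norm_mult norm_of_nat_Suc_powr
  using lin_form_pos[OF x, of p] by (simp add: norm_powr_real_powr del: of_nat_Suc)

lemma norm_theta_term_le:
  assumes x: "x > 0" and s: "\<sigma> \<le> Re s" "\<sigma> \<ge> 0" and p: "lin_form x p \<ge> 1"
  shows "norm (theta_term x s p) \<le> theta_majorant x \<sigma> p"
proof -
  obtain n m where p_eq: "p = (n, m)" by (cases p)
  have "norm (theta_term x s p) = real (Suc n) powr (- Re s) * real (Suc m) powr (- Re s) * lin_form x (n, m) powr (- Re s)"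
    using norm_theta_term[OF x, of s p] by (simp add: p_eq del: of_nat_Suc)
  also have "\<dots> \<le> real (Suc n) powr (- \<sigma>) * real (Suc m) powr (- \<sigma>) * lin_form x (n, m) powr (- \<sigma>)"
    using s p by (intro mult_mono powr_mono) (auto simp: p_eq)
  also have "\<dots> \<le> theta_majorant x \<sigma> p"
    unfolding p_eq by (rule theta_majorant_ge) (use x s in auto)
  finally show ?thesis .
qed

lemma lin_form_ge_1: "x > 0 \<Longrightarrow> lin_form x p \<ge> 1"
  by (auto simp: lin_form_def split: prod.splits intro!: add_increasing2)

lemma open_Re_gt: "open {s. Re s > a}"
  by (intro open_Collect_less continuous_intros)

lemma
  assumes x: "x > 0"
  shows theta_term_integral_holomorphic: "(\<lambda>s. \<integral>p. theta_term x s p \<partial>count_space UNIV) holomorphic_on {s. Re s > 2/3}" (is ?A)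
    and integrable_theta_term: "Re s > 2/3 \<Longrightarrow> integrable (count_space UNIV) (theta_term x s)" (is "PROP ?B")
proof -
  have dom: "\<exists>B. integrable (count_space UNIV) B \<and> (\<forall>s\<in>complex_box a b T. \<forall>p\<in>space (count_space UNIV). norm (theta_term x s p) \<le> B p)"
    if "ereal (2/3) < ereal a" for a b T
    using that x
    by (intro exI[of _ "theta_majorant x a"] conjI ballI integrable_theta_majorant norm_theta_term_le lin_form_ge_1)
       (auto simp: complex_box_def)
  have hol: "(\<lambda>s. theta_term x s p) holomorphic_on {s. Re s > 2/3}" for p
    unfolding theta_term_def using lin_form_pos[OF x, of p]
    by (intro holomorphic_intros) (auto simp del: of_nat_Suc)
  have S: "{s. Re s > 2/3} = {s. ereal (2/3) < ereal (Re s) \<and> ereal (Re s) < \<infinity>}" by simp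
  note * = holomorphic_on_integral_strip[OF S hol _ dom] integrable_strip[OF S hol _ dom]
  show ?A
    using *(1) by simp
  show "PROP ?B"
    using *(2)[of s] by simp
qed

lemma Theta_series_eq_integral:
  assumes "x > 0" "Re s > 2/3"
  shows "Theta_series s s s x = (\<integral>p. theta_term x s p \<partial>count_space UNIV)"
proof -
  have "Theta_series s s s x = infsum (\<lambda>(n, m). 1 / (of_nat n powr s * of_nat m powr s * of_real (real n + real m * x) powr s))
          (map_prod Suc Suc ` UNIV)"
    unfolding Theta_series_def
    by (intro arg_cong[of _ _ "infsum _"])
       (auto simp: image_iff Suc_le_eq gr0_conv_Suc map_prod_def split: prod.splits)
  also have "\<dots> = infsum (theta_term x s) UNIV"
    by (subst infsum_reindex)
       (auto simp: inj_def o_def theta_term_def lin_form_def powr_minus divide_inverse case_prod_unfold mult_ac intro!: infsum_cong)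
  also have "\<dots> = (\<integral>p. theta_term x s p \<partial>count_space UNIV)"
    by (rule infsum_eq_integral_count_space[OF integrable_theta_term[OF assms]])
  finally show ?thesis .
qed

lemma Theta_series_holomorphic:
  assumes x: "x > 0"
  shows "(\<lambda>s. Theta_series s s s x) holomorphic_on {s. Re s > 2/3}"
  by (rule holomorphic_transform[OF theta_term_integral_holomorphic[OF x]])
     (use x Theta_series_eq_integral in auto)

abbreviation theta_kernel :: "real \<Rightarrow> complex \<Rightarrow> real \<Rightarrow> complex" where
  "theta_kernel x s v \<equiv> of_real v powr (s - 1) * (dexp s (of_real v) * dexp s (of_real (x * v)))"

text \<open>The exponential turns the linear form n + m x into a product, so the Laplace sum over
  pairs factors into two values of \<open>dexp\<close>.\<close>

lemma Mellin_Theta: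
  assumes x: "x > 0" and s: "Re s > 2/3"
  shows "integrable half_lborel (\<lambda>v. theta_kernel x s v)" (is ?A)
    and "(\<integral>v. theta_kernel x s v \<partial>half_lborel) =
           Gamma s * Theta_series s s s x" (is ?B)
proof -
  have sf: "sigma_finite_measure (count_space (UNIV :: (nat \<times> nat) set))"
    by (intro sigma_finite_measure_count_space)
  have s0: "Re s > 0" using s by simp
  define c where "c p = (of_nat (Suc (fst p)) powr (-s) * of_nat (Suc (snd p)) powr (-s) :: complex)" for p :: "nat \<times> nat"
  note M = Mellin_laplace[where M = "count_space (UNIV :: (nat \<times> nat) set)" and c = c and \<tau> = "lin_form x", OF sf s0]
  have outer: "(\<integral>p. c p * of_real (lin_form x p) powr (-s) \<partial>count_space UNIV) = Theta_series s s s x"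
    unfolding Theta_series_eq_integral[OF x s]
    by (intro Bochner_Integration.integral_cong refl) (simp add: theta_term_def c_def)
  have "norm (theta_term x s p) = norm (c p) * lin_form x p powr (- Re s)" for p
    unfolding norm_theta_term[OF x] c_def norm_mult norm_of_nat_Suc_powr by simp
  hence int: "integrable (count_space UNIV) (\<lambda>p. norm (c p) * lin_form x p powr (- Re s))"
    using integrable_norm[OF integrable_theta_term[OF x s]] by simp
  have inner: "(\<integral>p. c p * of_real (exp (-(v * lin_form x p))) \<partial>count_space UNIV) = dexp s (of_real v) * dexp s (of_real (x * v))"
    if v: "v > 0" for v
  proof -
    have xv: "x * v > 0" using x v by simp
    have "(\<integral>p. c p * of_real (exp (-(v * lin_form x p))) \<partial>count_space UNIV) =
      (\<integral>(n, m). (of_nat (Suc n) powr (-s) * exp (-(of_nat (Suc n) * of_real v))) *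
                 (of_nat (Suc m) powr (-s) * exp (-(of_nat (Suc m) * of_real (x * v)))) \<partial>count_space UNIV)"
    proof (intro Bochner_Integration.integral_cong refl)
      fix p :: "nat \<times> nat"
      obtain n m where p: "p = (n, m)" by (cases p)
      have "exp (-(v * lin_form x p)) = exp (-(real (Suc n) * v)) * exp (-(real (Suc m) * (x * v)))"
        by (simp add: p lin_form_def exp_add [symmetric] algebra_simps)
      hence "complex_of_real (exp (-(v * lin_form x p))) = exp (-(of_nat (Suc n) * of_real v)) * exp (-(of_nat (Suc m) * of_real (x * v)))"
        by (simp add: exp_of_real [symmetric] del: of_nat_Suc)
      thus "c p * of_real (exp (-(v * lin_form x p))) = (case p of (n, m) \<Rightarrow> (of_nat (Suc n) powr (-s) * exp (-(of_nat (Suc n) * of_real v))) *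
                 (of_nat (Suc m) powr (-s) * exp (-(of_nat (Suc m) * of_real (x * v)))))"
        by (simp add: c_def p mult_ac del: of_nat_Suc)
    qed
    also have "\<dots> = dexp s (of_real v) * dexp s (of_real (x * v))"
      unfolding dexp_def
      by (rule integral_count_space_prod(2); rule integrable_dexp) (use v xv in simp_all)
    finally show ?thesis .
  qed
  have M1: "integrable half_lborel (\<lambda>v. of_real v powr (s - 1) * (\<integral>p. c p * of_real (exp (-(v * lin_form x p))) \<partial>count_space UNIV))"
   and M2: "(\<integral>v. of_real v powr (s - 1) * (\<integral>p. c p * of_real (exp (-(v * lin_form x p))) \<partial>count_space UNIV) \<partial>half_lborel) =
           Gamma s * Theta_series s s s x"
    using M[OF _ _ _ int] lin_form_pos[OF x] unfolding outer by simp_all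
  show ?A
    using M1 by (rule integrable_lborel_on_cong[THEN iffD1, rotated]) (use inner in simp_all)
  show ?B
    unfolding M2[symmetric] using inner
    by (intro Bochner_Integration.integral_cong refl) (simp_all add: space_restrict_space)
qed

definition theta_tail :: "real \<Rightarrow> complex \<Rightarrow> complex" where
  "theta_tail x s = (\<integral>v. theta_kernel x s v \<partial>tail_lborel)"

lemma continuous_on_dexp_of_real_mult:
  assumes "x > 0"
  shows "continuous_on {0<..} (\<lambda>u. dexp s (complex_of_real (x * u)))"
  by (rule continuous_on_compose2[OF continuous_on_dexp_of_real[of s], of "{0<..}" "\<lambda>u. x * u"])
     (use assms in \<open>auto intro!: continuous_intros\<close>)

text \<open>The first \<open>dexp\<close> factor supplies the exponential decay; for the second,
  boundedness on v > 1 suffices.\<close>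

lemma theta_tail_holomorphic:
  assumes x: "x > 0"
  shows "theta_tail x holomorphic_on A"
proof -
  define f where "f s v = (theta_kernel x s v :: complex)" for s and v :: real
  have 1: "(\<lambda>s. f s v) holomorphic_on UNIV" if "v > 1" for v
    unfolding f_def using that x by (intro holomorphic_intros holomorphic_dexp) auto
  have 2: "continuous_on {1<..} (f s)" for s
    unfolding f_def
    by (intro continuous_intros continuous_on_subset[OF continuous_on_dexp_of_real]
          continuous_on_subset[OF continuous_on_dexp_of_real_mult[OF x]]) auto
  have 3: "\<exists>C B. \<forall>s v. a \<le> Re s \<longrightarrow> Re s \<le> b \<longrightarrow> v > 1 \<longrightarrow> norm (f s v) \<le> C * (v powr B * exp (-(v / 2)))" for a b
  proof -
    define S1 where "S1 = (\<Sum>n. dexp_majorant (-a) (1/2) n)"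
    define S2 where "S2 = (\<Sum>n. dexp_majorant (-a) x n)"
    have S: "S1 \<ge> 0" "S2 \<ge> 0" unfolding S1_def S2_def using x by (auto intro: suminf_dexp_nonneg)
    show ?thesis
    proof (rule exI[of _ "S1 * S2"], rule exI[of _ "b - 1"], intro allI impI)
      fix s and v :: real assume *: "a \<le> Re s" "Re s \<le> b" "v > 1"
      have n1: "norm (dexp s (of_real v)) \<le> exp (-(v / 2)) * S1"
        unfolding S1_def using * by (intro norm_dexp_le_exp) auto
      have n2: "norm (dexp s (of_real (x * v))) \<le> S2"
        unfolding S2_def using * x by (intro norm_dexp_le) auto
      have n3: "norm (complex_of_real v powr (s - 1)) \<le> v powr (b - 1)"
        using * by (simp add: norm_powr_real_powr)
      have "norm (f s v) \<le> v powr (b - 1) * ((exp (-(v / 2)) * S1) * S2)"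
        unfolding f_def norm_mult using n1 n2 n3 S by (intro mult_mono) auto
      thus "norm (f s v) \<le> S1 * S2 * (v powr (b - 1) * exp (-(v / 2)))" by (simp add: mult_ac)
    qed
  qed
  have "(\<lambda>s. theta_tail x s) holomorphic_on UNIV"
    using holomorphic_integral_exp_decay(1)[of f, OF 1 2 3] by (simp add: theta_tail_def f_def)
  thus ?thesis by (rule holomorphic_on_subset) auto
qed

section \<open>The part of the Mellin transform near the origin\<close>

text \<open>What is left of \<open>L(s,u) L(s,xu)\<close> after removing the product of the two truncated expansions.\<close>
definition theta_rem :: "real \<Rightarrow> nat \<Rightarrow> complex \<Rightarrow> real \<Rightarrow> complex" where
  "theta_rem x K s u = of_real u powr (s - 1) *
     (drem K s u * dexp s (of_real (x * u)) + (dexp s (of_real u) - drem K s u) * drem K s (x * u))"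

definition theta_head :: "real \<Rightarrow> nat \<Rightarrow> complex \<Rightarrow> complex" where
  "theta_head x K s = (\<integral>u. theta_rem x K s u \<partial>unit_lborel)"

text \<open>The singular term has this order, and the bounded part \<open>dreg\<close> is absorbed
  because u^(a-1) >= 1 on (0,1].\<close>

lemma dexp_bound_near_0:
  assumes b: "b < 1" and x: "x > 0"
  obtains D where "D \<ge> 0" "\<And>s u. s \<in> complex_box a b T \<Longrightarrow> u \<in> {0<..1} \<Longrightarrow> norm (dexp s (of_real (x * u))) \<le> D * u powr (a - 1)"
proof -
  obtain C where C: "C \<ge> 0" "\<And>s u. s \<in> complex_box a b T \<Longrightarrow> u > 0 \<Longrightarrow> norm (dreg s u) \<le> C"
    using dreg_bound[OF b] by metis
  have "1 - s \<notin> \<int>\<^sub>\<le>\<^sub>0" if "s \<in> complex_box a b T" for s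
    using that b by (auto elim!: nonpos_Ints_cases simp: complex_eq_iff complex_box_def)
  then obtain E where E: "E \<ge> 0" "\<And>s. s \<in> complex_box a b T \<Longrightarrow> norm (Gamma (1 - s) * of_real x powr (s - 1)) \<le> E"
    using x by (elim bounded_on_complex_box[of a b T "\<lambda>s. Gamma (1 - s) * of_real x powr (s - 1)", rotated])
       (auto intro!: holomorphic_on_imp_continuous_on holomorphic_intros)
  show ?thesis
  proof (rule that[of "C + E"])
    fix s and u :: real assume s: "s \<in> complex_box a b T" and u: "u \<in> {0<..1}"
    have a: "a - 1 \<le> Re s - 1" "a - 1 \<le> 0" using s b by (auto simp: complex_box_def)
    have xu: "x * u > 0" using x u by simp
    have "dexp s (of_real (x * u)) = dreg s (x * u) + Gamma (1 - s) * of_real (x * u) powr (s - 1)"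
      by (simp add: dreg_def)
    also have "complex_of_real (x * u) powr (s - 1) = of_real x powr (s - 1) * of_real u powr (s - 1)"
      by (subst of_real_mult, rule powr_times_real) (use x u in auto)
    finally have "norm (dexp s (of_real (x * u))) \<le> norm (dreg s (x * u)) + norm ((Gamma (1 - s) * of_real x powr (s - 1)) * of_real u powr (s - 1))"
      by (simp add: norm_triangle_ineq mult.assoc)
    also have "\<dots> \<le> C * u powr (a - 1) + E * u powr (a - 1)"
    proof (rule add_mono)
      have "1 \<le> u powr (a - 1)" using u a powr_mono'[of "a - 1" 0 u] by simp
      hence "C * 1 \<le> C * u powr (a - 1)" using C(1) by (rule mult_left_mono)
      thus "norm (dreg s (x * u)) \<le> C * u powr (a - 1)"
        using C(2)[OF s xu] by simp
      have "norm (complex_of_real u powr (s - 1)) \<le> u powr (a - 1)"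
        using u a by (simp add: norm_powr_real_powr powr_mono')
      thus "norm ((Gamma (1 - s) * of_real x powr (s - 1)) * of_real u powr (s - 1)) \<le> E * u powr (a - 1)"
        unfolding norm_mult[of _ "of_real u powr (s - 1)"] using E s by (intro mult_mono) auto
    qed
    finally show "norm (dexp s (of_real (x * u))) \<le> (C + E) * u powr (a - 1)"
      by (simp add: ring_distribs)
  qed (use C E in auto)
qed

text \<open>Each product in \<open>theta_rem\<close> contains one remainder of order u^K and one
  factor of order u^(a-1); the prefactor contributes another u^(a-1).\<close>

lemma theta_rem_bound:
  assumes b: "b < 1" and x: "x > 0"
  obtains D where "D \<ge> 0" "\<And>s u. s \<in> complex_box a b T \<Longrightarrow> u \<in> {0<..1} \<Longrightarrow> norm (theta_rem x K s u) \<le> D * u powr (real K + 2 * a - 2)"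
proof -
  obtain C where C: "C \<ge> 0" "\<And>s u. s \<in> complex_box a b T \<Longrightarrow> u > 0 \<Longrightarrow> norm (drem K s u) \<le> C * u ^ K"
    using drem_bound[OF b] by metis
  obtain D where D: "D \<ge> 0" "\<And>s u. s \<in> complex_box a b T \<Longrightarrow> u \<in> {0<..1} \<Longrightarrow> norm (dexp s (of_real (x * u))) \<le> D * u powr (a - 1)"
    using dexp_bound_near_0[OF b x] by metis
  obtain D' where D': "D' \<ge> 0" "\<And>s u. s \<in> complex_box a b T \<Longrightarrow> u \<in> {0<..1} \<Longrightarrow> norm (dexp s (of_real u)) \<le> D' * u powr (a - 1)"
    using dexp_bound_near_0[OF b, of 1 a T] by (metis mult_1 zero_less_one)
  show ?thesis
  proof (rule that[of "C * D + (D' + C) * (C * x ^ K)"])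
    fix s and u :: real assume s: "s \<in> complex_box a b T" and u: "u \<in> {0<..1}"
    define w where "w = u powr (a - 1)"
    have a: "a - 1 \<le> Re s - 1" "a - 1 \<le> 0" using s b by (auto simp: complex_box_def)
    have w: "w \<ge> 0" "1 \<le> w" using u a powr_mono'[of "a - 1" 0 u] by (simp_all add: w_def)
    have uK: "0 \<le> u ^ K" "u ^ K \<le> 1" using u by (auto intro: power_le_one)
    have n1: "norm (complex_of_real u powr (s - 1)) \<le> w"
      using u a by (simp add: norm_powr_real_powr powr_mono' w_def)
    have r1: "norm (drem K s u) \<le> C * u ^ K" using C(2)[OF s] u by simp
    have r2: "norm (drem K s (x * u)) \<le> (C * x ^ K) * u ^ K"
      using C(2)[OF s, of "x * u"] x u by (simp add: power_mult_distrib mult_ac)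
    have "norm (drem K s u) \<le> C * w"
      using r1 mult_left_mono[OF order.trans[OF uK(2) w(2)] C(1)] by linarith
    hence e: "norm (dexp s (of_real u) - drem K s u) \<le> (D' + C) * w"
      using norm_triangle_ineq4[of "dexp s (of_real u)" "drem K s u"] D'(2)[OF s u]
      by (simp add: ring_distribs w_def)
    have "norm (drem K s u * dexp s (of_real (x * u)) + (dexp s (of_real u) - drem K s u) * drem K s (x * u)) \<le>
      norm (drem K s u) * norm (dexp s (of_real (x * u))) + norm (dexp s (of_real u) - drem K s u) * norm (drem K s (x * u))"
      by (rule order.trans[OF norm_triangle_ineq]) (simp add: norm_mult)
    also have "\<dots> \<le> (C * u ^ K) * (D * w) + ((D' + C) * w) * ((C * x ^ K) * u ^ K)"
      using r1 r2 e D(2)[OF s u] C(1) D(1) D'(1) w uK x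
      by (intro add_mono mult_mono) (auto simp: w_def)
    finally have n2: "norm (drem K s u * dexp s (of_real (x * u)) + (dexp s (of_real u) - drem K s u) * drem K s (x * u)) \<le>
       (C * D + (D' + C) * (C * x ^ K)) * (w * u ^ K)" by (simp add: algebra_simps)
    have "norm (theta_rem x K s u) \<le> w * ((C * D + (D' + C) * (C * x ^ K)) * (w * u ^ K))"
      unfolding theta_rem_def norm_mult[of "of_real u powr (s - 1)"]
      by (intro mult_mono n1 n2) (use w in auto)
    also have "\<dots> = (C * D + (D' + C) * (C * x ^ K)) * (w * w * u ^ K)" by (simp add: mult_ac)
    also have "w * w * u ^ K = u powr (real K + 2 * a - 2)"
    proof -
      have "u ^ K = u powr real K" using u by (simp add: powr_realpow)
      thus ?thesis unfolding w_def by (simp add: powr_add [symmetric] algebra_simps)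
    qed
    finally show "norm (theta_rem x K s u) \<le> (C * D + (D' + C) * (C * x ^ K)) * u powr (real K + 2 * a - 2)" .
  qed (use C D D' x in auto)
qed

text \<open>At the left edge the exponent K + 2a - 2 of \<open>theta_rem_bound\<close> reaches -1;
  the right edge keeps Gamma(1-s) and the coefficients holomorphic.\<close>

definition theta_strip :: "nat \<Rightarrow> complex set" where
  "theta_strip K = {s. (1 - real K) / 2 < Re s \<and> Re s < 1}"

lemma open_theta_strip: "open (theta_strip K)"
  unfolding theta_strip_def by (intro open_Collect_less open_Collect_conj continuous_intros)

lemma measurable_theta_rem:
  assumes x: "x > 0"
  shows "theta_rem x K s \<in> borel_measurable unit_lborel"
proof (intro measurable_lborel_on)
  have 1: "continuous_on {0<..1} (\<lambda>u. drem K s (x * u))"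
    by (rule continuous_on_compose2[OF continuous_on_drem[of K s], of "{0<..1}" "\<lambda>u. x * u"])
       (use x in \<open>auto intro!: continuous_intros\<close>)
  show "continuous_on {0<..1} (theta_rem x K s)"
    unfolding theta_rem_def[abs_def]
    by (intro continuous_intros 1 continuous_on_subset[OF continuous_on_dexp_of_real]
          continuous_on_subset[OF continuous_on_dexp_of_real_mult[OF x]] continuous_on_subset[OF continuous_on_drem]) auto
qed

lemma theta_head:
  assumes x: "x > 0"
  shows theta_head_holomorphic: "theta_head x K holomorphic_on theta_strip K" (is ?A)
    and integrable_theta_rem: "s \<in> theta_strip K \<Longrightarrow> integrable unit_lborel (theta_rem x K s)" (is "PROP ?B")
proof -
  have dom: "\<exists>B. integrable unit_lborel B \<and> (\<forall>s\<in>complex_box a b T. \<forall>u\<in>space (unit_lborel). norm (theta_rem x K s u) \<le> B u)"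
    if a: "ereal ((1 - real K) / 2) < ereal a" and b: "ereal b < ereal 1" for a b T
  proof -
    have b: "b < 1" using b by simp
    obtain D where "\<And>s u. s \<in> complex_box a b T \<Longrightarrow> u \<in> {0<..1} \<Longrightarrow>
        norm (theta_rem x K s u) \<le> D * u powr (real K + 2 * a - 2)"
      using theta_rem_bound[OF b x] by metis
    thus ?thesis using a
      by (intro exI[of _ "\<lambda>u. D * u powr (real K + 2 * a - 2)"])
         (auto intro!: integrable_mult_right integrable_real_powr_0_1 simp: space_restrict_space field_simps)
  qed
  have hol: "(\<lambda>s. theta_rem x K s u) holomorphic_on theta_strip K" if "u \<in> space unit_lborel" for u
    unfolding theta_rem_def using that x
    by (intro holomorphic_intros holomorphic_dexp holomorphic_on_subset[OF drem_holomorphic])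
       (auto simp: theta_strip_def space_restrict_space)
  have S: "theta_strip K = {s. ereal ((1 - real K) / 2) < ereal (Re s) \<and> ereal (Re s) < ereal 1}"
    by (simp add: theta_strip_def)
  note * = holomorphic_on_integral_strip[OF S hol measurable_theta_rem[OF x] dom]
           integrable_strip[OF S hol measurable_theta_rem[OF x] dom]
  show ?A
    using *(1) by (simp add: theta_head_def[abs_def])
  show "PROP ?B"
    by (rule *(2))
qed

section \<open>The continuation of \<open>\<Theta>(s,s,s,x)\<close> strip by strip\<close>

text \<open>This is \<open>rGamma s / (s + i)\<close> in a form that is regular at s = -i, where
  1/Gamma has a zero.\<close>

definition rGamma_quot :: "nat \<Rightarrow> complex \<Rightarrow> complex" where
  "rGamma_quot i s = pochhammer s i * rGamma (s + of_nat (Suc i))"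

lemma rGamma_quot: "rGamma s = (s + of_nat i) * rGamma_quot i s"
  unfolding rGamma_quot_def using pochhammer_rGamma[of s "Suc i"] by (simp add: pochhammer_Suc mult_ac)

lemma analytic_rGamma_quot: "rGamma_quot i analytic_on A"
proof -
  have "rGamma_quot i holomorphic_on UNIV"
    unfolding rGamma_quot_def pochhammer_prod by (intro holomorphic_intros)
  thus ?thesis using analytic_on_open[of UNIV] analytic_on_subset by blast
qed

text \<open>For odd \<open>k\<close> the zero of \<open>1/\<Gamma>(s)\<close> at \<open>(1-k)/2\<close> cancels the denominator \<open>2s - 1 + k\<close>.\<close>
definition theta_coeff :: "nat \<Rightarrow> complex \<Rightarrow> complex" where
  "theta_coeff k s = (if odd k then rGamma_quot (k div 2) s / 2 else rGamma s / (2 * s - 1 + of_nat k))"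

lemma theta_coeff:
  assumes "2 * s - 1 + of_nat k \<noteq> 0"
  shows "rGamma s * (1 / (2 * s - 1 + of_nat k)) = theta_coeff k s"
proof (cases "odd k")
  case True
  then obtain i where k: "k = 2 * i + 1" by (elim oddE)
  have eq: "2 * s - 1 + of_nat k = 2 * (s + of_nat i)" by (simp add: k)
  have "s + of_nat i \<noteq> 0"
  proof
    assume "s + of_nat i = 0"
    thus False using assms eq by (simp only: mult_zero_right)
  qed
  hence "rGamma s * (1 / (2 * s - 1 + of_nat k)) = rGamma_quot i s / 2"
    unfolding eq rGamma_quot[of s i] by (simp del: distrib_left_numeral)
  thus ?thesis using True by (simp add: theta_coeff_def k)
qed (auto simp: theta_coeff_def)

text \<open>The cross terms run over a variable index set so that the one responsible for a given
  pole can be split off; the double sum is entire except for its zeta coefficients, which are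
  holomorphic for Re s < 1.\<close>

definition theta_part :: "real \<Rightarrow> nat \<Rightarrow> nat set \<Rightarrow> complex \<Rightarrow> complex" where
  "theta_part x K I s =
     rGamma s * (theta_tail x s + theta_head x K s) +
     (\<Sum>k\<in>I. Gamma (1 - s) * zcoeff k s * (of_real x ^ k + of_real x powr (s - 1)) * theta_coeff k s) +
     (\<Sum>k<K. \<Sum>l<K. zcoeff k s * zcoeff l s * of_real x ^ l * rGamma_quot (k + l) s)"

definition theta_main :: "real \<Rightarrow> nat \<Rightarrow> complex \<Rightarrow> complex" where
  "theta_main x K s = theta_part x K {..<K} s +
     rGamma s * Gamma (1 - s) ^ 2 * of_real x powr (s - 1) / (3 * s - 2)"

lemma has_bochner_integral_powr_0_1:
  assumes "Re a > 0"
  shows "has_bochner_integral unit_lborel (\<lambda>v. complex_of_real v powr (a - 1)) (1 / a)"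
  using powr_integral_0_1[of "a - 1"] assms by (simp add: has_bochner_integral_iff)

text \<open>For 2/3 < Re s < 1 every power in \<open>A\<close> has exponent above -1 and integrates
  to the reciprocal of its exponent plus 1. Since K is arbitrary, all functions
  \<open>theta_main x K\<close> agree here.\<close>

lemma Theta_series_eq_theta_main:
  assumes x: "x > 0" and s: "2/3 < Re s" "Re s < 1"
  shows "Theta_series s s s x = theta_main x K s"
proof -
  define G y where "G = Gamma (1 - s)" and "y = complex_of_real x powr (s - 1)"
  define z where "z k = zcoeff k s" for k
  define A where "A u = G ^ 2 * y * of_real u powr ((3 * s - 2) - 1) +
      (\<Sum>k<K. G * z k * (of_real x ^ k + y) * of_real u powr ((2 * s - 1 + of_nat k) - 1)) +
      (\<Sum>k<K. \<Sum>l<K. z k * z l * of_real x ^ l * of_real u powr ((s + of_nat (k + l)) - 1))" for u :: real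
  define J where "J = G ^ 2 * y * (1 / (3 * s - 2)) +
      (\<Sum>k<K. G * z k * (of_real x ^ k + y) * (1 / (2 * s - 1 + of_nat k))) +
      (\<Sum>k<K. \<Sum>l<K. z k * z l * of_real x ^ l * (1 / (s + of_nat (k + l))))"
  have A: "has_bochner_integral unit_lborel A J"
    unfolding A_def J_def using s
    by (intro has_bochner_integral_add has_bochner_integral_sum has_bochner_integral_mult_right
          has_bochner_integral_powr_0_1) auto
  \<comment> \<open>With values a, b of \<open>dexp\<close> and remainders r, r', this is a b - (r b
    + (a - r) r') = (a - r)(b - r'). The right side is multiplied out into the powers of u collected
    in \<open>A\<close>.\<close>
  have split: "of_real u powr (s - 1) * (dexp s (of_real u) * dexp s (of_real (x * u))) = theta_rem x K s u + A u"
    if u: "u \<in> {0<..1}" for u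
  proof -
    define w where "w = complex_of_real u powr (s - 1)"
    define U where "U = complex_of_real u"
    have U: "U \<noteq> 0" using u by (simp add: U_def)
    define P where "P = (\<Sum>k<K. z k * U ^ k)"
    define P' where "P' = (\<Sum>l<K. z l * of_real x ^ l * U ^ l)"
    have 1: "dexp s (of_real u) - drem K s u = G * w + P"
      by (simp add: drem_def dreg_def G_def w_def P_def z_def U_def)
    have "of_real (x * u) powr (s - 1) = y * w"
      unfolding y_def w_def by (subst of_real_mult, rule powr_times_real) (use x u in auto)
    hence 2: "dexp s (of_real (x * u)) - drem K s (x * u) = G * (y * w) + P'"
      by (simp add: drem_def dreg_def G_def P'_def z_def U_def power_mult_distrib mult.assoc)
    have p3: "of_real u powr ((3 * s - 2) - 1) = w * w * w"
      unfolding w_def powr_add [symmetric] by (simp add: algebra_simps)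
    have pU: "of_real u powr of_nat m = U ^ m" for m
      using U by (simp add: U_def powr_nat')
    have p2: "of_real u powr ((2 * s - 1 + of_nat k) - 1) = w * w * U ^ k" for k
      unfolding w_def pU [symmetric] powr_add [symmetric] by (simp add: algebra_simps)
    have p1: "of_real u powr ((s + of_nat (k + l)) - 1) = w * (U ^ k * U ^ l)" for k l
      unfolding w_def pU [symmetric] powr_add [symmetric] by (simp add: algebra_simps)
    have "w * ((G * w + P) * (G * (y * w) + P')) = G ^ 2 * y * (w * w * w) + (G * w * w * P' + G * y * w * w * P) + w * (P * P')"
      by (simp add: algebra_simps power2_eq_square)
    also have "G * w * w * P' + G * y * w * w * P = (\<Sum>k<K. G * z k * (of_real x ^ k + y) * (w * w * U ^ k))"
      unfolding P_def P'_def sum_distrib_left sum.distrib [symmetric]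
      by (intro sum.cong refl) (simp add: algebra_simps)
    also have "w * (P * P') = (\<Sum>k<K. \<Sum>l<K. z k * z l * of_real x ^ l * (w * (U ^ k * U ^ l)))"
      unfolding P_def P'_def sum_product unfolding sum_distrib_left
      by (intro sum.cong refl) (simp add: mult_ac)
    finally have "w * ((G * w + P) * (G * (y * w) + P')) = A u"
      unfolding A_def p1 p2 p3 .
    moreover have "of_real u powr (s - 1) * (dexp s (of_real u) * dexp s (of_real (x * u))) - theta_rem x K s u =
       w * ((dexp s (of_real u) - drem K s u) * (dexp s (of_real (x * u)) - drem K s (x * u)))"
      by (simp add: theta_rem_def w_def algebra_simps)
    ultimately show ?thesis unfolding 1 2 by (simp add: algebra_simps)
  qed
  have strip: "s \<in> theta_strip K" using s by (auto simp: theta_strip_def field_simps)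
  note M = Mellin_Theta[OF x s(1)]
  have "Gamma s * Theta_series s s s x =
     (\<integral>v. theta_kernel x s v \<partial>unit_lborel) + theta_tail x s"
    unfolding M(2)[symmetric] theta_tail_def
    by (rule integral_lborel_on_split) (use M(1) in \<open>auto simp: integrable_lborel_on_split_iff\<close>)
  also have "(\<integral>v. theta_kernel x s v \<partial>unit_lborel) =
      (\<integral>v. theta_rem x K s v + A v \<partial>unit_lborel)"
    by (intro integral_lborel_on_cong split) auto
  also have "\<dots> = theta_head x K s + J"
    using integrable_theta_rem[OF x strip] A
    by (subst Bochner_Integration.integral_add) (auto simp: has_bochner_integral_iff theta_head_def)
  finally have *: "Gamma s * Theta_series s s s x = theta_head x K s + J + theta_tail x s" .
  have "Theta_series s s s x = rGamma s * (Gamma s * Theta_series s s s x)"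
    using rGamma_Gamma_cancel[of s] s by simp
  also have "\<dots> = rGamma s * (theta_tail x s + theta_head x K s) + rGamma s * J"
    unfolding * by (simp add: algebra_simps)
  also have "rGamma s * J = rGamma s * G ^ 2 * y / (3 * s - 2) +
      (\<Sum>k<K. G * z k * (of_real x ^ k + y) * (rGamma s * (1 / (2 * s - 1 + of_nat k)))) +
      (\<Sum>k<K. \<Sum>l<K. z k * z l * of_real x ^ l * (rGamma s * (1 / (s + of_nat (k + l)))))"
    unfolding J_def ring_distribs sum_distrib_left by (simp add: mult_ac)
  also have "(\<Sum>k<K. G * z k * (of_real x ^ k + y) * (rGamma s * (1 / (2 * s - 1 + of_nat k)))) =
             (\<Sum>k<K. G * z k * (of_real x ^ k + y) * theta_coeff k s)"
    using s by (intro sum.cong refl arg_cong2[of _ _ _ _ "(*)"] theta_coeff) (auto simp: complex_eq_iff)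
  also have "(\<Sum>k<K. \<Sum>l<K. z k * z l * of_real x ^ l * (rGamma s * (1 / (s + of_nat (k + l))))) =
             (\<Sum>k<K. \<Sum>l<K. z k * z l * of_real x ^ l * rGamma_quot (k + l) s)"
  proof (intro sum.cong refl arg_cong2[of _ _ _ _ "(*)"])
    fix k l
    have "s + of_nat (k + l) \<noteq> 0" using s by (auto simp: complex_eq_iff)
    thus "rGamma s * (1 / (s + of_nat (k + l))) = rGamma_quot (k + l) s"
      by (simp add: rGamma_quot[of s "k + l"])
  qed
  finally show ?thesis
    by (simp add: theta_main_def theta_part_def G_def y_def z_def add_ac)
qed

section \<open>Regularity of the pieces and gluing of the strips\<close>

lemma open_Re_lt: "open {s. Re s < a}"
  by (intro open_Collect_less continuous_intros)

lemma theta_components_analytic: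
  assumes x: "x > 0"
  shows "rGamma analytic_on A" "theta_tail x analytic_on A" "theta_head x K analytic_on theta_strip K" (is ?C)
    "(\<lambda>s. Gamma (1 - s)) analytic_on theta_strip K" (is ?D) "zcoeff k analytic_on theta_strip K"
    "(\<lambda>s. of_real x powr (s - 1)) analytic_on A" (is ?F)
proof -
  have sub: "theta_strip K \<subseteq> {s. Re s < 1}" by (auto simp: theta_strip_def)
  have entire: "f analytic_on A" if "f holomorphic_on UNIV" for f A
    using that analytic_on_open[of UNIV] analytic_on_subset by blast
  show "rGamma analytic_on A" by (rule entire) (intro holomorphic_intros)
  show "theta_tail x analytic_on A" by (rule entire) (rule theta_tail_holomorphic[OF x])
  show ?C
    using theta_head_holomorphic[OF x] by (simp add: analytic_on_open open_theta_strip)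
  have "1 - s \<notin> \<int>\<^sub>\<le>\<^sub>0" if "s \<in> theta_strip K" for s
    using that by (auto elim!: nonpos_Ints_cases simp: complex_eq_iff theta_strip_def)
  thus ?D
    by (auto simp: analytic_on_open open_theta_strip intro!: holomorphic_intros)
  show "zcoeff k analytic_on theta_strip K"
    using holomorphic_on_subset[OF zcoeff_holomorphic sub] by (simp add: analytic_on_open open_theta_strip)
  show ?F
    by (rule entire) (use x in \<open>auto intro!: holomorphic_intros\<close>)
qed

lemma theta_coeff_analytic:
  assumes "even k \<longrightarrow> 2 * s - 1 + of_nat k \<noteq> 0"
  shows "theta_coeff k analytic_on {s}"
proof (cases "odd k")
  case True
  thus ?thesis unfolding theta_coeff_def[abs_def]
    by (auto intro!: analytic_intros analytic_rGamma_quot)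
next
  case False
  have "rGamma analytic_on {s}" by (rule theta_components_analytic(1)[of 1]) simp
  thus ?thesis using False assms unfolding theta_coeff_def[abs_def]
    by (auto intro!: analytic_intros)
qed

lemma theta_part_analytic:
  assumes x: "x > 0" and s: "s \<in> theta_strip K"
    and I: "\<And>k. k \<in> I \<Longrightarrow> even k \<Longrightarrow> 2 * s - 1 + of_nat k \<noteq> 0"
  shows "theta_part x K I analytic_on {s}"
proof -
  note comp = theta_components_analytic[OF x]
  have at_s: "f analytic_on {s}" if "f analytic_on theta_strip K" for f
    using that s analytic_on_subset[of f "theta_strip K" "{s}"] by blast
  show ?thesis
    unfolding theta_part_def[abs_def]
    by (intro analytic_intros comp(1,2,6) at_s[OF comp(3)] at_s[OF comp(4)] at_s[OF comp(5)]
          theta_coeff_analytic analytic_rGamma_quot) (use I in auto)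
qed

lemma theta_main_meromorphic:
  assumes x: "x > 0"
  shows "theta_main x K meromorphic_on theta_strip K"
proof -
  note comp = theta_components_analytic[OF x, THEN analytic_on_imp_meromorphic_on]
  have q: "rGamma_quot i meromorphic_on theta_strip K" for i
    by (intro analytic_on_imp_meromorphic_on analytic_rGamma_quot)
  have c: "theta_coeff k meromorphic_on theta_strip K" for k
    unfolding theta_coeff_def[abs_def] by (cases "odd k") (auto intro!: meromorphic_intros q comp)
  show ?thesis
    unfolding theta_main_def[abs_def] theta_part_def
    by (intro meromorphic_intros comp q c)
qed

text \<open>Only a punctured neighbourhood is claimed because values at poles are arbitrary;
  \<open>remove_sings\<close> turns this into equality at the point.\<close>

lemma meromorphic_identity:
  assumes f: "f meromorphic_on S" and g: "g meromorphic_on S" and S: "open S" "connected S"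
    and A: "open A" "A \<noteq> {}" "A \<subseteq> S" and eq: "\<And>z. z \<in> A \<Longrightarrow> f z = g z" and z: "z \<in> S"
  shows "eventually (\<lambda>w. f w = g w) (at z)"
proof -
  have "(\<lambda>s. f s - g s) meromorphic_on S" using f g by (intro meromorphic_intros)
  hence "eventually (\<lambda>s. f s - g s = 0) (cosparse S) \<or> eventually (\<lambda>s. f s - g s \<noteq> 0) (cosparse S)"
    using S by (rule meromorphic_imp_constant_or_avoid)
  moreover have "\<not> eventually (\<lambda>s. f s - g s \<noteq> 0) (cosparse S)"
  proof
    assume ev: "eventually (\<lambda>s. f s - g s \<noteq> 0) (cosparse S)"
    obtain a where a: "a \<in> A" using A by auto
    have "eventually (\<lambda>s. f s - g s \<noteq> 0) (at a)"
      using ev a A S by (auto simp: eventually_cosparse_open_eq)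
    moreover have "eventually (\<lambda>s. s \<in> A) (at a)"
      using A a by (simp add: eventually_at_in_open')
    ultimately have "eventually (\<lambda>s. False) (at a)"
      by eventually_elim (use eq in auto)
    thus False by simp
  qed
  ultimately have "eventually (\<lambda>s. f s - g s = 0) (cosparse S)" by blast
  thus ?thesis using z S by (auto simp: eventually_cosparse_open_eq)
qed

text \<open>The chosen K exceeds 1 - 2 Re s, which puts s into its strip. That it varies with s is
  harmless by \<open>theta_ext_eq_remove_sings\<close>.\<close>

definition theta_ext :: "real \<Rightarrow> complex \<Rightarrow> complex" where
  "theta_ext x s = (if Re s > 2/3 then Theta_series s s s x
                    else remove_sings (theta_main x (nat \<lceil>2 - 2 * Re s\<rceil>)) s)"

lemma Theta_series_analytic:
  assumes x: "x > 0" and s: "Re s > 2/3"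
  shows "(\<lambda>s. Theta_series s s s x) analytic_on {s}"
proof -
  have "(\<lambda>s. Theta_series s s s x) analytic_on {s. Re s > 2/3}"
    using Theta_series_holomorphic[OF x] unfolding analytic_on_open[OF open_Re_gt] .
  thus ?thesis by (rule analytic_on_subset) (use s in auto)
qed

text \<open>Any two strips contain 2/3 < Re s < 1, where both expressions equal the series; the
  identity theorem on their connected intersection gives agreement.\<close>

lemma theta_ext_eq_remove_sings:
  assumes x: "x > 0" and s: "s \<in> theta_strip K"
  shows "theta_ext x s = remove_sings (theta_main x K) s"
proof (cases "Re s > 2/3")
  case True
  define A where "A = {s. 2/3 < Re s \<and> Re s < 1}"
  have A: "open A" unfolding A_def by (intro open_Collect_less open_Collect_conj continuous_intros)
  have sA: "s \<in> A" using True s by (auto simp: A_def theta_strip_def)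
  have "eventually (\<lambda>w. w \<in> A) (at s)" using A sA by (intro eventually_at_in_open')
  hence "eventually (\<lambda>w. theta_main x K w = Theta_series w w w x) (at s)"
    by eventually_elim (use x Theta_series_eq_theta_main in \<open>auto simp: A_def\<close>)
  hence "remove_sings (theta_main x K) s = remove_sings (\<lambda>w. Theta_series w w w x) s"
    by (rule remove_sings_cong) simp
  also have "\<dots> = Theta_series s s s x"
    by (intro remove_sings_at_analytic Theta_series_analytic x True)
  finally show ?thesis using True by (simp add: theta_ext_def)
next
  case False
  define K' where "K' = nat \<lceil>2 - 2 * Re s\<rceil>"
  have "1 - 2 * Re s < real K'" using False unfolding K'_def by linarith
  hence s': "s \<in> theta_strip K'" using s by (simp add: theta_strip_def field_simps)
  define S where "S = {s. max ((1 - real K) / 2) ((1 - real K') / 2) < Re s} \<inter> {s. Re s < 1}"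
  define A where "A = {s. 2/3 < Re s \<and> Re s < 1}"
  have S: "open S" unfolding S_def by (intro open_Int open_Re_gt open_Re_lt)
  have SK: "S \<subseteq> theta_strip K" "S \<subseteq> theta_strip K'" by (auto simp: S_def theta_strip_def)
  have "eventually (\<lambda>w. theta_main x K w = theta_main x K' w) (at s)"
  proof (rule meromorphic_identity)
    show "theta_main x K meromorphic_on S" "theta_main x K' meromorphic_on S"
      using theta_main_meromorphic[OF x] SK meromorphic_on_subset by blast+
    show "connected S"
      unfolding S_def by (intro convex_connected convex_Int convex_halfspace_Re_gt convex_halfspace_Re_lt)
    show "open A" unfolding A_def by (intro open_Collect_less open_Collect_conj continuous_intros)
    show "A \<noteq> {}" by (auto simp: A_def intro!: exI[of _ "5/6"])
    show "A \<subseteq> S" by (auto simp: A_def S_def field_simps)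
    show "s \<in> S" using s s' by (auto simp: S_def theta_strip_def)
    fix w assume "w \<in> A"
    thus "theta_main x K w = theta_main x K' w"
      using Theta_series_eq_theta_main[OF x] by (auto simp: A_def)
  qed (use S in auto)
  hence "remove_sings (theta_main x K) s = remove_sings (theta_main x K') s"
    by (rule remove_sings_cong) simp
  thus ?thesis using False by (simp add: theta_ext_def K'_def)
qed

lemma exists_theta_strip:
  assumes "Re s < 1"
  obtains K where "s \<in> theta_strip K"
proof (rule that[of "nat \<lceil>2 - 2 * Re s\<rceil>"])
  have "1 - 2 * Re s < real (nat \<lceil>2 - 2 * Re s\<rceil>)" by linarith
  thus "s \<in> theta_strip (nat \<lceil>2 - 2 * Re s\<rceil>)" using assms by (simp add: theta_strip_def field_simps)
qed

lemma Theta_diag_eq_theta_ext: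
  assumes x: "x > 0"
  shows "Theta_diag x = theta_ext x"
  unfolding Theta_diag_def
proof (rule meromorphic_continuation_eqI)
  show "theta_ext x nicely_meromorphic_on UNIV"
  proof (rule nicely_meromorphic_on_UNIV_local)
    fix z
    show "\<exists>S g. open S \<and> z \<in> S \<and> g nicely_meromorphic_on S \<and> (\<forall>w\<in>S. theta_ext x w = g w)"
    proof (cases "Re z > 2/3")
      case True
      have "(\<lambda>s. Theta_series s s s x) nicely_meromorphic_on {s. Re s > 2/3}"
        using Theta_series_holomorphic[OF x] unfolding analytic_on_open[OF open_Re_gt, symmetric]
        by (rule analytic_on_imp_nicely_meromorphic_on)
      thus ?thesis using True
        by (intro exI[of _ "{s. Re s > 2/3}"] exI[of _ "\<lambda>s. Theta_series s s s x"] conjI open_Re_gt)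
           (auto simp: theta_ext_def)
    next
      case False
      then obtain K where K: "z \<in> theta_strip K" using exists_theta_strip[of z] by auto
      thus ?thesis
        using theta_ext_eq_remove_sings[OF x] remove_sings_nicely_meromorphic[OF theta_main_meromorphic[OF x, of K]]
        by (intro exI[of _ "theta_strip K"] exI[of _ "remove_sings (theta_main x K)"]) (auto simp: open_theta_strip)
    qed
  qed
  show "{s. Re s > 2/3} \<noteq> {}" by (auto intro!: exI[of _ 1])
qed (use open_Re_gt[of "2/3"] in \<open>auto simp: theta_ext_def\<close>)

lemma eventually_Theta_diag_eq:
  assumes x: "x > 0" and s: "s \<in> theta_strip K"
  shows "eventually (\<lambda>w. Theta_diag x w = theta_main x K w) (at s)"
proof -
  have "eventually (\<lambda>w. w \<in> theta_strip K) (at s)"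
    using s open_theta_strip by (intro eventually_at_in_open')
  moreover have "isolated_singularity_at (theta_main x K) s"
    using theta_main_meromorphic[OF x, of K] s by (auto simp: meromorphic_on_altdef)
  hence "eventually (\<lambda>w. remove_sings (theta_main x K) w = theta_main x K w) (at s)"
    by (rule eventually_remove_sings_eq_at)
  ultimately show ?thesis
    by eventually_elim (simp add: Theta_diag_eq_theta_ext[OF x] theta_ext_eq_remove_sings[OF x])
qed

lemma Theta_diag_analytic:
  assumes x: "x > 0" and s: "s \<noteq> 2/3" "\<And>j. s \<noteq> 1/2 - of_nat j"
  shows "Theta_diag x analytic_on {s}"
proof (cases "Re s > 2/3")
  case True
  have an: "(\<lambda>s. Theta_series s s s x) analytic_on {s}"
    by (rule Theta_series_analytic[OF x True])
  have "eventually (\<lambda>w. w \<in> {s. Re s > 2/3}) (nhds s)"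
    using True by (intro eventually_nhds_in_open open_Re_gt) auto
  hence ev: "eventually (\<lambda>w. Theta_diag x w = Theta_series w w w x) (nhds s)"
    by eventually_elim (simp add: Theta_diag_eq_theta_ext[OF x] theta_ext_def)
  show ?thesis using an analytic_at_cong[OF ev refl] by blast
next
  case False
  then obtain K where K: "s \<in> theta_strip K" using exists_theta_strip[of s] by auto
  have nz: "3 * s - 2 \<noteq> 0" using s(1) by (simp add: field_simps)
  have "2 * s - 1 + of_nat k \<noteq> 0" if "even k" for k
  proof
    assume "2 * s - 1 + of_nat k = 0"
    moreover obtain j where "k = 2 * j" using \<open>even k\<close> by (elim evenE)
    ultimately have "2 * (s - (1/2 - of_nat j)) = 0" by (simp add: algebra_simps)
    hence "s - (1/2 - of_nat j) = 0" by (subst (asm) mult_eq_0_iff) simp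
    thus False using s(2)[of j] by (metis eq_iff_diff_eq_0)
  qed
  hence part: "theta_part x K {..<K} analytic_on {s}"
    by (intro theta_part_analytic[OF x K])
  note comp = theta_components_analytic[OF x]
  have gam: "(\<lambda>s. Gamma (1 - s)) analytic_on {s}"
    using comp(4)[of K] K analytic_on_subset by blast
  have "theta_main x K analytic_on {s}"
    unfolding theta_main_def[abs_def]
    by (intro analytic_on_add analytic_on_mult analytic_on_divide analytic_on_power part comp(1,6) gam)
       (use nz in \<open>auto intro!: analytic_intros\<close>)
  hence an: "remove_sings (theta_main x K) analytic_on {s}" by (rule remove_sings_analytic_on)
  have "eventually (\<lambda>w. w \<in> theta_strip K) (nhds s)"
    using K by (intro eventually_nhds_in_open open_theta_strip)
  hence ev: "eventually (\<lambda>w. Theta_diag x w = remove_sings (theta_main x K) w) (nhds s)"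
    by eventually_elim (simp add: Theta_diag_eq_theta_ext[OF x] theta_ext_eq_remove_sings[OF x])
  show ?thesis using an analytic_at_cong[OF ev refl] by blast
qed

section \<open>Residues\<close>

text \<open>The difference quotient of \<phi> at a has a limit, hence the bounded remainder. If F
  were analytic, (s - a) F(s) would tend to 0, but it tends to \<phi>(a).\<close>

lemma simple_pole:
  assumes \<phi>: "\<phi> analytic_on {a}" and \<psi>: "\<psi> analytic_on {a}"
    and F: "eventually (\<lambda>s. F s = \<phi> s / (s - a) + \<psi> s) (at a)"
  shows "(\<lambda>s. F s - \<phi> a / (s - a)) \<in> O[at a](\<lambda>_. 1)" (is ?A)
    and "\<phi> a \<noteq> 0 \<Longrightarrow> \<not> F analytic_on {a}"
proof -
  have \<psi>_lim: "\<psi> \<midarrow>a\<rightarrow> \<psi> a" using analytic_at_imp_isCont[OF \<psi>] by (rule isContD)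
  have \<phi>_lim: "\<phi> \<midarrow>a\<rightarrow> \<phi> a" using analytic_at_imp_isCont[OF \<phi>] by (rule isContD)
  obtain d where "(\<phi> has_field_derivative d) (at a)"
    using \<phi> by (metis analytic_at holomorphic_derivI)
  hence "(\<lambda>s. (\<phi> s - \<phi> a) / (s - a)) \<midarrow>a\<rightarrow> d" by (simp add: has_field_derivative_iff)
  hence "(\<lambda>s. (\<phi> s - \<phi> a) / (s - a) + \<psi> s) \<midarrow>a\<rightarrow> d + \<psi> a" by (intro tendsto_add \<psi>_lim)
  moreover have "eventually (\<lambda>s. (\<phi> s - \<phi> a) / (s - a) + \<psi> s = (F s - \<phi> a / (s - a)) / 1) (at a)"
    using F by eventually_elim (simp add: diff_divide_distrib)
  ultimately have "(\<lambda>s. (F s - \<phi> a / (s - a)) / 1) \<midarrow>a\<rightarrow> d + \<psi> a"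
    by (rule Lim_transform_eventually)
  thus ?A
    by (rule bigoI_tendsto) auto
  assume nz: "\<phi> a \<noteq> 0"
  show "\<not> F analytic_on {a}"
  proof
    assume "F analytic_on {a}"
    hence "F \<midarrow>a\<rightarrow> F a" using analytic_at_imp_isCont isContD by blast
    hence "(\<lambda>s. (s - a) * F s) \<midarrow>a\<rightarrow> (a - a) * F a" by (intro tendsto_intros)
    moreover have "eventually (\<lambda>s. (s - a) * F s = \<phi> s + (s - a) * \<psi> s) (at a)"
      using F eventually_neq_at_within[of a a UNIV]
      by eventually_elim (simp add: field_simps)
    ultimately have "(\<lambda>s. \<phi> s + (s - a) * \<psi> s) \<midarrow>a\<rightarrow> (a - a) * F a"
      by (rule Lim_transform_eventually)
    moreover have "(\<lambda>s. \<phi> s + (s - a) * \<psi> s) \<midarrow>a\<rightarrow> \<phi> a + (a - a) * \<psi> a"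
      by (intro tendsto_intros \<phi>_lim \<psi>_lim)
    ultimately have "(a - a) * F a = \<phi> a + (a - a) * \<psi> a"
      by (rule tendsto_unique[rotated]) simp
    thus False using nz by simp
  qed
qed

text \<open>Reflection gives Gamma(1/3) Gamma(2/3) = 2 pi / sqrt 3. The divisor 3 on the left comes
  from 3s - 2 = 3(s - 2/3).\<close>

lemma Gamma_third:
  "rGamma (2/3) * Gamma (1/3 :: real) ^ 2 / 3 = Gamma (1/3) ^ 3 / (2 * sqrt 3 * pi)"
proof -
  have "complex_of_real (Gamma (1/3) * Gamma (2/3)) = Gamma (1/3) * Gamma (1 - 1/3)"
    by (simp add: Gamma_complex_of_real [symmetric])
  also have "\<dots> = of_real pi / sin (of_real pi * (1/3))" by (rule Gamma_reflection_complex)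
  also have "sin (of_real pi * (1/3)) = complex_of_real (sin (pi / 3))"
    by (simp add: sin_of_real [symmetric])
  finally have "complex_of_real (Gamma (1/3) * Gamma (2/3)) = of_real (pi / (sqrt 3 / 2))"
    by (simp add: sin_60)
  hence G: "Gamma (1/3) * Gamma (2/3) = pi / (sqrt 3 / 2)" by (simp only: of_real_eq_iff)
  define g1 g2 :: real where "g1 = Gamma (1/3)" and "g2 = Gamma (2/3)"
  have pos: "g1 > 0" "g2 > 0" unfolding g1_def g2_def by (intro Gamma_real_pos; simp)+
  have s3: "sqrt 3 * sqrt 3 = (3::real)" by simp
  have "g1 * g2 = 2 * pi / sqrt 3" using G by (simp add: g1_def g2_def)
  hence G': "inverse g2 = sqrt 3 * g1 / (2 * pi)"
    using pos by (simp add: field_simps)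
  have "inverse g2 * g1 ^ 2 / 3 = sqrt 3 * g1 ^ 3 / (2 * pi * (sqrt 3 * sqrt 3))"
    unfolding G' s3 by (simp add: power2_eq_square power3_eq_cube)
  also have "\<dots> = g1 ^ 3 / (2 * sqrt 3 * pi)"
  proof -
    have "r * g / (2 * pi * (r * r)) = g / (2 * r * pi)" if "r \<noteq> 0" for r g :: real
      using that by (simp add: field_simps)
    from this[of "sqrt 3"] show ?thesis by fastforce
  qed
  finally show ?thesis by (simp add: g1_def g2_def rGamma_inverse_Gamma)
qed

text \<open>Each step from j to j + 1 multiplies by -(1/2+j)^2. In the residue one factor (2j)!
  cancels against the factorial in \<open>zcoeff (2 * j)\<close>, and the central binomial
  coefficient remains.\<close>

lemma Gamma_half_quotient:
  "Gamma (1/2 + of_nat j) * rGamma (1/2 - of_nat j :: complex) = (-1) ^ j * fact (2 * j) ^ 2 / (16 ^ j * fact j ^ 2)"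
proof (induction j)
  case 0
  have "(1/2 :: complex) \<notin> \<int>\<^sub>\<le>\<^sub>0" by (auto elim!: nonpos_Ints_cases simp: complex_eq_iff)
  thus ?case by (simp add: rGamma_inverse_Gamma Gamma_eq_zero_iff)
next
  case (Suc j)
  define h where "h = 1/2 + complex_of_nat j"
  have "Re h > 0" by (simp add: h_def)
  hence "h \<notin> \<int>\<^sub>\<le>\<^sub>0" by (auto elim!: nonpos_Ints_cases)
  hence 1: "Gamma (1/2 + of_nat (Suc j)) = h * Gamma h"
    using Gamma_plus1[of h] by (simp add: h_def add_ac)
  have 2: "rGamma (1/2 - of_nat (Suc j)) = - h * rGamma (1/2 - of_nat j)"
    using rGamma_plus1[of "1/2 - complex_of_nat (Suc j)"] by (simp add: h_def algebra_simps)
  have "Gamma (1/2 + of_nat (Suc j)) * rGamma (1/2 - of_nat (Suc j)) = - (h ^ 2) * (Gamma h * rGamma (1/2 - of_nat j))"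
    unfolding 1 2 by (simp add: power2_eq_square)
  also have "Gamma h * rGamma (1/2 - of_nat j) = (-1) ^ j * fact (2 * j) ^ 2 / (16 ^ j * fact j ^ 2)"
    using Suc.IH by (simp add: h_def)
  also have "- (h ^ 2) * \<dots> = (-1) ^ Suc j * fact (2 * Suc j) ^ 2 / (16 ^ Suc j * fact (Suc j) ^ 2)"
  proof -
    define c where "c = of_nat j + (1::complex)"
    have c: "c \<noteq> 0" unfolding c_def using of_nat_neq_0[of j] by (simp add: add.commute)
    have f2: "fact (2 * Suc j) = (2 * c) * ((2 * h) * (fact (2 * j) :: complex))"
      by (simp add: c_def h_def algebra_simps)
    have f1: "fact (Suc j) = c * (fact j :: complex)" by (simp add: c_def add.commute)
    show ?thesis unfolding f1 f2 using c by (simp add: field_simps power2_eq_square)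
  qed
  finally show ?case .
qed

lemma Theta_diag_at_two_thirds:
  assumes x: "x > 0"
  defines "C \<equiv> Gamma (1/3) ^ 3 / (2 * sqrt 3 * pi * x powr (1/3))"
  shows "(\<lambda>s. Theta_diag x s - of_real C / (s - 2/3)) \<in> O[at (2/3)](\<lambda>_. 1)" (is ?A)
    and "\<not> Theta_diag x analytic_on {2/3}"
proof -
  define \<phi> where "\<phi> s = rGamma s * Gamma (1 - s) ^ 2 * of_real x powr (s - 1) / 3" for s :: complex
  \<comment> \<open>No Taylor term is needed here: for K = 0 the strip is 1/2 < Re s < 1, and all
    sums are empty.\<close>
  have strip: "2/3 \<in> theta_strip 0" by (simp add: theta_strip_def)
  note comp = theta_components_analytic[OF x]
  have "(\<lambda>s. Gamma (1 - s)) analytic_on {2/3}"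
    using comp(4)[of 0] strip analytic_on_subset by blast
  hence \<phi>: "\<phi> analytic_on {2/3}" unfolding \<phi>_def[abs_def] by (intro analytic_intros comp) auto
  have \<psi>: "theta_part x 0 {..<0} analytic_on {2/3}"
    by (intro theta_part_analytic[OF x strip]) auto
  have F: "eventually (\<lambda>s. Theta_diag x s = \<phi> s / (s - 2/3) + theta_part x 0 {..<0} s) (at (2/3))"
    using eventually_Theta_diag_eq[OF x strip]
  proof eventually_elim
    case (elim s)
    have "\<phi> s / (s - 2/3) = rGamma s * Gamma (1 - s) ^ 2 * of_real x powr (s - 1) / (3 * s - 2)"
      by (simp add: \<phi>_def algebra_simps)
    thus ?case using elim by (simp add: theta_main_def)
  qed
  have "\<phi> (2/3) = of_real (rGamma (2/3) * Gamma (1/3) ^ 2 / 3 * x powr (-1/3))"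
    using powr_of_real[of x "-1/3"] x
    by (simp add: \<phi>_def Gamma_complex_of_real [symmetric] rGamma_complex_of_real [symmetric])
  also have "rGamma (2/3) * Gamma (1/3) ^ 2 / 3 * x powr (-1/3) = C"
  proof -
    have "x powr (-1/3) = inverse (x powr (1/3))"
      using powr_minus[of x "1/3"] by simp
    thus ?thesis unfolding Gamma_third C_def by (simp only: divide_inverse inverse_mult_distrib mult.assoc)
  qed
  finally have \<phi>C: "\<phi> (2/3) = of_real C" .
  have "C > 0" unfolding C_def using x by (auto intro!: divide_pos_pos mult_pos_pos Gamma_real_pos)
  thus "\<not> Theta_diag x analytic_on {2/3}"
    using simple_pole(2)[OF \<phi> \<psi> F] \<phi>C by simp
  show ?A
    using simple_pole(1)[OF \<phi> \<psi> F] unfolding \<phi>C .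
qed

lemma Theta_diag_at_half:
  fixes x :: real and j :: nat
  assumes x: "x > 0"
  defines "C \<equiv> (-1) ^ j * 2 powi (- 4 * int j - 1) * real ((2 * j) choose j) * (x ^ (2 * j) + x powr (- 1/2 - real j))"
  shows "(\<lambda>s. Theta_diag x s - of_real C * (Riemann_zeta ((1 - 6 * of_nat j) / 2) / (s - (1/2 - of_nat j))))
           \<in> O[at (1/2 - of_nat j)](\<lambda>_. 1)" (is ?A)
    and "\<not> Theta_diag x analytic_on {1/2 - of_nat j}" (is ?B)
proof -
  define a where "a = 1/2 - complex_of_nat j"
  \<comment> \<open>Any K > 2j puts 1/2 - j into the strip and includes the index 2j responsible for
    the pole.\<close>
  define K where "K = 2 * j + 2"
  define I where "I = {..<K} - {2 * j}"
  \<comment> \<open>The term k = 2j without its denominator 2s - 1 + 2j = 2(s - a); the 2 is kept as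
    the final divisor.\<close>
  define \<phi> where "\<phi> s = Gamma (1 - s) * zcoeff (2 * j) s * (of_real x ^ (2 * j) + of_real x powr (s - 1)) * rGamma s / 2" for s
  define \<psi> where "\<psi> s = theta_part x K I s + rGamma s * Gamma (1 - s) ^ 2 * of_real x powr (s - 1) / (3 * s - 2)" for s
  have strip: "a \<in> theta_strip K" by (simp add: theta_strip_def a_def K_def)
  note comp = theta_components_analytic[OF x]
  have at_a: "f analytic_on {a}" if "f analytic_on theta_strip K" for f
    using that strip analytic_on_subset[of f "theta_strip K" "{a}"] by blast
  have \<phi>: "\<phi> analytic_on {a}"
    unfolding \<phi>_def[abs_def] by (intro analytic_intros comp at_a[OF comp(4)] at_a[OF comp(5)]) auto
  have "3 * a - 2 \<noteq> 0"
  proof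
    assume "3 * a - 2 = 0"
    hence "Re (3 * a - 2) = 0" by simp
    thus False by (simp add: a_def)
  qed
  moreover have "2 * a - 1 + of_nat k \<noteq> 0" if "k \<in> I" for k
  proof
    assume "2 * a - 1 + of_nat k = 0"
    hence "complex_of_nat k = of_nat (2 * j)" by (simp add: a_def algebra_simps)
    hence "k = 2 * j" by (simp only: of_nat_eq_iff)
    thus False using that by (simp add: I_def)
  qed
  ultimately have \<psi>: "\<psi> analytic_on {a}"
    unfolding \<psi>_def[abs_def]
    by (intro analytic_intros comp at_a[OF comp(4)] theta_part_analytic[OF x strip]) auto
  have F: "eventually (\<lambda>s. Theta_diag x s = \<phi> s / (s - a) + \<psi> s) (at a)"
    using eventually_Theta_diag_eq[OF x strip]
  proof eventually_elim
    case (elim s)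
    have K_eq: "{..<K} = insert (2 * j) I" by (auto simp: I_def K_def)
    have "theta_part x K {..<K} s = theta_part x K I s +
            Gamma (1 - s) * zcoeff (2 * j) s * (of_real x ^ (2 * j) + of_real x powr (s - 1)) * theta_coeff (2 * j) s"
      unfolding theta_part_def K_eq by (subst sum.insert) (auto simp: I_def)
    moreover have "2 * s - 1 + of_nat (2 * j) = 2 * (s - a)" by (simp add: a_def algebra_simps)
    ultimately show ?case using elim by (simp add: theta_main_def \<psi>_def \<phi>_def theta_coeff_def)
  qed
  define Z where "Z = zt (1/2 - 3 * of_nat j)"
  have powi: "2 powi (- 4 * int j - 1) = (1 / (2 * 16 ^ j) :: real)"
  proof -
    have "2 powi (- 4 * int j - 1) = (2 powi (- int (4 * j + 1)) :: real)" by (rule arg_cong[of _ _ "(powi) 2"]) simp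
    also have "\<dots> = inverse (2 ^ (4 * j + 1))" by (simp only: power_int_minus power_int_of_nat)
    also have "(2::real) ^ (4 * j + 1) = 2 * 16 ^ j" by (simp add: power_mult)
    finally show ?thesis by (simp only: inverse_eq_divide)
  qed
  have xp: "complex_of_real x powr (a - 1) = of_real (x powr (- 1/2 - real j))"
    using powr_of_real[of x "- 1/2 - real j"] x by (simp add: a_def)
  have zc: "zcoeff (2 * j) a = Z / fact (2 * j)"
    by (simp add: zcoeff_def a_def Z_def algebra_simps)
  have "Gamma (1 - a) * rGamma a = Gamma (1/2 + of_nat j) * rGamma (1/2 - of_nat j)"
    by (simp add: a_def)
  also have "\<dots> = (-1) ^ j * fact (2 * j) ^ 2 / (16 ^ j * fact j ^ 2)" by (rule Gamma_half_quotient)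
  finally have GG: "Gamma (1 - a) * rGamma a = (-1) ^ j * fact (2 * j) ^ 2 / (16 ^ j * fact j ^ 2)" .
  have binom: "complex_of_nat ((2 * j) choose j) = fact (2 * j) / (fact j ^ 2)"
    using binomial_fact[of j "2 * j", where 'a = complex] by (simp add: power2_eq_square)
  have "\<phi> a = (Gamma (1 - a) * rGamma a) * (Z / fact (2 * j)) * (of_real x ^ (2 * j) + of_real x powr (a - 1)) / 2"
    unfolding \<phi>_def zc by (simp add: mult_ac)
  also have "\<dots> = of_real C * Z"
    unfolding GG xp C_def powi of_real_mult of_real_of_nat_eq binom
    by (simp add: field_simps power2_eq_square)
  finally have \<phi>C: "\<phi> a = of_real C * Z" .
  have RZ: "Riemann_zeta ((1 - 6 * of_nat j) / 2) = Z"
  proof -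
    have eq: "(1 - 6 * of_nat j) / 2 = 1/2 - 3 * complex_of_nat j" by (simp add: field_simps)
    show ?thesis unfolding eq Z_def by (rule Riemann_zeta_eq_zt) simp
  qed
  \<comment> \<open>Positivity excludes a cancellation between the two cross terms with index
    2j.\<close>
  have "x ^ (2 * j) + x powr (- 1/2 - real j) > 0" using x by (intro add_pos_pos) auto
  moreover have "(2 * j) choose j > 0" by (simp add: zero_less_binomial)
  ultimately have "C \<noteq> 0" unfolding C_def by (simp add: powi)
  hence "\<phi> a \<noteq> 0" unfolding \<phi>C using zt_nonzero[of j] by (simp add: Z_def)
  thus ?B
    using simple_pole(2)[OF \<phi> \<psi> F] by (simp add: a_def)
  show ?A
    using simple_pole(1)[OF \<phi> \<psi> F] unfolding \<phi>C RZ times_divide_eq_right unfolding a_def .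
qed

theorem theorem4p2:
  fixes x :: real
  assumes "x > 0"
  shows "singularities (Theta_diag x) = {2/3} \<union> {1/2 - of_nat j | j :: nat. True} \<and>
    (\<lambda>s. Theta_diag x s
           - of_real (Gamma (1/3) ^ 3 / (2 * sqrt 3 * pi * x powr (1/3))) / (s - 2/3))
      \<in> O[at (2/3)](\<lambda>_. 1) \<and>
    (\<forall>j::nat.
      (\<lambda>s. Theta_diag x s
             - of_real ((-1) ^ j * 2 powi (- 4 * int j - 1) * real ((2 * j) choose j)
                        * (x ^ (2 * j) + x powr (- 1/2 - real j)))
               * (Riemann_zeta ((1 - 6 * of_nat j) / 2) / (s - (1/2 - of_nat j))))
        \<in> O[at (1/2 - of_nat j)](\<lambda>_. 1))"
proof (intro conjI allI)
  show "singularities (Theta_diag x) = {2/3} \<union> {1/2 - of_nat j | j :: nat. True}"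
    unfolding singularities_def
    using Theta_diag_analytic[OF assms] Theta_diag_at_two_thirds(2)[OF assms] Theta_diag_at_half(2)[OF assms]
    by blast
qed (fact Theta_diag_at_two_thirds(1)[OF assms] Theta_diag_at_half(1)[OF assms])+

end
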